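(* Let $\Theta\subset\mathbb{R}^p$ be compact and convex with smooth boundary, $\theta_0$ an interior point of $\Theta$, and let $\Theta\to M(T)$, $\theta\mapsto\mu_\theta$, be continuous and belong to $C^2(\Theta;M(T))$ and to $C^3(\Theta;M(T))$. Suppose that for $\theta\in\Theta$, $\mathcal{K}\mu_\theta(t)=\mathcal{K}\mu_{\theta_0}(t)$ for all $t\in T$ implies $\theta=\theta_0$, and that the $p\times p$ matrix $\Sigma$ with entries $\Sigma_{ij}=\langle\partial_i\mu_{\theta_0},\mathcal{K}\partial_j\mu_{\theta_0}\rangle$ is regular (invertible). Consider a joint limit $\varepsilon\to0$, $n\to\infty$ (i.e. any sequence of pairs $(\varepsilon,n)$ with $\varepsilon\to0$ and $n\to\infty$) along which $\varepsilon^{-1}\|K^n-K\|_{L^\infty}\to0$. Let $\hat\theta_{n,\varepsilon}\in\Theta$ be a maximizer over $\Theta$ of the contrast function $\Phi_{n,\varepsilon}$. Then for any $q\in[1,\infty)$, in this limit, $$\varepsilon^{-1}(\hat\theta_{n,\varepsilon}-\theta_0)\to\Sigma^{-1}\langle\nabla_\theta\mu_{\theta_0},Z\rangle\quad\text{in }L^q\big((\Omega,\mathbb{P});\mathbb{R}^p\big),$$ $$\varepsilon^{-1}(\mu_{\hat\theta_{n,\varepsilon}}-\mu_{\theta_0})\to(\nabla_\theta\mu_{\theta_0})^{\mathsf T}\Sigma^{-1}\langle\nabla_\theta\mu_{\theta_0},Z\rangle\quad\text{in }L^q\big((\Omega,\mathbb{P});M(T)\big).$$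
   Context: $T=[0,\tau]$ is a closed bounded interval; $C(T)$ is the Banach space of continuous real functions on $T$ with the sup norm; $M(T)=C(T)^*$ is the space of finite signed Borel measures on $T$ with the total variation norm; $\langle\mu,x\rangle=\int_T x_t\,\mu(dt)$. $Z$ is a centered Gaussian vector on $C(T)$, i.e. a $C(T)$-valued random vector on a probability space $(\Omega,\mathbb{P})$ such that $\langle\mu,Z\rangle$ is a centered normal variable for every $\mu\in M(T)$. Its covariance function $K(s,t)=\mathrm{Cov}[Z_s,Z_t]$ is continuous on $T^2$ and its covariance operator $\mathcal{K}:M(T)\to C(T)$ is $(\mathcal{K}\mu)(s)=\int_T K(s,t)\,\mu(dt)$. For each $n\in\mathbb{N}$ let $0=t_0<t_1<\dots<t_n=\tau$ (points depending on $n$) with $\lim_{n\to\infty}\sup_{i}|t_i-t_{i-1}|=0$, and $T_1=[0,t_1]$, $T_i=(t_{i-1},t_i]$ for $i\ge2$. $K^n=\sum_{i,j=1}^nK(t_i,t_j)\mathbf{1}_{T_i\times T_j}$, and $\|\cdot\|_{L^\infty}$ is the norm of $L^\infty(T^2)$. With $h_0=\mathcal{K}\mu_{\theta_0}$ and $X^\varepsilon=h_0+\varepsilon Z$ ($\varepsilon>0$), $$\Phi_{n,\varepsilon}(\theta)=\sum_{i=1}^n\mu_\theta(T_i)X^\varepsilon_{t_i}-\frac12\sum_{i,j=1}^n\mu_\theta(T_i)\mu_\theta(T_j)K(t_i,t_j).$$ The maximizer $\hat\theta_{n,\varepsilon}$ is understood to be chosen as a random variable. $C^k(\Theta;M(T))$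 is the set of maps $\theta\mapsto\mu_\theta$ from $\Theta$ to $M(T)$ that are $k$ times Fréchet differentiable (total variation norm on $M(T)$) with uniformly continuous partial derivatives of order $k$; that is, differentiable in the interior of $\Theta$, with partial derivatives of order at most $k$ extending continuously to $\Theta$. $\partial_i=\partial/\partial\theta_i$, $\langle\nabla_\theta\mu_{\theta_0},Z\rangle=(\langle\partial_i\mu_{\theta_0},Z\rangle)_{i=1}^p\in\mathbb{R}^p$, and for $v\in\mathbb{R}^p$, $(\nabla_\theta\mu_{\theta_0})^{\mathsf T}v=\sum_{i=1}^pv_i\,\partial_i\mu_{\theta_0}\in M(T)$. Convergence $Y_k\to Y$ in $L^q((\Omega,\mathbb{P});E)$ for a Banach space $E$ means $\mathbb{E}\|Y_k-Y\|_E^q\to0$. *)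

theory Defs
  imports "HOL-Probability.Probability"
begin

section \<open>Finite signed Borel measures and the total variation norm\<close>

text \<open>
  A finite signed Borel measure is a bounded, countably additive real function on the Borel sets;
  off the Borel sets it is set to 0, so that equality is equality on Borel sets.  (Boundedness
  follows from countable additivity.)  All measures live on the real line; the measures
  on a subset are those carried by it, see \<open>measures_on\<close> below.
\<close>

typedef signed_measure =
  "{m :: real set \<Rightarrow> real.
      (\<forall>A. A \<notin> sets borel \<longrightarrow> m A = 0) \<and>
      (\<forall>A :: nat \<Rightarrow> real set. range A \<subseteq> sets borel \<longrightarrow> disjoint_family A \<longrightarrow>
          (\<lambda>i. m (A i)) sums m (\<Union>i. A i)) \<and>
      (\<exists>B. \<forall>A. \<bar>m A\<bar> \<le> B)}"
  morphisms sm Abs_signed_measure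
  by (rule exI[of _ "\<lambda>_. 0"]) auto

setup_lifting type_definition_signed_measure

lemma sm_not_borel: "A \<notin> sets borel \<Longrightarrow> sm m A = 0"
  using sm[of m] by simp

lemma sm_eqI: "(\<And>A. A \<in> sets borel \<Longrightarrow> sm m A = sm n A) \<Longrightarrow> m = n"
  by (metis ext sm_inject sm_not_borel)

lemma sm_sums:
  "range A \<subseteq> sets borel \<Longrightarrow> disjoint_family (A :: nat \<Rightarrow> real set) \<Longrightarrow>
    (\<lambda>i. sm m (A i)) sums sm m (\<Union>i. A i)"
  using sm[of m] by simp

lemma sm_bounded: "\<exists>B. \<forall>A. \<bar>sm m A\<bar> \<le> B"
  using sm[of m] by simp

lemma sm_empty [simp]: "sm m {} = 0"
proof -
  have "(\<lambda>i::nat. sm m {}) sums sm m (\<Union>i::nat. {})"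
    by (rule sm_sums) (auto simp: disjoint_family_on_def)
  then have "summable (\<lambda>i::nat. sm m {})" by (rule sums_summable)
  then show ?thesis by (simp add: summable_const_iff)
qed

lemma sm_Un:
  assumes "A \<in> sets borel" "B \<in> sets borel" "A \<inter> B = {}"
  shows "sm m (A \<union> B) = sm m A + sm m B"
proof -
  have r: "range (binaryset A B) \<subseteq> sets borel"
    using assms by (auto simp: binaryset_def)
  have d: "disjoint_family (binaryset A B)"
    using assms by (auto simp: disjoint_family_on_def binaryset_def)
  have "(\<lambda>i. sm m (binaryset A B i)) sums sm m (\<Union>i. binaryset A B i)"
    by (rule sm_sums[OF r d])
  moreover have "(\<lambda>i. sm m (binaryset A B i)) sums (sm m A + sm m B)"
    using binaryset_sums[of "sm m" A B] by simp
  ultimately show ?thesis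
    by (metis sums_unique2 UN_binaryset_eq)
qed

lemma sm_Union:
  assumes "finite P" "P \<subseteq> sets borel" "disjoint P"
  shows "sm m (\<Union>P) = (\<Sum>A\<in>P. sm m A)"
  using assms
proof (induction P rule: finite_induct)
  case (insert A P)
  have "A \<inter> \<Union>P = {}"
    using insert.prems insert.hyps by (auto simp: disjoint_def)
  moreover have "\<Union>P \<in> sets borel"
    using insert.prems insert.hyps by (intro sets.finite_Union) auto
  ultimately have "sm m (\<Union>(insert A P)) = sm m A + sm m (\<Union>P)"
    using insert.prems by (simp add: sm_Un)
  then show ?case
    using insert by (simp add: disjoint_def)
qed simp

lemma sm_Diff:
  assumes "A \<in> sets borel" "B \<in> sets borel" "B \<subseteq> A"
  shows "sm m (A - B) = sm m A - sm m B"
  using sm_Un[of B "A - B" m] assms by (simp add: Un_absorb1)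

definition borel_partitions :: "real set set set" where
  "borel_partitions = {P. finite P \<and> P \<subseteq> sets borel \<and> partition_on UNIV P}"

definition total_variation :: "(real set \<Rightarrow> real) \<Rightarrow> real" where
  "total_variation m = (SUP P\<in>borel_partitions. \<Sum>A\<in>P. \<bar>m A\<bar>)"

lemma UNIV_borel_partition: "{UNIV} \<in> borel_partitions"
  by (auto simp: borel_partitions_def partition_on_def disjoint_def)

lemma bdd_above_variation: "bdd_above ((\<lambda>P. \<Sum>A\<in>P. \<bar>sm m A\<bar>) ` borel_partitions)"
proof -
  obtain B where B: "\<And>A. \<bar>sm m A\<bar> \<le> B" using sm_bounded by blast
  have "(\<Sum>A\<in>P. \<bar>sm m A\<bar>) \<le> 2 * B" if P: "P \<in> borel_partitions" for P
  proof -
    let ?p = "{A\<in>P. sm m A \<ge> 0}" and ?n = "{A\<in>P. \<not> sm m A \<ge> 0}"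
    have fin: "finite P" and b: "P \<subseteq> sets borel" and d: "disjoint P"
      using P by (auto simp: borel_partitions_def partition_on_def)
    have "(\<Sum>A\<in>P. \<bar>sm m A\<bar>) = (\<Sum>A\<in>?p. \<bar>sm m A\<bar>) + (\<Sum>A\<in>?n. \<bar>sm m A\<bar>)"
      using fin by (subst sum.union_disjoint[symmetric]) (auto intro: sum.cong)
    also have "(\<Sum>A\<in>?p. \<bar>sm m A\<bar>) = sm m (\<Union>?p)"
      using fin b d by (subst sm_Union) (auto simp: disjoint_def)
    also have "(\<Sum>A\<in>?n. \<bar>sm m A\<bar>) = - sm m (\<Union>?n)"
      using fin b d
      by (subst sm_Union) (auto simp: disjoint_def sum_negf[symmetric] intro: sum.cong)
    also have "sm m (\<Union>?p) + - sm m (\<Union>?n) \<le> 2 * B"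
      using B[of "\<Union>?p"] B[of "\<Union>?n"] by linarith
    finally show ?thesis .
  qed
  then show ?thesis by (rule bdd_aboveI2)
qed

lemma variation_le:
  assumes "P \<in> borel_partitions"
  shows "(\<Sum>A\<in>P. \<bar>sm m A\<bar>) \<le> total_variation (sm m)"
  unfolding total_variation_def by (rule cSUP_upper[OF assms bdd_above_variation])

lemma total_variation_least:
  assumes "\<And>P. P \<in> borel_partitions \<Longrightarrow> (\<Sum>A\<in>P. \<bar>m A\<bar>) \<le> c"
  shows "total_variation m \<le> c"
  unfolding total_variation_def
  by (rule cSUP_least) (use UNIV_borel_partition assms in auto)

lemma abs_le_total_variation: "\<bar>sm m A\<bar> \<le> total_variation (sm m)"
proof (cases "A \<in> sets borel")
  case False
  have "0 \<le> \<bar>sm m UNIV\<bar>" by simp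
  also have "\<dots> \<le> total_variation (sm m)"
    using variation_le[OF UNIV_borel_partition, of m] by simp
  finally show ?thesis using False by (simp add: sm_not_borel)
next
  case True
  show ?thesis
  proof (cases "A = {} \<or> A = UNIV")
    case True
    then show ?thesis
      using variation_le[OF UNIV_borel_partition, of m] by auto
  next
    case False
    have "{A, -A} \<in> borel_partitions"
      using False \<open>A \<in> sets borel\<close>
      by (auto simp: borel_partitions_def partition_on_def disjoint_def Compl_eq_Diff_UNIV)
    from variation_le[OF this, of m] have "(\<Sum>B\<in>{A, -A}. \<bar>sm m B\<bar>) \<le> total_variation (sm m)" .
    moreover have "A \<noteq> -A" by auto
    ultimately show ?thesis by simp
  qed
qed

instantiation signed_measure :: real_normed_vector
begin

lift_definition zero_signed_measure :: signed_measure is "\<lambda>_. 0"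
  by auto

lift_definition plus_signed_measure :: "signed_measure \<Rightarrow> signed_measure \<Rightarrow> signed_measure"
  is "\<lambda>m n A. m A + n A"
proof -
  fix m n :: "real set \<Rightarrow> real"
  assume *: "(\<forall>A. A \<notin> sets borel \<longrightarrow> m A = 0) \<and>
      (\<forall>A :: nat \<Rightarrow> real set. range A \<subseteq> sets borel \<longrightarrow> disjoint_family A \<longrightarrow>
          (\<lambda>i. m (A i)) sums m (\<Union>i. A i)) \<and> (\<exists>B. \<forall>A. \<bar>m A\<bar> \<le> B)"
    "(\<forall>A. A \<notin> sets borel \<longrightarrow> n A = 0) \<and>
      (\<forall>A :: nat \<Rightarrow> real set. range A \<subseteq> sets borel \<longrightarrow> disjoint_family A \<longrightarrow>
          (\<lambda>i. n (A i)) sums n (\<Union>i. A i)) \<and> (\<exists>B. \<forall>A. \<bar>n A\<bar> \<le> B)"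
  then obtain B C where "\<And>A. \<bar>m A\<bar> \<le> B" "\<And>A. \<bar>n A\<bar> \<le> C" by blast
  then have "\<bar>m A + n A\<bar> \<le> B + C" for A
    by (meson abs_triangle_ineq add_mono order_trans)
  with * show "(\<forall>A. A \<notin> sets borel \<longrightarrow> m A + n A = 0) \<and>
      (\<forall>A :: nat \<Rightarrow> real set. range A \<subseteq> sets borel \<longrightarrow> disjoint_family A \<longrightarrow>
          (\<lambda>i. m (A i) + n (A i)) sums (m (\<Union>i. A i) + n (\<Union>i. A i))) \<and>
      (\<exists>B. \<forall>A. \<bar>m A + n A\<bar> \<le> B)"
    by (auto intro: sums_add)
qed

lift_definition scaleR_signed_measure :: "real \<Rightarrow> signed_measure \<Rightarrow> signed_measure"
  is "\<lambda>c m A. c * m A"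
proof -
  fix c :: real and m :: "real set \<Rightarrow> real"
  assume *: "(\<forall>A. A \<notin> sets borel \<longrightarrow> m A = 0) \<and>
      (\<forall>A :: nat \<Rightarrow> real set. range A \<subseteq> sets borel \<longrightarrow> disjoint_family A \<longrightarrow>
          (\<lambda>i. m (A i)) sums m (\<Union>i. A i)) \<and> (\<exists>B. \<forall>A. \<bar>m A\<bar> \<le> B)"
  then obtain B where "\<And>A. \<bar>m A\<bar> \<le> B" by blast
  then have "\<bar>c * m A\<bar> \<le> \<bar>c\<bar> * B" for A
    by (simp add: abs_mult mult_left_mono)
  with * show "(\<forall>A. A \<notin> sets borel \<longrightarrow> c * m A = 0) \<and>
      (\<forall>A :: nat \<Rightarrow> real set. range A \<subseteq> sets borel \<longrightarrow> disjoint_family A \<longrightarrow>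
          (\<lambda>i. c * m (A i)) sums (c * m (\<Union>i. A i))) \<and>
      (\<exists>B. \<forall>A. \<bar>c * m A\<bar> \<le> B)"
    by (auto intro: sums_mult)
qed

definition uminus_signed_measure :: "signed_measure \<Rightarrow> signed_measure" where
  "- m = (-1) *\<^sub>R m" for m :: signed_measure

definition minus_signed_measure :: "signed_measure \<Rightarrow> signed_measure \<Rightarrow> signed_measure" where
  "m - n = m + - n" for m n :: signed_measure

definition norm_signed_measure :: "signed_measure \<Rightarrow> real" where
  "norm m = total_variation (sm m)"

definition dist_signed_measure :: "signed_measure \<Rightarrow> signed_measure \<Rightarrow> real" where
  "dist m n = norm (m - n)" for m n :: signed_measure

definition sgn_signed_measure :: "signed_measure \<Rightarrow> signed_measure" where
  "sgn m = inverse (norm m) *\<^sub>R m" for m :: signed_measure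

definition uniformity_signed_measure :: "(signed_measure \<times> signed_measure) filter" where
  "uniformity = (INF e\<in>{0 <..}. principal {(x :: signed_measure, y). dist x y < e})"

definition open_signed_measure :: "signed_measure set \<Rightarrow> bool" where
  "open S = (\<forall>x\<in>S. \<forall>\<^sub>F (x', y) in uniformity. x' = x \<longrightarrow> y \<in> S)" for S :: "signed_measure set"

lemma sm_add: "sm (m + n) A = sm m A + sm n A"
  by transfer simp

lemma sm_scaleR: "sm (c *\<^sub>R m) A = c * sm m A"
  by transfer simp

lemma sm_zero: "sm 0 A = 0"
  by transfer simp

instance
proof
  fix m n k :: signed_measure and a b :: real
  show "dist m n = norm (m - n)" by (fact dist_signed_measure_def)
  show "sgn m = inverse (norm m) *\<^sub>R m" by (fact sgn_signed_measure_def)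
  show "(uniformity :: (signed_measure \<times> signed_measure) filter)
      = (INF e\<in>{0 <..}. principal {(x, y). dist x y < e})"
    by (fact uniformity_signed_measure_def)
  show "open S = (\<forall>x\<in>S. \<forall>\<^sub>F (x', y) in uniformity. x' = x \<longrightarrow> y \<in> S)"
    for S :: "signed_measure set" by (fact open_signed_measure_def)
  show "m + n + k = m + (n + k)" "m + n = n + m" "0 + m = m" "- m + m = 0" "m - n = m + - n"
    "a *\<^sub>R (m + n) = a *\<^sub>R m + a *\<^sub>R n" "(a + b) *\<^sub>R m = a *\<^sub>R m + b *\<^sub>R m"
    "a *\<^sub>R b *\<^sub>R m = (a * b) *\<^sub>R m" "1 *\<^sub>R m = m"
    by (auto intro!: sm_eqI
        simp: sm_add sm_scaleR sm_zero uminus_signed_measure_def minus_signed_measure_def algebra_simps)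
  show "(norm m = 0) = (m = 0)"
  proof
    assume "norm m = 0"
    then have "sm m A = 0" for A
      using abs_le_total_variation[of m A] by (simp add: norm_signed_measure_def)
    then show "m = 0" by (intro sm_eqI) (simp add: sm_zero)
  next
    assume "m = 0"
    moreover have "total_variation (sm 0) \<le> 0"
      by (rule total_variation_least) (simp add: sm_zero)
    moreover have "0 \<le> total_variation (sm 0)"
      using abs_le_total_variation[of 0 UNIV] by linarith
    ultimately show "norm m = 0" by (simp add: norm_signed_measure_def)
  qed
  show "norm (m + n) \<le> norm m + norm n"
    unfolding norm_signed_measure_def
  proof (rule total_variation_least)
    fix P assume P: "P \<in> borel_partitions"
    have "(\<Sum>A\<in>P. \<bar>sm (m + n) A\<bar>) \<le> (\<Sum>A\<in>P. \<bar>sm m A\<bar>) + (\<Sum>A\<in>P. \<bar>sm n A\<bar>)"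
      unfolding sum.distrib[symmetric] by (intro sum_mono) (simp add: sm_add)
    also have "\<dots> \<le> total_variation (sm m) + total_variation (sm n)"
      by (intro add_mono variation_le P)
    finally show "(\<Sum>A\<in>P. \<bar>sm (m + n) A\<bar>) \<le> \<dots>" .
  qed
  have le: "norm (c *\<^sub>R l) \<le> \<bar>c\<bar> * norm l" for c and l :: signed_measure
    unfolding norm_signed_measure_def
  proof (rule total_variation_least)
    fix P assume P: "P \<in> borel_partitions"
    have "(\<Sum>A\<in>P. \<bar>sm (c *\<^sub>R l) A\<bar>) = \<bar>c\<bar> * (\<Sum>A\<in>P. \<bar>sm l A\<bar>)"
      by (simp add: sm_scaleR abs_mult sum_distrib_left)
    also have "\<dots> \<le> \<bar>c\<bar> * total_variation (sm l)"
      by (intro mult_left_mono variation_le P) simp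
    finally show "(\<Sum>A\<in>P. \<bar>sm (c *\<^sub>R l) A\<bar>) \<le> \<dots>" .
  qed
  show "norm (a *\<^sub>R m) = \<bar>a\<bar> * norm m"
  proof (cases "a = 0")
    case True
    have "0 \<le> norm (a *\<^sub>R m)"
      using abs_le_total_variation[of "a *\<^sub>R m" UNIV] unfolding norm_signed_measure_def by linarith
    with le[of a m] True show ?thesis by simp
  next
    case False
    have "inverse a *\<^sub>R a *\<^sub>R m = m"
      using False by (intro sm_eqI) (simp add: sm_scaleR)
    with le[of "inverse a" "a *\<^sub>R m"] have "norm m \<le> inverse \<bar>a\<bar> * norm (a *\<^sub>R m)"
      by simp
    then have "\<bar>a\<bar> * norm m \<le> norm (a *\<^sub>R m)"
      using False by (simp add: field_simps)
    with le[of a m] show ?thesis by (rule antisym)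
  qed
qed

end

text \<open>The space $M(T)$: measures that vanish on every Borel set disjoint from \<open>T\<close>.\<close>

definition measures_on :: "real set \<Rightarrow> signed_measure set" where
  "measures_on T = {m. \<forall>A\<in>sets borel. A \<inter> T = {} \<longrightarrow> sm m A = 0}"

section \<open>Integration against a signed measure\<close>

text \<open>
  The positive part of the Jordan decomposition is $\mu^+(A) = \sup_{B \subseteq A} \mu(B)$;
  the negative part of \<open>m\<close> is the positive part of \<open>- m\<close>.
\<close>

definition positive_variation :: "signed_measure \<Rightarrow> real set \<Rightarrow> real" where
  "positive_variation m A = (SUP B\<in>{B \<in> sets borel. B \<subseteq> A}. sm m B)"

definition jordan_pos :: "signed_measure \<Rightarrow> real measure" where
  "jordan_pos m = measure_of UNIV (sets borel) (\<lambda>A. ennreal (positive_variation m A))"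

definition jordan_neg :: "signed_measure \<Rightarrow> real measure" where
  "jordan_neg m = jordan_pos (- m)"

definition pairing :: "real set \<Rightarrow> signed_measure \<Rightarrow> (real \<Rightarrow> real) \<Rightarrow> real" where
  "pairing T m x = (LINT t:T|jordan_pos m. x t) - (LINT t:T|jordan_neg m. x t)"

lemma bdd_above_sm: "bdd_above (sm m ` \<A>)"
  using sm_bounded[of m] by (metis abs_le_D1 bdd_aboveI2)

lemma sm_le_positive_variation:
  "B \<in> sets borel \<Longrightarrow> B \<subseteq> A \<Longrightarrow> sm m B \<le> positive_variation m A"
  unfolding positive_variation_def by (rule cSUP_upper[OF _ bdd_above_sm]) simp

lemma positive_variation_least:
  assumes "\<And>B. B \<in> sets borel \<Longrightarrow> B \<subseteq> A \<Longrightarrow> sm m B \<le> c"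
  shows "positive_variation m A \<le> c"
  unfolding positive_variation_def by (rule cSUP_least) (use assms in auto)

lemma positive_variation_nonneg: "0 \<le> positive_variation m A"
  using sm_le_positive_variation[of "{}" A m] by simp

lemma positive_variation_Un:
  assumes "A \<in> sets borel" "B \<in> sets borel" "A \<inter> B = {}"
  shows "positive_variation m (A \<union> B) = positive_variation m A + positive_variation m B"
proof (rule antisym)
  show "positive_variation m (A \<union> B) \<le> positive_variation m A + positive_variation m B"
  proof (rule positive_variation_least)
    fix C assume C: "C \<in> sets borel" "C \<subseteq> A \<union> B"
    have "sm m C = sm m ((C \<inter> A) \<union> (C \<inter> B))" using C by (metis Int_Un_distrib inf.absorb1)
    also have "\<dots> = sm m (C \<inter> A) + sm m (C \<inter> B)"
      using C assms by (intro sm_Un) auto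
    also have "\<dots> \<le> positive_variation m A + positive_variation m B"
      using C assms by (intro add_mono sm_le_positive_variation) auto
    finally show "sm m C \<le> positive_variation m A + positive_variation m B" .
  qed
  have "sm m C + sm m D \<le> positive_variation m (A \<union> B)"
    if "C \<in> sets borel" "C \<subseteq> A" "D \<in> sets borel" "D \<subseteq> B" for C D
  proof -
    have "sm m C + sm m D = sm m (C \<union> D)"
      using that assms by (intro sm_Un[symmetric]) auto
    then show ?thesis
      using that sm_le_positive_variation[of "C \<union> D" "A \<union> B" m] by auto
  qed
  then have "positive_variation m B \<le> positive_variation m (A \<union> B) - sm m C"
    if "C \<in> sets borel" "C \<subseteq> A" for C
    using that by (intro positive_variation_least) (smt (verit))
  then have "positive_variation m A \<le> positive_variation m (A \<union> B) - positive_variation m B"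
    by (intro positive_variation_least) (smt (verit))
  then show "positive_variation m A + positive_variation m B \<le> positive_variation m (A \<union> B)"
    by simp
qed

lemma positive_variation_mono: "A \<subseteq> B \<Longrightarrow> positive_variation m A \<le> positive_variation m B"
  by (rule positive_variation_least) (auto intro: sm_le_positive_variation)

lemma positive_variation_UN_lessThan:
  assumes "range A \<subseteq> sets borel" "disjoint_family (A :: nat \<Rightarrow> real set)"
  shows "positive_variation m (\<Union>i<n. A i) = (\<Sum>i<n. positive_variation m (A i))"
proof (induction n)
  case 0
  have "positive_variation m {} \<le> 0" by (rule positive_variation_least) auto
  then show ?case using positive_variation_nonneg[of m "{}"] by simp
next
  case (Suc n)
  have "A n \<inter> A i = {}" if "i < n" for i
    by (rule disjoint_family_onD[OF assms(2)]) (use that in auto)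
  then have "A n \<inter> (\<Union>i<n. A i) = {}" by blast
  moreover have "A i \<in> sets borel" for i using assms(1) by blast
  ultimately have "positive_variation m (A n \<union> (\<Union>i<n. A i))
      = positive_variation m (A n) + positive_variation m (\<Union>i<n. A i)"
    by (intro positive_variation_Un sets.finite_UN) simp_all
  then show ?case by (simp add: Suc lessThan_Suc)
qed

lemma positive_variation_sums:
  assumes A: "range A \<subseteq> sets borel" "disjoint_family (A :: nat \<Rightarrow> real set)"
  shows "(\<lambda>i. positive_variation m (A i)) sums positive_variation m (\<Union>i. A i)"
proof -
  let ?p = "positive_variation m"
  have part: "(\<Sum>i<n. ?p (A i)) \<le> ?p (\<Union>i. A i)" for n
    unfolding positive_variation_UN_lessThan[OF A, symmetric]
    by (rule positive_variation_mono) auto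
  have smm: "summable (\<lambda>i. ?p (A i))"
    by (rule summableI_nonneg_bounded[OF positive_variation_nonneg part])
  moreover have "(\<Sum>i. ?p (A i)) \<le> ?p (\<Union>i. A i)"
    by (rule suminf_le_const[OF smm part])
  moreover have "?p (\<Union>i. A i) \<le> (\<Sum>i. ?p (A i))"
  proof (rule positive_variation_least)
    fix B assume B: "B \<in> sets borel" "B \<subseteq> (\<Union>i. A i)"
    have "(\<lambda>i. sm m (B \<inter> A i)) sums sm m (\<Union>i. B \<inter> A i)"
      using A B by (intro sm_sums) (auto simp: disjoint_family_on_def)
    moreover have "(\<Union>i. B \<inter> A i) = B" using B by auto
    ultimately have s: "(\<lambda>i. sm m (B \<inter> A i)) sums sm m B" by simp
    have "sm m B = (\<Sum>i. sm m (B \<inter> A i))" by (rule sums_unique[OF s])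
    also have "\<dots> \<le> (\<Sum>i. ?p (A i))"
      using A B by (intro suminf_le sums_summable[OF s] smm sm_le_positive_variation) auto
    finally show "sm m B \<le> (\<Sum>i. ?p (A i))" .
  qed
  ultimately show ?thesis by (metis antisym summable_sums)
qed

lemma space_jordan_pos [simp]: "space (jordan_pos m) = UNIV"
  and sets_jordan_pos [simp]: "sets (jordan_pos m) = sets borel"
  unfolding jordan_pos_def
  using sets.sigma_sets_eq[of "borel :: real measure"] by (simp_all add: space_measure_of_conv)

lemma emeasure_jordan_pos:
  assumes "A \<in> sets borel"
  shows "emeasure (jordan_pos m) A = ennreal (positive_variation m A)"
proof (rule emeasure_measure_of[OF jordan_pos_def])
  show "positive (sets (jordan_pos m)) (\<lambda>A. ennreal (positive_variation m A))"
    using positive_variation_UN_lessThan[of "\<lambda>_. {}" m 0]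
    by (simp add: positive_def disjoint_family_on_def)
  show "countably_additive (sets (jordan_pos m)) (\<lambda>A. ennreal (positive_variation m A))"
  proof (rule countably_additiveI)
    fix A :: "nat \<Rightarrow> real set"
    assume "range A \<subseteq> sets (jordan_pos m)" "disjoint_family A"
    then have "(\<lambda>i. positive_variation m (A i)) sums positive_variation m (\<Union>i. A i)"
      by (intro positive_variation_sums) auto
    then show "(\<Sum>i. ennreal (positive_variation m (A i))) = ennreal (positive_variation m (\<Union>i. A i))"
      by (metis positive_variation_nonneg suminf_ennreal_eq)
  qed
qed (use assms in auto)

lemma sm_eq_jordan:
  assumes A: "A \<in> sets borel"
  shows "sm m A = measure (jordan_pos m) A - measure (jordan_neg m) A"
proof -
  let ?p = "positive_variation m A" and ?n = "positive_variation (- m) A"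
  have neg: "sm (- m) B = - sm m B" for B
    using sm_add[of "- m" m B] by (simp add: sm_zero)
  have "?p \<le> sm m A + ?n"
  proof (rule positive_variation_least)
    fix B assume "B \<in> sets borel" "B \<subseteq> A"
    then show "sm m B \<le> sm m A + ?n"
      using sm_le_positive_variation[OF sets.Diff[OF A], of B A "- m"] sm_Diff[OF A, of B m]
      by (simp add: neg)
  qed
  moreover have "?n \<le> ?p - sm m A"
  proof (rule positive_variation_least)
    fix B assume "B \<in> sets borel" "B \<subseteq> A"
    then show "sm (- m) B \<le> ?p - sm m A"
      using sm_le_positive_variation[OF sets.Diff[OF A], of B A m] sm_Diff[OF A, of B m]
      by (simp add: neg)
  qed
  ultimately have "sm m A = ?p - ?n" by simp
  then show ?thesis
    using A by (simp add: measure_def jordan_neg_def emeasure_jordan_pos positive_variation_nonneg)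
qed

section \<open>Differentiability classes\<close>

definition partial :: "'p \<Rightarrow> (real ^ 'p \<Rightarrow> 'b) \<Rightarrow> real ^ 'p \<Rightarrow> 'b::real_normed_vector" where
  "partial i f x = frechet_derivative f (at x) (axis i 1)"

definition partials :: "'p list \<Rightarrow> (real ^ 'p \<Rightarrow> 'b) \<Rightarrow> real ^ 'p \<Rightarrow> 'b::real_normed_vector" where
  "partials is f = foldr partial is f"

text \<open>
  Since the domain has finite dimension, a function is \<open>k\<close> times Frechet differentiable
  iff all its iterated partial derivatives of order less than \<open>k\<close> are Frechet differentiable.
\<close>

definition C_class :: "nat \<Rightarrow> (real ^ 'p) set \<Rightarrow> (real ^ 'p \<Rightarrow> 'b::real_normed_vector) \<Rightarrow> bool" where
  "C_class k \<Theta> f \<longleftrightarrow>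
    (\<forall>is. length is < k \<longrightarrow> (\<forall>x\<in>interior \<Theta>. partials is f differentiable (at x))) \<and>
    (\<forall>is. length is \<le> k \<longrightarrow>
      (\<exists>g. continuous_on \<Theta> g \<and> (\<forall>x\<in>interior \<Theta>. g x = partials is f x)))"

definition smooth_on :: "(real ^ 'p) set \<Rightarrow> (real ^ 'p \<Rightarrow> 'b::real_normed_vector) \<Rightarrow> bool" where
  "smooth_on U f \<longleftrightarrow> (\<forall>is. \<forall>x\<in>U. partials is f differentiable (at x))"

text \<open>
  Smooth means $C^\infty$: near each of its boundary points the set is
  the sublevel set of a smooth function with nonvanishing gradient.
\<close>

definition smooth_boundary :: "(real ^ 'p) set \<Rightarrow> bool" where
  "smooth_boundary \<Theta> \<longleftrightarrow>
    (\<forall>x\<in>frontier \<Theta>. \<exists>U (\<rho> :: real ^ 'p \<Rightarrow> real).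
        open U \<and> x \<in> U \<and> smooth_on U \<rho> \<and>
        (\<forall>y\<in>U. \<exists>i. partial i \<rho> y \<noteq> 0) \<and>
        \<Theta> \<inter> U = {y\<in>U. \<rho> y \<le> 0})"

section \<open>Gaussian vectors on the space of continuous functions\<close>

text \<open>
  \<open>cont_space \<tau>\<close> is $C(T)$ for $T = [0,\tau]$ with the sup metric; its elements are extensional,
  i.e. take an unspecified constant value outside $T$.
\<close>

abbreviation cont_space :: "real \<Rightarrow> (real \<Rightarrow> real) metric" where
  "cont_space \<tau> \<equiv> cfunspace (top_of_set {0..\<tau>}) euclidean_metric"

definition cont_borel :: "real \<Rightarrow> (real \<Rightarrow> real) measure" where
  "cont_borel \<tau> = sigma (mspace (cont_space \<tau>)) {U. openin (mtopology_of (cont_space \<tau>)) U}"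

text \<open>The point mass at 0 counts as a normal distribution (of variance 0).\<close>

definition centered_normal :: "'w measure \<Rightarrow> ('w \<Rightarrow> real) \<Rightarrow> bool" where
  "centered_normal P X \<longleftrightarrow>
    X \<in> borel_measurable P \<and>
    ((AE \<omega> in P. X \<omega> = 0) \<or> (\<exists>\<sigma>>0. distributed P lborel X (normal_density 0 \<sigma>)))"

definition centered_gaussian_vector :: "'w measure \<Rightarrow> real \<Rightarrow> ('w \<Rightarrow> real \<Rightarrow> real) \<Rightarrow> bool" where
  "centered_gaussian_vector P \<tau> Z \<longleftrightarrow>
    Z \<in> P \<rightarrow>\<^sub>M cont_borel \<tau> \<and>
    (\<forall>m\<in>measures_on {0..\<tau>}. centered_normal P (\<lambda>\<omega>. pairing {0..\<tau>} m (Z \<omega>)))"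

definition covariance :: "'w measure \<Rightarrow> ('w \<Rightarrow> real) \<Rightarrow> ('w \<Rightarrow> real) \<Rightarrow> real" where
  "covariance P X Y =
    (LINT \<omega>|P. (X \<omega> - (LINT \<omega>'|P. X \<omega>')) * (Y \<omega> - (LINT \<omega>'|P. Y \<omega>')))"

definition cov_kernel :: "'w measure \<Rightarrow> ('w \<Rightarrow> real \<Rightarrow> real) \<Rightarrow> real \<Rightarrow> real \<Rightarrow> real" where
  "cov_kernel P Z s t = covariance P (\<lambda>\<omega>. Z \<omega> s) (\<lambda>\<omega>. Z \<omega> t)"

definition cov_operator :: "real \<Rightarrow> (real \<Rightarrow> real \<Rightarrow> real) \<Rightarrow> signed_measure \<Rightarrow> real \<Rightarrow> real" where
  "cov_operator \<tau> K m s = pairing {0..\<tau>} m (K s)"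

section \<open>Discretisation and contrast function\<close>

definition partition_points :: "real \<Rightarrow> (nat \<Rightarrow> nat \<Rightarrow> real) \<Rightarrow> bool" where
  "partition_points \<tau> t \<longleftrightarrow>
    (\<forall>n\<ge>1. t n 0 = 0 \<and> t n n = \<tau> \<and> (\<forall>i\<in>{1..n}. t n (i - 1) < t n i)) \<and>
    (\<lambda>n. SUP i\<in>{1..n}. \<bar>t n i - t n (i - 1)\<bar>) \<longlonglongrightarrow> 0"

definition cell :: "(nat \<Rightarrow> nat \<Rightarrow> real) \<Rightarrow> nat \<Rightarrow> nat \<Rightarrow> real set" where
  "cell t n i = (if i = 1 then {0..t n 1} else {t n (i - 1)<..t n i})"

definition step_kernel ::
    "(nat \<Rightarrow> nat \<Rightarrow> real) \<Rightarrow> (real \<Rightarrow> real \<Rightarrow> real) \<Rightarrow> nat \<Rightarrow> real \<Rightarrow> real \<Rightarrow> real" where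
  "step_kernel t K n r s =
    (\<Sum>i=1..n. \<Sum>j=1..n. K (t n i) (t n j) * indicator (cell t n i \<times> cell t n j) (r, s))"

definition Linfty_norm :: "real set \<Rightarrow> (real \<Rightarrow> real \<Rightarrow> real) \<Rightarrow> ereal" where
  "Linfty_norm T f = esssup (restrict_space lborel (T \<times> T)) (\<lambda>(r, s). ereal \<bar>f r s\<bar>)"

definition contrast ::
    "(nat \<Rightarrow> nat \<Rightarrow> real) \<Rightarrow> (real \<Rightarrow> real \<Rightarrow> real) \<Rightarrow> ('v \<Rightarrow> signed_measure) \<Rightarrow>
      nat \<Rightarrow> (real \<Rightarrow> real) \<Rightarrow> 'v \<Rightarrow> real" where
  "contrast t K \<mu> n x \<theta> =
    (\<Sum>i=1..n. sm (\<mu> \<theta>) (cell t n i) * x (t n i))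
    - 1 / 2 * (\<Sum>i=1..n. \<Sum>j=1..n.
        sm (\<mu> \<theta>) (cell t n i) * sm (\<mu> \<theta>) (cell t n j) * K (t n i) (t n j))"

definition observation ::
    "real \<Rightarrow> (real \<Rightarrow> real \<Rightarrow> real) \<Rightarrow> signed_measure \<Rightarrow> ('w \<Rightarrow> real \<Rightarrow> real) \<Rightarrow>
      real \<Rightarrow> 'w \<Rightarrow> real \<Rightarrow> real" where
  "observation \<tau> K m\<^sub>0 Z \<epsilon> \<omega> s = cov_operator \<tau> K m\<^sub>0 s + \<epsilon> * Z \<omega> s"

definition fisher_matrix ::
    "real \<Rightarrow> (real \<Rightarrow> real \<Rightarrow> real) \<Rightarrow> (real ^ 'p \<Rightarrow> signed_measure) \<Rightarrow> real ^ 'p \<Rightarrow> real ^ 'p ^ 'p" where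
  "fisher_matrix \<tau> K \<mu> \<theta> =
    (\<chi> i j. pairing {0..\<tau>} (partial i \<mu> \<theta>) (cov_operator \<tau> K (partial j \<mu> \<theta>)))"

section \<open>Convergence in $L^q$\<close>

text \<open>
  Elements of $L^q((\Omega,P);E)$ are strongly measurable; the condition on separability of
  the range matters for $E = M(T)$.
\<close>

definition Lq_space :: "'w measure \<Rightarrow> real \<Rightarrow> ('w \<Rightarrow> 'b::real_normed_vector) set" where
  "Lq_space P q = {Y. Y \<in> borel_measurable P \<and>
    (\<exists>D. countable D \<and> Y ` space P \<subseteq> closure D) \<and>
    (\<integral>\<^sup>+ \<omega>. ennreal (norm (Y \<omega>) powr q) \<partial>P) < \<infinity>}"

definition tendsto_Lq ::
    "'w measure \<Rightarrow> real \<Rightarrow> (nat \<Rightarrow> 'w \<Rightarrow> 'b::real_normed_vector) \<Rightarrow> ('w \<Rightarrow> 'b) \<Rightarrow> bool" where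
  "tendsto_Lq P q Y L \<longleftrightarrow>
    (\<forall>k. Y k \<in> Lq_space P q) \<and> L \<in> Lq_space P q \<and>
    (\<lambda>k. \<integral>\<^sup>+ \<omega>. ennreal (norm (Y k \<omega> - L \<omega>) powr q) \<partial>P) \<longlonglongrightarrow> 0"

end

theory Submission
  imports Defs
begin

text \<open>
  Write $\nu = \mu_\theta - \mu_{\theta_0}$, let $\delta_n$ be the uniform distance of the step kernel
  from $K$, and let $\langle m\rangle_n$ be the discretised measure, which moves the mass of each cell into
  its right end point. Up to errors of order $\delta_n = o(\varepsilon)$ and a term that does not depend on
  $\theta$, the contrast at $\theta$ is
  $-\frac12\langle\nu,\mathcal K\nu\rangle + \varepsilon\langle\langle\nu\rangle_n, Z\rangle$.
  The quadratic term grows at least like $|\theta-\theta_0|^2$: far from $\theta_0$ by identifiability and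
  compactness, near $\theta_0$ because $\Sigma$ is positive semidefinite and regular
  (\<open>quadratic_growth\<close>). The noise term is at most $|\theta-\theta_0|$ times
  $s = \sum_i \sup_\theta |\langle\langle\partial_i\mu_\theta\rangle_n, Z\rangle|$. Comparing the contrast at
  its maximizer and at $\theta_0$ therefore gives
  $\varepsilon^{-1}|\hat\theta-\theta_0| \le C(1+s)$ with a constant $C$ (\<open>scaled_error_rate\<close>).

  This is used in two ways. For a fixed path of $Z$ the number $s$ is bounded, so that
  $\hat\theta\to\theta_0$ is eventually interior, and the first-order condition, divided by $\varepsilon$,
  becomes $\Sigma\,\varepsilon^{-1}(\hat\theta-\theta_0) \to \langle\nabla_\theta\mu_{\theta_0},Z\rangle$.
  Hence both limits hold for every sample point (\<open>pathwise_limits\<close>). Secondly, all moments of $s$ are bounded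
  uniformly in $n$ (\<open>scaled_error_moments\<close>), so that the pointwise limits hold in every $L^q$
  (\<open>tendsto_nn_integral_powr\<close>).

  The moments of $s$ do not require integrability of the norm of $Z$ (Fernique's theorem). The map
  $\theta\mapsto\langle\langle\partial_i\mu_\theta\rangle_n, Z\rangle$ is a Gaussian process on a bounded
  subset of $\mathbb R^p$, and because $\partial_i\mu$ is Lipschitz in total variation and
  $K$ is bounded, the moments of order $r$ of its increments are at most
  $C_r |\theta-\theta'|^r$ uniformly in $n$. A chaining argument with $r > 4p$ bounds the supremum
  (\<open>chaining\<close>).

  Pairings are handled as limits of Riemann sums over the given partitions
  (\<open>riemann_sum_tendsto\<close>), which makes linearity, symmetry and positivity of the form
  $\langle m,\mathcal K m'\rangle$ consequences of the finite dimensional case. The covariance is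
  continuous since for centered normal variables pointwise convergence to zero implies
  convergence of the variances (\<open>centered_normal_tendsto_zero\<close>).
\<close>

section \<open>Signed measures\<close>

lemma sm_minus: "sm (m - n) A = sm m A - sm n A"
  using sm_add[of "m - n" n A] by simp

lemma abs_sm_le_norm: "\<bar>sm m A\<bar> \<le> norm m"
  unfolding norm_signed_measure_def by (rule abs_le_total_variation)

lemma bounded_linear_sm: "bounded_linear (\<lambda>m. sm m A)"
  by (rule bounded_linear_intro[where K=1]) (auto simp: sm_add sm_scaleR abs_sm_le_norm)

lemma sum_abs_sm_le_norm:
  assumes I: "finite I" and A: "\<And>i. i \<in> I \<Longrightarrow> A i \<in> sets borel" and d: "disjoint_family_on A I"
  shows "(\<Sum>i\<in>I. \<bar>sm m (A i)\<bar>) \<le> norm m"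
proof -
  define J where "J = {i\<in>I. A i \<noteq> {}}"
  have J: "finite J" "J \<subseteq> I" using I by (auto simp: J_def)
  have inj: "inj_on A J"
  proof (rule inj_onI)
    fix i j assume "i \<in> J" "j \<in> J" "A i = A j"
    then show "i = j"
      using disjoint_family_onD[OF d, of i j] by (auto simp: J_def)
  qed
  define R where "R = - (\<Union>i\<in>J. A i)"
  have R: "R \<in> sets borel"
    unfolding R_def Compl_eq_Diff_UNIV using A J by (intro sets.Diff sets.finite_UN) auto
  define Q where "Q = A ` J \<union> ({R} - {{}})"
  have "Q \<in> borel_partitions"
    unfolding borel_partitions_def partition_on_def disjoint_def
  proof (intro CollectI conjI ballI impI)
    show "finite Q" using J by (simp add: Q_def)
    show "Q \<subseteq> sets borel" using A J R by (auto simp: Q_def)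
    have "x \<in> \<Union>Q" for x
    proof (cases "x \<in> R")
      case True
      then show ?thesis by (intro UnionI[of R]) (auto simp: Q_def)
    next
      case False
      then obtain i where "i \<in> J" "x \<in> A i" by (auto simp: R_def)
      then show ?thesis by (intro UnionI[of "A i"]) (auto simp: Q_def)
    qed
    then show "\<Union>Q = UNIV" by (simp only: set_eq_iff UNIV_I simp_thms)
    show "{} \<notin> Q" by (auto simp: Q_def J_def)
    have AA: "A i \<inter> A j = {}" if "i \<in> J" "j \<in> J" "A i \<noteq> A j" for i j
      using that J(2) by (intro disjoint_family_onD[OF d]) auto
    have RA: "R \<inter> A i = {}" if "i \<in> J" for i
      using that by (auto simp: R_def)
    fix a b assume "a \<in> Q" "b \<in> Q" and ne: "a \<noteq> b"
    then consider i j where "i \<in> J" "j \<in> J" "a = A i" "b = A j"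
      | i where "i \<in> J" "a = A i" "b = R" | j where "j \<in> J" "a = R" "b = A j"
      unfolding Q_def by blast
    then show "a \<inter> b = {}"
      by cases (use AA RA ne in \<open>simp_all add: Int_commute\<close>)
  qed
  from variation_le[OF this, of m] have "(\<Sum>B\<in>Q. \<bar>sm m B\<bar>) \<le> norm m"
    by (simp add: norm_signed_measure_def)
  moreover have "(\<Sum>B\<in>A ` J. \<bar>sm m B\<bar>) \<le> (\<Sum>B\<in>Q. \<bar>sm m B\<bar>)"
    by (rule sum_mono2) (use J in \<open>auto simp: Q_def\<close>)
  moreover have "(\<Sum>B\<in>A ` J. \<bar>sm m B\<bar>) = (\<Sum>i\<in>J. \<bar>sm m (A i)\<bar>)"
    by (simp add: sum.reindex[OF inj])
  moreover have "(\<Sum>i\<in>J. \<bar>sm m (A i)\<bar>) = (\<Sum>i\<in>I. \<bar>sm m (A i)\<bar>)"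
    by (rule sum.mono_neutral_left) (use I in \<open>auto simp: J_def\<close>)
  ultimately show ?thesis by simp
qed

text \<open>The unit point mass at \<open>s\<close>.\<close>

lift_definition point_mass :: "real \<Rightarrow> signed_measure" is
  "\<lambda>s A. if A \<in> sets borel then indicator A s else 0"
proof -
  fix s :: real
  let ?d = "\<lambda>A. if A \<in> sets borel then indicator A s else 0 :: real"
  have "(\<lambda>i. ?d (A i)) sums ?d (\<Union>i. A i)"
    if A: "range A \<subseteq> sets borel" "disjoint_family A" for A :: "nat \<Rightarrow> real set"
  proof -
    have "A i \<in> sets borel" for i using A(1) by blast
    moreover have "(\<lambda>i. indicator (A i) s :: real) sums indicator (\<Union>i. A i) s"
      by (rule indicator_sums) (use A(2) in \<open>auto simp: disjoint_family_on_def\<close>)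
    ultimately show ?thesis by simp
  qed
  moreover have "\<bar>?d A\<bar> \<le> 1" for A by (auto simp: indicator_def)
  ultimately show "(\<forall>A. A \<notin> sets borel \<longrightarrow> ?d A = 0) \<and>
      (\<forall>A :: nat \<Rightarrow> real set. range A \<subseteq> sets borel \<longrightarrow> disjoint_family A \<longrightarrow>
          (\<lambda>i. ?d (A i)) sums ?d (\<Union>i. A i)) \<and> (\<exists>B. \<forall>A. \<bar>?d A\<bar> \<le> B)"
    by (intro conjI) (simp, blast, blast)
qed

lemma sm_point_mass: "A \<in> sets borel \<Longrightarrow> sm (point_mass s) A = indicator A s"
  by transfer simp

lemma point_mass_in_measures_on: "s \<in> T \<Longrightarrow> point_mass s \<in> measures_on T"
  by (auto simp: measures_on_def sm_point_mass indicator_def)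

lemma measures_on_add: "m \<in> measures_on T \<Longrightarrow> n \<in> measures_on T \<Longrightarrow> m + n \<in> measures_on T"
  and measures_on_diff: "m \<in> measures_on T \<Longrightarrow> n \<in> measures_on T \<Longrightarrow> m - n \<in> measures_on T"
  and measures_on_scaleR: "m \<in> measures_on T \<Longrightarrow> c *\<^sub>R m \<in> measures_on T"
  and measures_on_zero: "0 \<in> measures_on T"
  by (auto simp: measures_on_def sm_add sm_minus sm_scaleR sm_zero)

lemma measures_on_sum: "(\<And>i. i \<in> I \<Longrightarrow> f i \<in> measures_on T) \<Longrightarrow> (\<Sum>i\<in>I. f i) \<in> measures_on T"
  by (induction I rule: infinite_finite_induct) (auto simp: measures_on_zero measures_on_add)

section \<open>The partition\<close>

lemma cell_borel [measurable]: "cell t n i \<in> sets borel"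
  by (auto simp: cell_def)

context
  fixes \<tau> :: real and t :: "nat \<Rightarrow> nat \<Rightarrow> real"
  assumes pp: "partition_points \<tau> t"
begin

lemma partition_first: "1 \<le> n \<Longrightarrow> t n 0 = 0"
  and partition_last: "1 \<le> n \<Longrightarrow> t n n = \<tau>"
  and partition_less: "1 \<le> n \<Longrightarrow> i \<in> {1..n} \<Longrightarrow> t n (i - 1) < t n i"
  using pp by (auto simp: partition_points_def)

lemma partition_mono:
  assumes "1 \<le> n" "i \<le> j" "j \<le> n"
  shows "t n i \<le> t n j"
  using assms(2,3)
proof (induction j rule: dec_induct)
  case (step j)
  then show ?case using partition_less[of n "Suc j"] assms(1) by fastforce
qed simp

lemma partition_mem: "1 \<le> n \<Longrightarrow> i \<le> n \<Longrightarrow> t n i \<in> {0..\<tau>}"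
  using partition_mono[of n 0 i] partition_mono[of n i n] partition_first[of n] partition_last[of n]
  by auto

lemma cell_subset_Icc: "1 \<le> n \<Longrightarrow> i \<in> {1..n} \<Longrightarrow> cell t n i \<subseteq> {t n (i - 1)..t n i}"
  using partition_first[of n] by (auto simp: cell_def)

lemma cell_subset: "1 \<le> n \<Longrightarrow> i \<in> {1..n} \<Longrightarrow> cell t n i \<subseteq> {0..\<tau>}"
  using cell_subset_Icc[of n i] partition_mem[of n i] partition_mem[of n "i - 1"] by force

lemma partition_in_cell: "1 \<le> n \<Longrightarrow> i \<in> {1..n} \<Longrightarrow> t n i \<in> cell t n i"
  using partition_mem[of n i] partition_less[of n i] by (auto simp: cell_def)

lemma cell_disjoint:
  assumes "1 \<le> n" "i \<in> {1..n}" "j \<in> {1..n}" "i < j"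
  shows "cell t n i \<inter> cell t n j = {}"
proof -
  have "t n i \<le> t n (j - 1)" using assms by (intro partition_mono) auto
  then show ?thesis using cell_subset_Icc[of n i] assms by (fastforce simp: cell_def)
qed

lemma disjoint_cells: "1 \<le> n \<Longrightarrow> disjoint_family_on (cell t n) {1..n}"
  unfolding disjoint_family_on_def using cell_disjoint by (metis Int_commute linorder_neqE_nat)

lemma cell_cover:
  assumes n: "1 \<le> n" and s: "s \<in> {0..\<tau>}"
  obtains i where "i \<in> {1..n}" "s \<in> cell t n i"
proof -
  define i where "i = (LEAST i. 1 \<le> i \<and> s \<le> t n i)"
  have ex: "1 \<le> n \<and> s \<le> t n n" using n s partition_last by auto
  have i: "1 \<le> i" "s \<le> t n i" "i \<le> n"
    using LeastI[of "\<lambda>i. 1 \<le> i \<and> s \<le> t n i", OF ex]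
      Least_le[of "\<lambda>i. 1 \<le> i \<and> s \<le> t n i", OF ex] by (auto simp: i_def)
  have "s > t n (i - 1)" if "i \<noteq> 1"
    using not_less_Least[of "i - 1" "\<lambda>i. 1 \<le> i \<and> s \<le> t n i"] that i by (fastforce simp: i_def)
  then have "s \<in> cell t n i" using i s by (auto simp: cell_def)
  then show ?thesis using that[of i] i by simp
qed

lemma cell_unique:
  assumes "1 \<le> n" "i \<in> {1..n}" "j \<in> {1..n}" "s \<in> cell t n i" "s \<in> cell t n j"
  shows "i = j"
  using disjoint_family_onD[OF disjoint_cells[OF assms(1)] assms(2,3)] assms by auto

lemma cells_small:
  assumes "0 < \<delta>"
  shows "\<forall>\<^sub>F n in sequentially. \<forall>i\<in>{1..n}. \<forall>s\<in>cell t n i. \<bar>s - t n i\<bar> < \<delta>"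
proof -
  have "(\<lambda>n. SUP i\<in>{1..n}. \<bar>t n i - t n (i - 1)\<bar>) \<longlonglongrightarrow> 0"
    using pp by (simp add: partition_points_def)
  from order_tendstoD(2)[OF this assms] eventually_ge_at_top[of 1] show ?thesis
  proof eventually_elim
    case (elim n)
    show ?case
    proof (intro ballI)
      fix i s assume i: "i \<in> {1..n}" "s \<in> cell t n i"
      have "\<bar>t n i - t n (i - 1)\<bar> \<le> (SUP i\<in>{1..n}. \<bar>t n i - t n (i - 1)\<bar>)"
        by (rule cSUP_upper) (use i in auto)
      then show "\<bar>s - t n i\<bar> < \<delta>" using cell_subset_Icc[of n i] i elim by fastforce
    qed
  qed
qed

end

section \<open>Riemann sums and the pairing\<close>

text \<open>
  The integral of \<open>x\<close> against the discretised measure, which puts the mass of each cell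
  into its right end point.
\<close>

definition riemann_sum :: "(nat \<Rightarrow> nat \<Rightarrow> real) \<Rightarrow> nat \<Rightarrow> signed_measure \<Rightarrow> (real \<Rightarrow> real) \<Rightarrow> real" where
  "riemann_sum t n m x = (\<Sum>i=1..n. sm m (cell t n i) * x (t n i))"

lemma riemann_sum_add: "riemann_sum t n (m + m') x = riemann_sum t n m x + riemann_sum t n m' x"
  and riemann_sum_diff: "riemann_sum t n (m - m') x = riemann_sum t n m x - riemann_sum t n m' x"
  and riemann_sum_scaleR: "riemann_sum t n (c *\<^sub>R m) x = c * riemann_sum t n m x"
  and riemann_sum_add_right: "riemann_sum t n m (\<lambda>s. x s + y s) = riemann_sum t n m x + riemann_sum t n m y"
  and riemann_sum_diff_right: "riemann_sum t n m (\<lambda>s. x s - y s) = riemann_sum t n m x - riemann_sum t n m y"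
  and riemann_sum_scale_right: "riemann_sum t n m (\<lambda>s. c * x s) = c * riemann_sum t n m x"
  by (simp_all add: riemann_sum_def sm_add sm_minus sm_scaleR algebra_simps
      sum.distrib sum_subtractf sum_distrib_left)

lemma bounded_linear_riemann_sum: "bounded_linear (\<lambda>m. riemann_sum t n m x)"
  unfolding riemann_sum_def
  by (intro bounded_linear_sum bounded_linear_mult_const[OF bounded_linear_sm])

context
  fixes \<tau> :: real and t :: "nat \<Rightarrow> nat \<Rightarrow> real"
  assumes pp: "partition_points \<tau> t"
begin

lemma abs_riemann_sum_le:
  assumes n: "1 \<le> n" and b: "\<And>s. s \<in> {0..\<tau>} \<Longrightarrow> \<bar>x s\<bar> \<le> b" and "0 \<le> b"
  shows "\<bar>riemann_sum t n m x\<bar> \<le> b * norm m"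
proof -
  have "\<bar>riemann_sum t n m x\<bar> \<le> (\<Sum>i=1..n. \<bar>sm m (cell t n i)\<bar> * b)"
    unfolding riemann_sum_def
    by (rule order_trans[OF sum_abs], rule sum_mono)
      (use partition_mem[OF pp n] b in \<open>auto simp: abs_mult intro!: mult_left_mono\<close>)
  also have "\<dots> = b * (\<Sum>i=1..n. \<bar>sm m (cell t n i)\<bar>)"
    by (simp add: sum_distrib_left mult.commute)
  also have "\<dots> \<le> b * norm m"
    by (intro mult_left_mono sum_abs_sm_le_norm disjoint_cells[OF pp n] assms) auto
  finally show ?thesis .
qed

lemma finite_measure_jordan_pos: "finite_measure (jordan_pos m)"
  by (rule finite_measureI) (simp add: emeasure_jordan_pos)

lemma measure_jordan_pos_le: "measure (jordan_pos m) A \<le> norm m"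
proof (cases "A \<in> sets borel")
  case True
  have "positive_variation m A \<le> norm m"
    by (rule positive_variation_least) (meson abs_sm_le_norm abs_le_D1)
  then show ?thesis
    using True by (simp add: measure_def emeasure_jordan_pos positive_variation_nonneg)
qed (simp add: measure_notin_sets)

lemma jordan_pos_step:
  assumes n: "1 \<le> n" and x: "continuous_on {0..\<tau>} x"
    and osc: "\<And>i s. i \<in> {1..n} \<Longrightarrow> s \<in> cell t n i \<Longrightarrow> \<bar>x s - x (t n i)\<bar> \<le> \<delta>"
  shows "\<bar>(LINT s:{0..\<tau>}|jordan_pos m. x s)
    - (\<Sum>i=1..n. measure (jordan_pos m) (cell t n i) * x (t n i))\<bar> \<le> \<delta> * norm m"
proof -
  let ?J = "jordan_pos m"
  interpret J: finite_measure ?J by (rule finite_measure_jordan_pos)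
  have "0 \<le> \<delta>" using osc[of 1 "t n 1"] partition_in_cell[OF pp n, of 1] n by force
  let ?g = "\<lambda>s. \<Sum>i=1..n. indicator (cell t n i) s * x (t n i)"
  let ?f = "\<lambda>s. indicator {0..\<tau>} s * x s"
  have cells: "cell t n i \<in> sets ?J" for i by simp
  have ig: "integrable ?J ?g"
    by (intro Bochner_Integration.integrable_sum integrable_mult_left) (auto simp: J.emeasure_finite less_top[symmetric])
  have eg: "(LINT s|?J. ?g s) = (\<Sum>i=1..n. measure ?J (cell t n i) * x (t n i))"
    by (subst Bochner_Integration.integral_sum) (auto simp: J.emeasure_finite less_top[symmetric])
  obtain b where b: "\<And>s. s \<in> {0..\<tau>} \<Longrightarrow> \<bar>x s\<bar> \<le> b"
    using compact_imp_bounded[OF compact_continuous_image[OF x compact_Icc]]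
    unfolding bounded_iff by (metis image_eqI real_norm_def)
  have fm: "?f \<in> borel_measurable ?J"
    using borel_measurable_continuous_on_indicator[OF _ x] by (simp add: measurable_def)
  have if': "integrable ?J ?f"
  proof (rule J.integrable_const_bound[where B = "max b 0"])
    show "AE s in ?J. norm (?f s) \<le> max b 0"
      using b by (auto simp: indicator_def max.coboundedI1)
  qed (rule fm)
  have out: "s \<notin> cell t n i" if "s \<notin> {0..\<tau>}" "i \<in> {1..n}" for s i
    using cell_subset[OF pp n that(2)] that(1) by blast
  have diff: "\<bar>?f s - ?g s\<bar> \<le> \<delta>" for s
  proof (cases "s \<in> {0..\<tau>}")
    case True
    then obtain i where i: "i \<in> {1..n}" "s \<in> cell t n i" by (rule cell_cover[OF pp n])
    have "?g s = (\<Sum>j=1..n. if j = i then x (t n i) else 0)"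
      using i cell_unique[OF pp n] by (intro sum.cong) (auto simp: indicator_def)
    also have "\<dots> = x (t n i)" using i by simp
    finally show ?thesis using osc[OF i] True by simp
  next
    case False
    then have "?g s = 0"
      using out by (intro sum.neutral) (auto simp: indicator_def)
    then show ?thesis using False \<open>0 \<le> \<delta>\<close> by simp
  qed
  have "\<bar>(LINT s|?J. ?f s) - (LINT s|?J. ?g s)\<bar> = \<bar>LINT s|?J. ?f s - ?g s\<bar>"
    using ig if' by simp
  also have "\<dots> \<le> (LINT s|?J. \<bar>?f s - ?g s\<bar>)" by (rule integral_abs_bound)
  also have "\<dots> \<le> (LINT s|?J. \<delta>)"
    by (rule integral_mono) (use diff ig if' in auto)
  also have "\<dots> = \<delta> * measure ?J UNIV" by simp
  also have "\<dots> \<le> \<delta> * norm m"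
    by (rule mult_left_mono[OF measure_jordan_pos_le \<open>0 \<le> \<delta>\<close>])
  finally show ?thesis unfolding eg by (simp add: set_lebesgue_integral_def)
qed

text \<open>
  The Jordan decomposition enters only through this estimate. All further properties of the pairing
  with a continuous function are read off from Riemann sums by passing to the limit; in particular additivity in
  the measure, which is not evident from the decomposition.
\<close>

lemma pairing_riemann_sum:
  assumes n: "1 \<le> n" and x: "continuous_on {0..\<tau>} x"
    and osc: "\<And>i s. i \<in> {1..n} \<Longrightarrow> s \<in> cell t n i \<Longrightarrow> \<bar>x s - x (t n i)\<bar> \<le> \<delta>"
  shows "\<bar>pairing {0..\<tau>} m x - riemann_sum t n m x\<bar> \<le> 2 * \<delta> * norm m"
proof -
  have "riemann_sum t n m x = (\<Sum>i=1..n. measure (jordan_pos m) (cell t n i) * x (t n i))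
      - (\<Sum>i=1..n. measure (jordan_pos (- m)) (cell t n i) * x (t n i))"
    by (simp add: riemann_sum_def sm_eq_jordan jordan_neg_def sum_subtractf left_diff_distrib)
  then show ?thesis
    using jordan_pos_step[OF n x osc, of m] jordan_pos_step[OF n x osc, of "- m"]
    by (simp add: pairing_def jordan_neg_def abs_le_iff)
qed

lemma riemann_sum_tendsto:
  assumes x: "continuous_on {0..\<tau>} x"
  shows "(\<lambda>n. riemann_sum t n m x) \<longlonglongrightarrow> pairing {0..\<tau>} m x"
proof (rule LIMSEQ_I)
  fix r :: real assume r: "0 < r"
  define e where "e = r / (2 * norm m + 1)"
  have e: "0 < e" using r by (simp add: e_def add_nonneg_pos)
  have "uniformly_continuous_on {0..\<tau>} x"
    by (rule compact_uniformly_continuous[OF x compact_Icc])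
  then obtain d where d: "0 < d" "\<And>s s'. s \<in> {0..\<tau>} \<Longrightarrow> s' \<in> {0..\<tau>} \<Longrightarrow> dist s' s < d \<Longrightarrow> dist (x s') (x s) < e"
    using e unfolding uniformly_continuous_on_def by blast
  have "\<forall>\<^sub>F n in sequentially. norm (riemann_sum t n m x - pairing {0..\<tau>} m x) < r"
    using cells_small[OF pp d(1)] eventually_ge_at_top[of 1]
  proof eventually_elim
    case (elim n)
    have "\<bar>x s - x (t n i)\<bar> \<le> e" if "i \<in> {1..n}" "s \<in> cell t n i" for i s
      using d(2)[of "t n i" s] elim that partition_mem[OF pp, of n i] cell_subset[OF pp, of n i]
      by (force simp: dist_real_def)
    from pairing_riemann_sum[OF _ x this, of m] elim
    have "\<bar>pairing {0..\<tau>} m x - riemann_sum t n m x\<bar> \<le> e * (2 * norm m)" by simp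
    also have "\<dots> < e * (2 * norm m + 1)" using e by simp
    also have "\<dots> = r" by (simp add: e_def add_nonneg_eq_0_iff)
    finally show ?case by (simp add: abs_minus_commute)
  qed
  then show "\<exists>no. \<forall>n\<ge>no. norm (riemann_sum t n m x - pairing {0..\<tau>} m x) < r"
    by (simp add: eventually_sequentially)
qed

lemma pairing_add:
  assumes x: "continuous_on {0..\<tau>} x"
  shows "pairing {0..\<tau>} (m + m') x = pairing {0..\<tau>} m x + pairing {0..\<tau>} m' x"
  using tendsto_add[OF riemann_sum_tendsto[OF x, of m] riemann_sum_tendsto[OF x, of m']]
  by (intro LIMSEQ_unique[OF riemann_sum_tendsto[OF x]]) (simp add: riemann_sum_add)

lemma pairing_scaleR:
  assumes x: "continuous_on {0..\<tau>} x"
  shows "pairing {0..\<tau>} (c *\<^sub>R m) x = c * pairing {0..\<tau>} m x"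
  using tendsto_mult_left[OF riemann_sum_tendsto[OF x, of m]]
  by (intro LIMSEQ_unique[OF riemann_sum_tendsto[OF x]]) (simp add: riemann_sum_scaleR)

lemma abs_pairing_le:
  assumes x: "continuous_on {0..\<tau>} x" and b: "\<And>s. s \<in> {0..\<tau>} \<Longrightarrow> \<bar>x s\<bar> \<le> b" "0 \<le> b"
  shows "\<bar>pairing {0..\<tau>} m x\<bar> \<le> b * norm m"
proof (rule tendsto_upperbound[OF tendsto_rabs[OF riemann_sum_tendsto[OF x]]])
  show "\<forall>\<^sub>F n in sequentially. \<bar>riemann_sum t n m x\<bar> \<le> b * norm m"
    using eventually_ge_at_top[of 1] by eventually_elim (use abs_riemann_sum_le b in auto)
qed simp

lemma pairing_minus:
  assumes x: "continuous_on {0..\<tau>} x"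
  shows "pairing {0..\<tau>} (m - m') x = pairing {0..\<tau>} m x - pairing {0..\<tau>} m' x"
  using pairing_add[OF x, of "m - m'" m'] by simp

lemma pairing_zero:
  assumes x: "continuous_on {0..\<tau>} x"
  shows "pairing {0..\<tau>} 0 x = 0"
  using pairing_scaleR[OF x, of 0 0] by simp

lemma pairing_sum:
  assumes x: "continuous_on {0..\<tau>} x"
  shows "pairing {0..\<tau>} (\<Sum>i\<in>I. f i) x = (\<Sum>i\<in>I. pairing {0..\<tau>} (f i) x)"
  by (induction I rule: infinite_finite_induct) (auto simp: pairing_add[OF x] pairing_zero[OF x])

lemma pairing_diff_right:
  assumes x: "continuous_on {0..\<tau>} x" and y: "continuous_on {0..\<tau>} y"
  shows "pairing {0..\<tau>} m (\<lambda>s. x s - y s) = pairing {0..\<tau>} m x - pairing {0..\<tau>} m y"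
  using tendsto_diff[OF riemann_sum_tendsto[OF x, of m] riemann_sum_tendsto[OF y, of m]]
  by (intro LIMSEQ_unique[OF riemann_sum_tendsto[OF continuous_on_diff[OF x y]]])
    (simp add: riemann_sum_diff_right)

lemma pairing_point_mass:
  assumes x: "continuous_on {0..\<tau>} x" and s: "s \<in> {0..\<tau>}"
  shows "pairing {0..\<tau>} (point_mass s) x = x s"
proof (rule LIMSEQ_unique[OF riemann_sum_tendsto[OF x]])
  show "(\<lambda>n. riemann_sum t n (point_mass s) x) \<longlonglongrightarrow> x s"
  proof (rule tendstoI)
    fix e :: real assume "0 < e"
    then obtain d where d: "0 < d" "\<And>s'. s' \<in> {0..\<tau>} \<Longrightarrow> dist s' s < d \<Longrightarrow> dist (x s') (x s) < e"
      using x s unfolding continuous_on_iff by blast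
    show "\<forall>\<^sub>F n in sequentially. dist (riemann_sum t n (point_mass s) x) (x s) < e"
      using cells_small[OF pp d(1)] eventually_ge_at_top[of 1]
    proof eventually_elim
      case (elim n)
      obtain i where i: "i \<in> {1..n}" "s \<in> cell t n i" by (rule cell_cover[OF pp elim(2) s])
      have "riemann_sum t n (point_mass s) x = (\<Sum>j=1..n. if j = i then x (t n i) else 0)"
        unfolding riemann_sum_def
        using i cell_unique[OF pp elim(2)] by (intro sum.cong) (auto simp: sm_point_mass indicator_def)
      then have "riemann_sum t n (point_mass s) x = x (t n i)" using i by simp
      then show ?case
        using d(2)[of "t n i"] elim i partition_mem[OF pp elim(2), of i]
        by (auto simp: dist_real_def abs_minus_commute)
    qed
  qed
qed

end

section \<open>The quadratic form of a kernel\<close>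

text \<open>The bilinear form $\langle m, \mathcal K m'\rangle$ on measures.\<close>

definition kernel_form ::
    "real \<Rightarrow> (real \<Rightarrow> real \<Rightarrow> real) \<Rightarrow> signed_measure \<Rightarrow> signed_measure \<Rightarrow> real" where
  "kernel_form \<tau> K m m' = pairing {0..\<tau>} m (cov_operator \<tau> K m')"

text \<open>
  The same form evaluated at the discretised measures.
\<close>

definition discrete_form ::
    "(nat \<Rightarrow> nat \<Rightarrow> real) \<Rightarrow> nat \<Rightarrow> (real \<Rightarrow> real \<Rightarrow> real) \<Rightarrow> signed_measure \<Rightarrow> signed_measure \<Rightarrow> real" where
  "discrete_form t n K m m' = riemann_sum t n m (\<lambda>s. riemann_sum t n m' (K s))"

text \<open>The step kernel differs from \<open>K\<close> by at most \<open>\<delta>\<close> at every point of the square.\<close>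

definition kernel_close :: "(nat \<Rightarrow> nat \<Rightarrow> real) \<Rightarrow> (real \<Rightarrow> real \<Rightarrow> real) \<Rightarrow> nat \<Rightarrow> real \<Rightarrow> bool" where
  "kernel_close t K n \<delta> \<longleftrightarrow>
    (\<forall>i\<in>{1..n}. \<forall>j\<in>{1..n}. \<forall>r\<in>cell t n i. \<forall>s\<in>cell t n j. \<bar>K r s - K (t n i) (t n j)\<bar> \<le> \<delta>)"

lemma kernel_closeD:
  "kernel_close t K n \<delta> \<Longrightarrow> i \<in> {1..n} \<Longrightarrow> j \<in> {1..n} \<Longrightarrow> r \<in> cell t n i \<Longrightarrow> s \<in> cell t n j \<Longrightarrow>
    \<bar>K r s - K (t n i) (t n j)\<bar> \<le> \<delta>"
  by (auto simp: kernel_close_def)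

lemma discrete_form_add_left: "discrete_form t n K (m + m') l = discrete_form t n K m l + discrete_form t n K m' l"
  and discrete_form_scale_left: "discrete_form t n K (c *\<^sub>R m) l = c * discrete_form t n K m l"
  and discrete_form_add_right: "discrete_form t n K l (m + m') = discrete_form t n K l m + discrete_form t n K l m'"
  and discrete_form_scale_right: "discrete_form t n K l (c *\<^sub>R m) = c * discrete_form t n K l m"
  by (simp_all add: discrete_form_def riemann_sum_add riemann_sum_scaleR
      riemann_sum_add_right riemann_sum_scale_right)

lemma discrete_form_expand:
  "discrete_form t n K m m'
    = (\<Sum>i=1..n. \<Sum>j=1..n. sm m (cell t n i) * sm m' (cell t n j) * K (t n i) (t n j))"
  by (simp add: discrete_form_def riemann_sum_def sum_distrib_left mult.assoc)

lemma discrete_form_commute: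
  assumes "\<And>r s. K r s = K s r"
  shows "discrete_form t n K m m' = discrete_form t n K m' m"
  unfolding discrete_form_expand
  by (subst sum.swap) (auto intro!: sum.cong simp: assms[of "t n _" "t n _"] mult_ac)

text \<open>
  A symmetric kernel that is continuous on the square, together with partitions whose mesh tends to 0.
  Continuity is required only on the square, symmetry for all arguments.
\<close>

locale kernel_on_interval =
  fixes \<tau> :: real and t :: "nat \<Rightarrow> nat \<Rightarrow> real" and K :: "real \<Rightarrow> real \<Rightarrow> real"
  assumes pp: "partition_points \<tau> t"
    and kernel_continuous: "continuous_on ({0..\<tau>} \<times> {0..\<tau>}) (\<lambda>(r, s). K r s)"
    and kernel_sym: "K r s = K s r"
begin

lemma kernel_continuous_right:
  assumes "r \<in> {0..\<tau>}"
  shows "continuous_on {0..\<tau>} (K r)"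
proof -
  have "continuous_on {0..\<tau>} ((\<lambda>(r, s). K r s) \<circ> Pair r)"
    using assms by (intro continuous_on_compose continuous_on_subset[OF kernel_continuous])
      (auto intro!: continuous_intros)
  then show ?thesis by (simp add: comp_def)
qed

lemma kernel_bounded:
  obtains \<kappa> where "0 \<le> \<kappa>" "\<And>r s. r \<in> {0..\<tau>} \<Longrightarrow> s \<in> {0..\<tau>} \<Longrightarrow> \<bar>K r s\<bar> \<le> \<kappa>"
proof -
  have "bounded ((\<lambda>(r, s). K r s) ` ({0..\<tau>} \<times> {0..\<tau>}))"
    by (intro compact_imp_bounded compact_continuous_image kernel_continuous compact_Times compact_Icc)
  then obtain \<kappa> where "\<forall>x\<in>(\<lambda>(r, s). K r s) ` ({0..\<tau>} \<times> {0..\<tau>}). norm x \<le> \<kappa>"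
    by (auto simp: bounded_iff)
  then have "\<bar>K r s\<bar> \<le> max \<kappa> 0" if "r \<in> {0..\<tau>}" "s \<in> {0..\<tau>}" for r s
    using that by force
  then show ?thesis using that[of "max \<kappa> 0"] by simp
qed

lemma kernel_uniformly_continuous:
  assumes "0 < e"
  obtains d where "0 < d" "\<And>r s r' s'. r \<in> {0..\<tau>} \<Longrightarrow> s \<in> {0..\<tau>} \<Longrightarrow> r' \<in> {0..\<tau>} \<Longrightarrow> s' \<in> {0..\<tau>} \<Longrightarrow>
    \<bar>r' - r\<bar> < d \<Longrightarrow> \<bar>s' - s\<bar> < d \<Longrightarrow> \<bar>K r' s' - K r s\<bar> < e"
proof -
  have "uniformly_continuous_on ({0..\<tau>} \<times> {0..\<tau>}) (\<lambda>(r, s). K r s)"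
    by (intro compact_uniformly_continuous kernel_continuous compact_Times compact_Icc)
  from this[unfolded uniformly_continuous_on_def, rule_format, OF assms]
  obtain d where d: "0 < d" "\<forall>x\<in>{0..\<tau>} \<times> {0..\<tau>}. \<forall>x'\<in>{0..\<tau>} \<times> {0..\<tau>}. dist x' x < d \<longrightarrow>
      dist (case x' of (r, s) \<Rightarrow> K r s) (case x of (r, s) \<Rightarrow> K r s) < e"
    by metis
  have "\<bar>K r' s' - K r s\<bar> < e"
    if "r \<in> {0..\<tau>}" "s \<in> {0..\<tau>}" "r' \<in> {0..\<tau>}" "s' \<in> {0..\<tau>}" "\<bar>r' - r\<bar> < d / 2" "\<bar>s' - s\<bar> < d / 2"
    for r s r' s'
  proof -
    have "dist (r', s') (r, s) \<le> \<bar>r' - r\<bar> + \<bar>s' - s\<bar>"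
      unfolding dist_prod_def by (simp add: dist_real_def sqrt_sum_squares_le_sum_abs)
    also have "\<dots> < d" using that by simp
    finally show ?thesis using d(2) that by (force simp: dist_real_def)
  qed
  then show ?thesis using that[of "d / 2"] d(1) by simp
qed

lemma eventually_kernel_close:
  assumes "0 < \<delta>"
  shows "\<forall>\<^sub>F n in sequentially. kernel_close t K n \<delta>"
proof -
  obtain d where d: "0 < d" "\<And>r s r' s'. r \<in> {0..\<tau>} \<Longrightarrow> s \<in> {0..\<tau>} \<Longrightarrow> r' \<in> {0..\<tau>} \<Longrightarrow> s' \<in> {0..\<tau>} \<Longrightarrow>
    \<bar>r' - r\<bar> < d \<Longrightarrow> \<bar>s' - s\<bar> < d \<Longrightarrow> \<bar>K r' s' - K r s\<bar> < \<delta>"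
    using kernel_uniformly_continuous[OF assms] by metis
  show ?thesis
    using cells_small[OF pp d(1)] eventually_ge_at_top[of 1]
  proof eventually_elim
    case (elim n)
    show ?case
      unfolding kernel_close_def
    proof (intro ballI)
      fix i j r s assume *: "i \<in> {1..n}" "j \<in> {1..n}" "r \<in> cell t n i" "s \<in> cell t n j"
      have "r \<in> {0..\<tau>}" "s \<in> {0..\<tau>}" "t n i \<in> {0..\<tau>}" "t n j \<in> {0..\<tau>}"
        using * cell_subset[OF pp elim(2)] partition_mem[OF pp elim(2)] by (blast, blast, auto)
      then show "\<bar>K r s - K (t n i) (t n j)\<bar> \<le> \<delta>"
        using d(2)[of "t n i" "t n j" r s] * elim(1) by (simp add: less_imp_le)
    qed
  qed
qed

lemma continuous_cov_operator: "continuous_on {0..\<tau>} (cov_operator \<tau> K m)"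
  unfolding continuous_on_iff
proof (intro ballI allI impI)
  fix r e :: real assume r: "r \<in> {0..\<tau>}" and e: "0 < e"
  define e' where "e' = e / (norm m + 1)"
  have e': "0 < e'" using e by (simp add: e'_def add_nonneg_pos)
  obtain d where d: "0 < d" "\<And>r s r' s'. r \<in> {0..\<tau>} \<Longrightarrow> s \<in> {0..\<tau>} \<Longrightarrow> r' \<in> {0..\<tau>} \<Longrightarrow> s' \<in> {0..\<tau>} \<Longrightarrow>
    \<bar>r' - r\<bar> < d \<Longrightarrow> \<bar>s' - s\<bar> < d \<Longrightarrow> \<bar>K r' s' - K r s\<bar> < e'"
    using kernel_uniformly_continuous[OF e'] by metis
  have "dist (cov_operator \<tau> K m r') (cov_operator \<tau> K m r) < e" if r': "r' \<in> {0..\<tau>}" "dist r' r < d" for r'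
  proof -
    have "\<bar>pairing {0..\<tau>} m (\<lambda>s. K r' s - K r s)\<bar> \<le> e' * norm m"
      using d r r' e' by (intro abs_pairing_le[OF pp] continuous_on_diff kernel_continuous_right)
        (auto simp: dist_real_def less_imp_le)
    also have "\<dots> < e' * (norm m + 1)" using e' by simp
    also have "\<dots> = e" using norm_ge_zero[of m] by (simp add: e'_def add_nonneg_eq_0_iff)
    finally show ?thesis
      using r r' by (simp add: cov_operator_def dist_real_def pairing_diff_right[OF pp] kernel_continuous_right)
  qed
  then show "\<exists>d>0. \<forall>r'\<in>{0..\<tau>}. dist r' r < d \<longrightarrow> dist (cov_operator \<tau> K m r') (cov_operator \<tau> K m r) < e"
    using d(1) by blast
qed

text \<open>
  Two points of one cell give kernel sections that differ by at most \<open>2 * \<delta>\<close>, since both are compared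
  with the values at the right end points.
\<close>

lemma kernel_form_riemann:
  assumes n: "1 \<le> n" and close: "kernel_close t K n \<delta>"
  shows "\<bar>kernel_form \<tau> K m m' - riemann_sum t n m (cov_operator \<tau> K m')\<bar> \<le> 4 * \<delta> * norm m * norm m'"
proof -
  have "\<bar>cov_operator \<tau> K m' r - cov_operator \<tau> K m' (t n i)\<bar> \<le> 2 * \<delta> * norm m'"
    if i: "i \<in> {1..n}" "r \<in> cell t n i" for i r
  proof -
    have T: "r \<in> {0..\<tau>}" "t n i \<in> {0..\<tau>}" "t n i \<in> cell t n i"
      using i cell_subset[OF pp n i(1)] partition_mem[OF pp n, of i] partition_in_cell[OF pp n i(1)] by auto
    have "\<bar>K r s - K (t n i) s\<bar> \<le> 2 * \<delta>" if s: "s \<in> {0..\<tau>}" for s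
    proof -
      obtain j where j: "j \<in> {1..n}" "s \<in> cell t n j" by (rule cell_cover[OF pp n s])
      have "\<bar>K r s - K (t n i) (t n j)\<bar> \<le> \<delta>" "\<bar>K (t n i) s - K (t n i) (t n j)\<bar> \<le> \<delta>"
        using i j T by (auto intro!: kernel_closeD[OF close])
      then show ?thesis by linarith
    qed
    moreover have "0 \<le> \<delta>" using kernel_closeD[OF close i(1) i(1) i(2) i(2)] by linarith
    ultimately have "\<bar>pairing {0..\<tau>} m' (\<lambda>s. K r s - K (t n i) s)\<bar> \<le> 2 * \<delta> * norm m'"
      using T by (intro abs_pairing_le[OF pp] continuous_on_diff kernel_continuous_right) auto
    then show ?thesis
      using T by (simp add: cov_operator_def pairing_diff_right[OF pp] kernel_continuous_right)
  qed
  from pairing_riemann_sum[OF pp n continuous_cov_operator this, of m]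
  show ?thesis by (simp add: kernel_form_def mult_ac)
qed

lemma riemann_discrete_form:
  assumes n: "1 \<le> n" and close: "kernel_close t K n \<delta>"
  shows "\<bar>riemann_sum t n m (cov_operator \<tau> K m') - discrete_form t n K m m'\<bar> \<le> 2 * \<delta> * norm m * norm m'"
proof -
  let ?y = "\<lambda>r. cov_operator \<tau> K m' r - riemann_sum t n m' (K r)"
  have "\<bar>?y (t n i)\<bar> \<le> 2 * \<delta> * norm m'" if i: "i \<in> {1..n}" for i
  proof -
    have T: "t n i \<in> {0..\<tau>}" "t n i \<in> cell t n i"
      using i partition_mem[OF pp n] partition_in_cell[OF pp n] by auto
    show ?thesis
      unfolding cov_operator_def
      by (rule pairing_riemann_sum[OF pp n kernel_continuous_right])
        (use T i in \<open>auto intro!: kernel_closeD[OF close]\<close>)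
  qed
  then have "\<bar>riemann_sum t n m ?y\<bar> \<le> (\<Sum>i=1..n. \<bar>sm m (cell t n i)\<bar> * (2 * \<delta> * norm m'))"
    unfolding riemann_sum_def
    by (intro order_trans[OF sum_abs] sum_mono) (auto simp: abs_mult intro!: mult_left_mono)
  also have "\<dots> = 2 * \<delta> * norm m' * (\<Sum>i=1..n. \<bar>sm m (cell t n i)\<bar>)"
    by (simp add: sum_distrib_left mult_ac)
  also have "\<dots> \<le> 2 * \<delta> * norm m' * norm m"
  proof (intro mult_left_mono sum_abs_sm_le_norm disjoint_cells[OF pp n])
    have "0 \<le> \<delta>"
      using kernel_closeD[OF close, of 1 1 "t n 1" "t n 1"] partition_in_cell[OF pp n, of 1] n by simp
    then show "0 \<le> 2 * \<delta> * norm m'" by simp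
  qed auto
  finally show ?thesis by (simp add: riemann_sum_diff_right discrete_form_def mult_ac)
qed

lemma kernel_form_discrete:
  assumes n: "1 \<le> n" and close: "kernel_close t K n \<delta>"
  shows "\<bar>kernel_form \<tau> K m m' - discrete_form t n K m m'\<bar> \<le> 6 * \<delta> * norm m * norm m'"
  using kernel_form_riemann[OF assms, of m m'] riemann_discrete_form[OF assms, of m m'] by linarith

lemma discrete_form_tendsto:
  "(\<lambda>n. discrete_form t n K m m') \<longlonglongrightarrow> kernel_form \<tau> K m m'"
proof (rule LIMSEQ_I)
  fix r :: real assume r: "0 < r"
  let ?c = "6 * norm m * norm m'"
  define \<delta> where "\<delta> = r / (?c + 1)"
  have c: "0 \<le> ?c" by simp
  then have \<delta>: "0 < \<delta>" using r unfolding \<delta>_def by (intro divide_pos_pos) linarith+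
  have "\<forall>\<^sub>F n in sequentially. norm (discrete_form t n K m m' - kernel_form \<tau> K m m') < r"
    using eventually_kernel_close[OF \<delta>] eventually_ge_at_top[of 1]
  proof eventually_elim
    case (elim n)
    have "\<bar>kernel_form \<tau> K m m' - discrete_form t n K m m'\<bar> \<le> \<delta> * ?c"
      using kernel_form_discrete[OF elim(2,1), of m m'] by (simp add: mult_ac)
    also have "\<dots> < \<delta> * (?c + 1)" using \<delta> by simp
    also have "\<dots> = r" unfolding \<delta>_def using c by (metis add_nonneg_eq_0_iff nonzero_eq_divide_eq zero_le_one zero_neq_one)
    finally show ?case by (simp add: abs_minus_commute)
  qed
  then show "\<exists>no. \<forall>n\<ge>no. norm (discrete_form t n K m m' - kernel_form \<tau> K m m') < r"
    by (simp add: eventually_sequentially)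
qed

lemma kernel_form_commute: "kernel_form \<tau> K m m' = kernel_form \<tau> K m' m"
  by (rule LIMSEQ_unique[OF discrete_form_tendsto])
    (subst discrete_form_commute[OF kernel_sym], rule discrete_form_tendsto)

lemma abs_discrete_form_le:
  assumes \<kappa>: "0 \<le> \<kappa>" "\<And>r s. r \<in> {0..\<tau>} \<Longrightarrow> s \<in> {0..\<tau>} \<Longrightarrow> \<bar>K r s\<bar> \<le> \<kappa>" and n: "1 \<le> n"
  shows "\<bar>discrete_form t n K m m'\<bar> \<le> \<kappa> * norm m' * norm m"
  unfolding discrete_form_def
  using \<kappa> by (intro abs_riemann_sum_le[OF pp n] mult_nonneg_nonneg) auto

text \<open>
  The discretised forms are bilinear by inspection, and so is their limit.
\<close>

lemma bounded_bilinear_kernel_form: "bounded_bilinear (kernel_form \<tau> K)"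
proof
  fix m m' l :: signed_measure and c :: real
  note [tendsto_intros] = discrete_form_tendsto
  show "kernel_form \<tau> K (m + m') l = kernel_form \<tau> K m l + kernel_form \<tau> K m' l"
    by (rule LIMSEQ_unique[OF discrete_form_tendsto], unfold discrete_form_add_left) (intro tendsto_intros)
  show "kernel_form \<tau> K l (m + m') = kernel_form \<tau> K l m + kernel_form \<tau> K l m'"
    by (rule LIMSEQ_unique[OF discrete_form_tendsto], unfold discrete_form_add_right) (intro tendsto_intros)
  show "kernel_form \<tau> K (c *\<^sub>R m) l = c *\<^sub>R kernel_form \<tau> K m l"
    by (rule LIMSEQ_unique[OF discrete_form_tendsto], unfold discrete_form_scale_left real_scaleR_def)
      (intro tendsto_intros)
  show "kernel_form \<tau> K l (c *\<^sub>R m) = c *\<^sub>R kernel_form \<tau> K l m"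
    by (rule LIMSEQ_unique[OF discrete_form_tendsto], unfold discrete_form_scale_right real_scaleR_def)
      (intro tendsto_intros)
next
  obtain \<kappa> where \<kappa>: "0 \<le> \<kappa>" "\<And>r s. r \<in> {0..\<tau>} \<Longrightarrow> s \<in> {0..\<tau>} \<Longrightarrow> \<bar>K r s\<bar> \<le> \<kappa>"
    using kernel_bounded by metis
  have "norm (kernel_form \<tau> K m m') \<le> norm m * norm m' * \<kappa>" for m m'
  proof (rule tendsto_upperbound[OF tendsto_norm[OF discrete_form_tendsto]])
    show "\<forall>\<^sub>F n in sequentially. norm (discrete_form t n K m m') \<le> norm m * norm m' * \<kappa>"
      using eventually_ge_at_top[of 1]
      by eventually_elim (use abs_discrete_form_le[OF \<kappa>, of _ m m'] in \<open>simp add: mult_ac\<close>)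
  qed simp
  then show "\<exists>\<kappa>. \<forall>m m'. norm (kernel_form \<tau> K m m') \<le> norm m * norm m' * \<kappa>" by blast
qed

lemma kernel_form_point_mass:
  "s \<in> {0..\<tau>} \<Longrightarrow> kernel_form \<tau> K (point_mass s) m = cov_operator \<tau> K m s"
  unfolding kernel_form_def by (rule pairing_point_mass[OF pp continuous_cov_operator])

text \<open>The degenerate case of the Cauchy-Schwarz inequality.\<close>

lemma kernel_form_degenerate:
  assumes psd: "\<And>m. 0 \<le> kernel_form \<tau> K m m" and m: "kernel_form \<tau> K m m = 0"
  shows "kernel_form \<tau> K m' m = 0"
proof -
  interpret bounded_bilinear "kernel_form \<tau> K" by (rule bounded_bilinear_kernel_form)
  let ?b = "kernel_form \<tau> K m' m" and ?a = "kernel_form \<tau> K m' m'"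
  have *: "0 \<le> 2 * c * ?b + c * c * ?a" for c
    using psd[of "m + c *\<^sub>R m'"] m kernel_form_commute[of m m']
    by (simp add: add_left add_right scaleR_left scaleR_right algebra_simps)
  have a: "0 \<le> ?a" by (rule psd)
  \<comment> \<open>near the minimizer \<open>- ?b / ?a\<close> of the parabola, but defined also when \<open>?a\<close> vanishes\<close>
  define c where "c = - ?b / (?a + 1)"
  have "?b = - c * (?a + 1)" using a by (simp add: c_def)
  moreover have "2 * c * b + c * c * a = - (c * c * (a + 2))" if "b = - c * (a + 1)" for a b :: real
    unfolding that by (simp add: algebra_simps)
  ultimately have "2 * c * ?b + c * c * ?a = - (c * c * (?a + 2))" by blast
  then have "0 \<le> - (c * c * (?a + 2))" using *[of c] by simp
  then have "c * c * (?a + 2) \<le> 0" by simp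
  then have "c = 0"
    using a by (smt (verit) mult_eq_0_iff mult_nonneg_nonneg zero_le_square mult_pos_pos)
  then show ?thesis using a by (simp add: c_def)
qed

text \<open>
  Since \<open>K\<close> is continuous, an almost everywhere bound on the interior of a product of cells
  holds on the whole product.
\<close>

lemma kernel_close_Linfty:
  assumes n: "1 \<le> n" and le: "Linfty_norm {0..\<tau>} (\<lambda>r s. step_kernel t K n r s - K r s) \<le> ereal \<delta>"
  shows "kernel_close t K n \<delta>"
  unfolding kernel_close_def
proof (intro ballI)
  fix i j r s assume i: "i \<in> {1..n}" and j: "j \<in> {1..n}" and r: "r \<in> cell t n i" and s: "s \<in> cell t n j"
  define I where "I k = {t n (k - 1)<..<t n k}" for k
  define J where "J k = {t n (k - 1)..t n k}" for k
  have IJ: "I k \<subseteq> cell t n k" "cell t n k \<subseteq> J k" "J k \<subseteq> {0..\<tau>}" "closure (I k) = J k" if k: "k \<in> {1..n}" for k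
  proof -
    show "I k \<subseteq> cell t n k" using partition_mem[OF pp n, of "k - 1"] k by (auto simp: I_def cell_def)
    show "cell t n k \<subseteq> J k" unfolding J_def by (rule cell_subset_Icc[OF pp n k])
    show "J k \<subseteq> {0..\<tau>}"
      using partition_mem[OF pp n, of k] partition_mem[OF pp n, of "k - 1"] k by (auto simp: J_def)
    show "closure (I k) = J k"
      unfolding I_def J_def using partition_less[OF pp n k] by (rule closure_greaterThanLessThan)
  qed
  define C where "C = {z \<in> J i \<times> J j. \<bar>(case z of (r, s) \<Rightarrow> K r s) - K (t n i) (t n j)\<bar> \<le> \<delta>}"
  have cJ: "continuous_on (J i \<times> J j) (\<lambda>(r, s). K r s)"
    by (intro continuous_on_subset[OF kernel_continuous] Sigma_mono IJ(3) i j)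
  have "closed C"
  proof -
    have "closed {z \<in> J i \<times> J j. \<bar>(case z of (r, s) \<Rightarrow> K r s) - K (t n i) (t n j)\<bar> \<in> {..\<delta>}}"
      by (intro continuous_closed_preimage[unfolded vimage_def Int_def, simplified]
          continuous_intros cJ closed_atMost) (auto simp: J_def intro!: closed_Times)
    then show ?thesis by (simp add: C_def)
  qed
  have sub: "z \<in> C" if z: "z \<in> I i \<times> I j" for z
  proof (rule mem_closed_if_AE_lebesgue_open[OF _ \<open>closed C\<close> _ z])
    show "open (I i \<times> I j)" by (auto simp: I_def intro!: open_Times)
    let ?M = "restrict_space lborel ({0..\<tau>} \<times> {0..\<tau>})"
    have "AE z in ?M. (case z of (r, s) \<Rightarrow> ereal \<bar>step_kernel t K n r s - K r s\<bar>)
        \<le> Linfty_norm {0..\<tau>} (\<lambda>r s. step_kernel t K n r s - K r s)"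
      unfolding Linfty_norm_def by (rule esssup_AE)
    then have "AE z in ?M. (case z of (r, s) \<Rightarrow> ereal \<bar>step_kernel t K n r s - K r s\<bar>) \<le> ereal \<delta>"
      by eventually_elim (use le in auto)
    then have "AE z in lborel. z \<in> {0..\<tau>} \<times> {0..\<tau>} \<longrightarrow>
        (case z of (r, s) \<Rightarrow> ereal \<bar>step_kernel t K n r s - K r s\<bar>) \<le> ereal \<delta>"
      by (subst (asm) AE_restrict_space_iff) (auto intro!: borel_closed closed_Times)
    then have "AE z in lebesgue. z \<in> {0..\<tau>} \<times> {0..\<tau>} \<longrightarrow>
        (case z of (r, s) \<Rightarrow> ereal \<bar>step_kernel t K n r s - K r s\<bar>) \<le> ereal \<delta>"
      by (rule AE_completion)
    then show "AE z\<in>I i \<times> I j in lebesgue. z \<in> C"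
    proof eventually_elim
      case (elim z)
      show ?case
      proof
        assume z: "z \<in> I i \<times> I j"
        obtain r s where rs: "z = (r, s)" by (cases z)
        have m: "r \<in> cell t n i" "s \<in> cell t n j"
          using z IJ(1)[OF i] IJ(1)[OF j] by (auto simp: rs)
        have iff: "r \<in> cell t n i' \<longleftrightarrow> i' = i" "s \<in> cell t n i' \<longleftrightarrow> i' = j" if "i' \<in> {1..n}" for i'
          using m i j that cell_unique[OF pp n] by metis+
        have "step_kernel t K n r s
            = (\<Sum>i'=1..n. \<Sum>j'=1..n. if i' = i \<and> j' = j then K (t n i) (t n j) else 0)"
          unfolding step_kernel_def
          by (intro sum.cong refl) (simp only: indicator_def mem_Times_iff fst_conv snd_conv iff, simp)
        also have "\<dots> = (\<Sum>i'=1..n. if i' = i then K (t n i) (t n j) else 0)"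
          using j by (intro sum.cong) auto
        also have "\<dots> = K (t n i) (t n j)" using i by simp
        finally have "step_kernel t K n r s = K (t n i) (t n j)" .
        moreover have "r \<in> J i" "s \<in> J j"
          using m IJ(2)[OF i] IJ(2)[OF j] by auto
        moreover from this have "r \<in> {0..\<tau>}" "s \<in> {0..\<tau>}"
          using IJ(3)[OF i] IJ(3)[OF j] by auto
        ultimately show "z \<in> C" using elim by (simp add: C_def rs abs_minus_commute)
      qed
    qed
  qed
  have "closure (I i \<times> I j) \<subseteq> C" using sub \<open>closed C\<close> by (intro closure_minimal) auto
  then have "(r, s) \<in> C"
    using r s IJ(2)[OF i] IJ(2)[OF j] by (auto simp: closure_Times IJ(4)[OF i] IJ(4)[OF j])
  then show "\<bar>K r s - K (t n i) (t n j)\<bar> \<le> \<delta>" by (simp add: C_def)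
qed

end

section \<open>Centered normal variables\<close>

context prob_space
begin

text \<open>
  All absolute moments of a centered normal variable are controlled by its second moment.
\<close>

lemma normal_abs_moment:
  assumes \<sigma>: "0 < \<sigma>" and D: "distributed M lborel X (normal_density 0 \<sigma>)"
  shows "integrable M (\<lambda>\<omega>. \<bar>X \<omega>\<bar> ^ r)"
    and "expectation (\<lambda>\<omega>. \<bar>X \<omega>\<bar> ^ r) = \<sigma> ^ r * (\<integral>x. std_normal_density x * \<bar>x\<bar> ^ r \<partial>lborel)"
proof -
  have Y: "distributed M lborel (\<lambda>\<omega>. X \<omega> / \<sigma>) std_normal_density"
    using normal_standard_normal_convert[OF \<sigma>, of X 0] D by simp
  have eq: "\<bar>X \<omega>\<bar> ^ r = \<sigma> ^ r * \<bar>X \<omega> / \<sigma>\<bar> ^ r" for \<omega>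
    using \<sigma> by (simp add: power_divide)
  have "integrable M (\<lambda>\<omega>. \<bar>X \<omega> / \<sigma>\<bar> ^ r)"
    using distributed_integrable[OF Y, of "\<lambda>x. \<bar>x\<bar> ^ r"] integrable_std_normal_moment_abs[of r] by simp
  then show "integrable M (\<lambda>\<omega>. \<bar>X \<omega>\<bar> ^ r)" unfolding eq by (rule integrable_mult_right)
  have "(\<integral>x. std_normal_density x * \<bar>x\<bar> ^ r \<partial>lborel) = expectation (\<lambda>\<omega>. \<bar>X \<omega> / \<sigma>\<bar> ^ r)"
    by (rule distributed_integral[OF Y]) auto
  then show "expectation (\<lambda>\<omega>. \<bar>X \<omega>\<bar> ^ r) = \<sigma> ^ r * (\<integral>x. std_normal_density x * \<bar>x\<bar> ^ r \<partial>lborel)"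
    unfolding eq by simp
qed

lemma normal_second_moment:
  assumes \<sigma>: "0 < \<sigma>" and D: "distributed M lborel X (normal_density 0 \<sigma>)"
  shows "expectation (\<lambda>\<omega>. (X \<omega>)\<^sup>2) = \<sigma>\<^sup>2"
  using normal_distributed_variance[OF \<sigma> D] normal_distributed_expectation[OF \<sigma> D] by simp

lemma centered_normal_expectation:
  assumes "centered_normal M X"
  shows "expectation X = 0"
  using assms unfolding centered_normal_def
proof (elim conjE disjE exE)
  assume "X \<in> borel_measurable M" "AE \<omega> in M. X \<omega> = 0"
  then have "expectation X = expectation (\<lambda>_. 0)" by (intro integral_cong_AE) auto
  then show ?thesis by simp
qed (use normal_distributed_expectation in blast)

lemma centered_normal_moments:
  obtains c where "0 \<le> c" and "\<And>X. centered_normal M X \<Longrightarrow> integrable M (\<lambda>\<omega>. \<bar>X \<omega>\<bar> ^ r)"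
    and "\<And>X. centered_normal M X \<Longrightarrow>
      expectation (\<lambda>\<omega>. \<bar>X \<omega>\<bar> ^ r) \<le> c * sqrt (expectation (\<lambda>\<omega>. (X \<omega>)\<^sup>2)) ^ r"
proof
  let ?m = "\<integral>x. std_normal_density x * \<bar>x\<bar> ^ r \<partial>lborel"
  \<comment> \<open>the 1 covers variables that vanish almost surely when \<open>r = 0\<close>\<close>
  show "0 \<le> max 1 ?m" by simp
  fix X assume X: "centered_normal M X"
  have "integrable M (\<lambda>\<omega>. \<bar>X \<omega>\<bar> ^ r) \<and>
    expectation (\<lambda>\<omega>. \<bar>X \<omega>\<bar> ^ r) \<le> max 1 ?m * sqrt (expectation (\<lambda>\<omega>. (X \<omega>)\<^sup>2)) ^ r"
    using X unfolding centered_normal_def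
  proof (elim conjE disjE exE)
    assume m: "X \<in> borel_measurable M" and AE: "AE \<omega> in M. X \<omega> = 0"
    have e2: "expectation (\<lambda>\<omega>. (X \<omega>)\<^sup>2) = expectation (\<lambda>_. 0)"
      by (rule integral_cong_AE) (use m AE in auto)
    have AEr: "AE \<omega> in M. \<bar>X \<omega>\<bar> ^ r = 0 ^ r" using AE by eventually_elim simp
    have "integrable M (\<lambda>\<omega>. \<bar>X \<omega>\<bar> ^ r) \<longleftrightarrow> integrable M (\<lambda>_. 0 ^ r :: real)"
      by (rule integrable_cong_AE) (use m AEr in auto)
    moreover have "expectation (\<lambda>\<omega>. \<bar>X \<omega>\<bar> ^ r) = expectation (\<lambda>_. 0 ^ r)"
      by (rule integral_cong_AE) (use m AEr in auto)
    ultimately show ?thesis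
      unfolding e2 by (cases "r = 0") (simp_all add: prob_space zero_power)
  next
    fix \<sigma> :: real assume \<sigma>: "0 < \<sigma>" "distributed M lborel X (normal_density 0 \<sigma>)"
    have "\<sigma> ^ r * ?m \<le> max 1 ?m * \<sigma> ^ r"
      using \<sigma>(1) by (subst mult.commute) (intro mult_right_mono, auto)
    then show ?thesis
      using normal_abs_moment[OF \<sigma>, of r] normal_second_moment[OF \<sigma>] \<sigma>(1) by simp
  qed
  then show "integrable M (\<lambda>\<omega>. \<bar>X \<omega>\<bar> ^ r)"
    "expectation (\<lambda>\<omega>. \<bar>X \<omega>\<bar> ^ r) \<le> max 1 ?m * sqrt (expectation (\<lambda>\<omega>. (X \<omega>)\<^sup>2)) ^ r" by auto
qed

lemma centered_normal_square_integrable: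
  assumes "centered_normal M X"
  shows "integrable M (\<lambda>\<omega>. (X \<omega>)\<^sup>2)"
  by (rule centered_normal_moments[of 2]) (use assms in simp)

text \<open>The density is bounded by $1/\sigma$, so that a likely interval cannot be short.\<close>

lemma centered_normal_small_ball:
  assumes X: "centered_normal M X" and "0 \<le> \<eta>" and p: "1 / 2 \<le> prob {\<omega>\<in>space M. \<bar>X \<omega>\<bar> \<le> \<eta>}"
  shows "expectation (\<lambda>\<omega>. (X \<omega>)\<^sup>2) \<le> (4 * \<eta>)\<^sup>2"
  using X unfolding centered_normal_def
proof (elim conjE disjE exE)
  assume m: "X \<in> borel_measurable M" and AE: "AE \<omega> in M. X \<omega> = 0"
  have "expectation (\<lambda>\<omega>. (X \<omega>)\<^sup>2) = expectation (\<lambda>_. 0)"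
    by (rule integral_cong_AE) (use m AE in auto)
  then show ?thesis by simp
next
  fix \<sigma> :: real assume \<sigma>: "0 < \<sigma>" "distributed M lborel X (normal_density 0 \<sigma>)"
  have dens: "normal_density 0 \<sigma> x \<le> 1 / \<sigma>" for x
  proof -
    have "1 \<le> sqrt (2 * pi)" using pi_gt3 by (intro real_le_rsqrt) simp
    then have "\<sigma> \<le> sqrt (2 * pi) * \<sigma>" using \<sigma>(1) by simp
    also have "\<dots> = sqrt (2 * pi * \<sigma>\<^sup>2)" using \<sigma>(1) by (simp add: real_sqrt_mult)
    finally have "1 / sqrt (2 * pi * \<sigma>\<^sup>2) \<le> 1 / \<sigma>" using \<sigma>(1) by (intro divide_left_mono) auto
    moreover have "exp (- (x - 0)\<^sup>2 / (2 * \<sigma>\<^sup>2)) \<le> 1" by simp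
    ultimately have "1 / sqrt (2 * pi * \<sigma>\<^sup>2) * exp (- (x - 0)\<^sup>2 / (2 * \<sigma>\<^sup>2)) \<le> 1 / \<sigma> * 1"
      using \<sigma>(1) by (intro mult_mono) auto
    then show ?thesis by (simp add: normal_density_def)
  qed
  have "{\<omega>\<in>space M. \<bar>X \<omega>\<bar> \<le> \<eta>} = X -` {-\<eta>..\<eta>} \<inter> space M" by auto
  then have "emeasure M {\<omega>\<in>space M. \<bar>X \<omega>\<bar> \<le> \<eta>}
      = (\<integral>\<^sup>+x. ennreal (normal_density 0 \<sigma> x) * indicator {-\<eta>..\<eta>} x \<partial>lborel)"
    using distributed_emeasure[OF \<sigma>(2), of "{-\<eta>..\<eta>}"] by simp
  also have "\<dots> \<le> (\<integral>\<^sup>+x. ennreal (1 / \<sigma>) * indicator {-\<eta>..\<eta>} x \<partial>lborel)"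
    using dens by (intro nn_integral_mono mult_right_mono ennreal_leI) auto
  also have "\<dots> = ennreal (1 / \<sigma>) * ennreal (2 * \<eta>)"
    using \<open>0 \<le> \<eta>\<close> by (subst nn_integral_cmult_indicator) auto
  also have "\<dots> = ennreal (2 * \<eta> / \<sigma>)"
    using \<open>0 \<le> \<eta>\<close> \<sigma>(1) by (simp add: ennreal_mult[symmetric])
  finally have "prob {\<omega>\<in>space M. \<bar>X \<omega>\<bar> \<le> \<eta>} \<le> 2 * \<eta> / \<sigma>"
    using \<open>0 \<le> \<eta>\<close> \<sigma>(1) by (simp add: emeasure_eq_measure)
  then have "1 / 2 \<le> 2 * \<eta> / \<sigma>" using p by simp
  then have "\<sigma> \<le> 4 * \<eta>" using \<sigma>(1) by (simp add: field_simps)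
  from power_mono[OF this, of 2] show ?thesis using normal_second_moment[OF \<sigma>] \<sigma>(1) by simp
qed

text \<open>
  For centered normal variables, pointwise convergence to 0 implies convergence in mean square: the
  probability of a fixed small interval tends to 1, and this bounds the variance.
\<close>

lemma centered_normal_tendsto_zero:
  assumes X: "\<And>k::nat. centered_normal M (X k)" and lim: "\<And>\<omega>. \<omega> \<in> space M \<Longrightarrow> (\<lambda>k. X k \<omega>) \<longlonglongrightarrow> 0"
  shows "(\<lambda>k. expectation (\<lambda>\<omega>. (X k \<omega>)\<^sup>2)) \<longlonglongrightarrow> 0"
proof (rule order_tendstoI)
  fix e :: real assume "0 < e"
  \<comment> \<open>the variance bound \<open>(4 * \<eta>)\<^sup>2\<close> is then below \<open>e\<close>\<close>
  define \<eta> where "\<eta> = sqrt e / 5"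
  have \<eta>: "0 < \<eta>" using \<open>0 < e\<close> by (simp add: \<eta>_def)
  have m[measurable]: "X k \<in> borel_measurable M" for k using X by (simp add: centered_normal_def)
  let ?A = "\<lambda>k. {\<omega>\<in>space M. \<bar>X k \<omega>\<bar> \<le> \<eta>}"
  have "(\<lambda>k. expectation (indicator (?A k) :: 'a \<Rightarrow> real)) \<longlonglongrightarrow> expectation (\<lambda>_. 1)"
  proof (rule integral_dominated_convergence[where w = "\<lambda>_. 1 :: real"])
    show "AE \<omega> in M. (\<lambda>k. indicator (?A k) \<omega> :: real) \<longlonglongrightarrow> 1"
    proof (rule AE_I2)
      fix \<omega> assume \<omega>: "\<omega> \<in> space M"
      have "\<forall>\<^sub>F k in sequentially. \<bar>X k \<omega>\<bar> < \<eta>"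
        using tendstoD[OF lim[OF \<omega>] \<eta>] by (simp add: dist_real_def)
      then have "\<forall>\<^sub>F k in sequentially. indicator (?A k) \<omega> = (1::real)"
        by eventually_elim (use \<omega> in \<open>auto simp: indicator_def\<close>)
      then show "(\<lambda>k. indicator (?A k) \<omega> :: real) \<longlonglongrightarrow> 1" by (rule tendsto_eventually)
    qed
  qed (auto simp: indicator_def)
  then have "(\<lambda>k. prob (?A k)) \<longlonglongrightarrow> 1" by (simp add: prob_space)
  then have "\<forall>\<^sub>F k in sequentially. 1 / 2 < prob (?A k)" by (rule order_tendstoD) simp
  then show "\<forall>\<^sub>F k in sequentially. expectation (\<lambda>\<omega>. (X k \<omega>)\<^sup>2) < e"
  proof eventually_elim
    case (elim k)
    have "expectation (\<lambda>\<omega>. (X k \<omega>)\<^sup>2) \<le> (4 * \<eta>)\<^sup>2"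
      by (rule centered_normal_small_ball[OF X]) (use \<eta> elim in auto)
    also have "\<dots> < e" using \<open>0 < e\<close> by (simp add: \<eta>_def power_mult_distrib power_divide)
    finally show ?case .
  qed
qed (auto intro!: always_eventually less_le_trans[OF _ integral_nonneg_AE])

lemma integrable_product:
  fixes f g :: "'a \<Rightarrow> real"
  assumes [measurable]: "f \<in> borel_measurable M" "g \<in> borel_measurable M"
    and "integrable M (\<lambda>x. (f x)\<^sup>2)" "integrable M (\<lambda>x. (g x)\<^sup>2)"
  shows "integrable M (\<lambda>x. f x * g x)"
proof (rule Bochner_Integration.integrable_bound[OF Bochner_Integration.integrable_add[OF assms(3,4)]])
  show "AE x in M. norm (f x * g x) \<le> norm ((f x)\<^sup>2 + (g x)\<^sup>2)"
  proof (rule AE_I2)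
    fix x
    have "0 \<le> (\<bar>f x\<bar> - \<bar>g x\<bar>)\<^sup>2" by simp
    then have "2 * (\<bar>f x\<bar> * \<bar>g x\<bar>) \<le> (f x)\<^sup>2 + (g x)\<^sup>2" by (simp add: power2_diff)
    moreover have "0 \<le> \<bar>f x\<bar> * \<bar>g x\<bar>" by simp
    ultimately show "norm (f x * g x) \<le> norm ((f x)\<^sup>2 + (g x)\<^sup>2)"
      unfolding real_norm_def abs_mult by linarith
  qed
qed simp

lemma Cauchy_Schwarz_expectation:
  fixes f g :: "'a \<Rightarrow> real"
  assumes m: "f \<in> borel_measurable M" "g \<in> borel_measurable M"
    and i: "integrable M (\<lambda>x. (f x)\<^sup>2)" "integrable M (\<lambda>x. (g x)\<^sup>2)"
  shows "\<bar>expectation (\<lambda>x. f x * g x)\<bar> \<le> sqrt (expectation (\<lambda>x. (f x)\<^sup>2)) * sqrt (expectation (\<lambda>x. (g x)\<^sup>2))"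
proof -
  let ?a = "expectation (\<lambda>x. (f x)\<^sup>2)" and ?b = "expectation (\<lambda>x. f x * g x)" and ?c = "expectation (\<lambda>x. (g x)\<^sup>2)"
  have ac: "0 \<le> ?a" "0 \<le> ?c" by (auto intro!: integral_nonneg_AE)
  have *: "0 \<le> s\<^sup>2 * ?a + 2 * s * u * ?b + u\<^sup>2 * ?c" for s u
  proof -
    have "0 \<le> expectation (\<lambda>x. (s * f x + u * g x)\<^sup>2)" by (auto intro!: integral_nonneg_AE)
    also have "(\<lambda>x. (s * f x + u * g x)\<^sup>2) = (\<lambda>x. s\<^sup>2 * (f x)\<^sup>2 + 2 * s * u * (f x * g x) + u\<^sup>2 * (g x)\<^sup>2)"
      by (auto simp: power2_sum power_mult_distrib algebra_simps)
    also have "expectation \<dots> = s\<^sup>2 * ?a + 2 * s * u * ?b + u\<^sup>2 * ?c"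
      using i integrable_product[OF m i] by simp
    finally show ?thesis .
  qed
  have "?b\<^sup>2 \<le> ?a * ?c"
  proof (cases "?a = 0 \<and> ?c = 0")
    case True
    then show ?thesis using *[of 1 1] *[of 1 "-1"] by auto
  next
    case False
    then consider "0 < ?c" | "0 < ?a" using ac by linarith
    then show ?thesis
    proof cases
      case 1
      have "0 \<le> ?c * (?a * ?c - ?b\<^sup>2)"
        using *[of ?c "- ?b"] by (simp add: power2_eq_square algebra_simps)
      then show ?thesis using 1 by (simp add: zero_le_mult_iff)
    next
      case 2
      have "0 \<le> ?a * (?a * ?c - ?b\<^sup>2)"
        using *[of "- ?b" ?a] by (simp add: power2_eq_square algebra_simps)
      then show ?thesis using 2 by (simp add: zero_le_mult_iff)
    qed
  qed
  then have "sqrt (?b\<^sup>2) \<le> sqrt (?a * ?c)" by (rule real_sqrt_le_mono)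
  then show ?thesis by (simp add: real_sqrt_mult)
qed

end

section \<open>Gaussian vectors on \<open>C(T)\<close>\<close>

text \<open>
  The partitions are part of the context, as Riemann sums are used to evaluate pairings.
\<close>

locale gaussian_vector = prob_space P
  for P :: "'w measure" and \<tau> :: real and t :: "nat \<Rightarrow> nat \<Rightarrow> real" and Z :: "'w \<Rightarrow> real \<Rightarrow> real" +
  assumes pp: "partition_points \<tau> t" and gaussian: "centered_gaussian_vector P \<tau> Z"
begin

abbreviation K where "K \<equiv> cov_kernel P Z"

lemma path_continuous:
  assumes "\<omega> \<in> space P"
  shows "continuous_on {0..\<tau>} (Z \<omega>)"
proof -
  have "Z \<omega> \<in> space (cont_borel \<tau>)"
    using assms gaussian by (auto simp: centered_gaussian_vector_def dest: measurable_space)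
  then show ?thesis
    by (auto simp: cont_borel_def space_measure_of_conv)
qed

lemma pairing_centered_normal: "m \<in> measures_on {0..\<tau>} \<Longrightarrow> centered_normal P (\<lambda>\<omega>. pairing {0..\<tau>} m (Z \<omega>))"
  using gaussian by (simp add: centered_gaussian_vector_def)

lemma centered_normal_cong:
  assumes "\<And>\<omega>. \<omega> \<in> space P \<Longrightarrow> X \<omega> = Y \<omega>" and X: "centered_normal P X"
  shows "centered_normal P Y"
proof -
  have "distributed P lborel X (normal_density 0 \<sigma>) \<longleftrightarrow> distributed P lborel Y (normal_density 0 \<sigma>)" for \<sigma>
    unfolding distributed_def using assms(1)
    by (auto simp: cong: distr_cong measurable_cong)
  moreover have "X \<in> borel_measurable P \<longleftrightarrow> Y \<in> borel_measurable P"
    by (rule measurable_cong) (rule assms(1))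
  moreover have "(AE \<omega> in P. X \<omega> = 0) \<longleftrightarrow> (AE \<omega> in P. Y \<omega> = 0)"
    by (rule AE_cong) (simp add: assms(1))
  ultimately show ?thesis using X unfolding centered_normal_def by simp
qed

lemma eval_centered_normal: "s \<in> {0..\<tau>} \<Longrightarrow> centered_normal P (\<lambda>\<omega>. Z \<omega> s)"
  by (rule centered_normal_cong[OF _ pairing_centered_normal[OF point_mass_in_measures_on]])
    (auto intro!: pairing_point_mass[OF pp] path_continuous)

lemma diff_centered_normal:
  assumes "r \<in> {0..\<tau>}" "s \<in> {0..\<tau>}"
  shows "centered_normal P (\<lambda>\<omega>. Z \<omega> r - Z \<omega> s)"
proof (rule centered_normal_cong)
  show "centered_normal P (\<lambda>\<omega>. pairing {0..\<tau>} (point_mass r - point_mass s) (Z \<omega>))"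
    using assms by (intro pairing_centered_normal measures_on_diff point_mass_in_measures_on)
  show "pairing {0..\<tau>} (point_mass r - point_mass s) (Z \<omega>) = Z \<omega> r - Z \<omega> s" if "\<omega> \<in> space P" for \<omega>
    using assms path_continuous[OF that] by (simp add: pairing_minus[OF pp] pairing_point_mass[OF pp])
qed

text \<open>A Riemann sum is the pairing with a combination of point masses.\<close>

lemma riemann_sum_centered_normal:
  assumes n: "1 \<le> n"
  shows "centered_normal P (\<lambda>\<omega>. riemann_sum t n m (Z \<omega>))"
proof (rule centered_normal_cong)
  let ?m = "\<Sum>i=1..n. sm m (cell t n i) *\<^sub>R point_mass (t n i)"
  show "centered_normal P (\<lambda>\<omega>. pairing {0..\<tau>} ?m (Z \<omega>))"
    by (intro pairing_centered_normal measures_on_sum measures_on_scaleR point_mass_in_measures_on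
        partition_mem[OF pp n]) auto
  show "pairing {0..\<tau>} ?m (Z \<omega>) = riemann_sum t n m (Z \<omega>)" if "\<omega> \<in> space P" for \<omega>
    unfolding riemann_sum_def pairing_sum[OF pp path_continuous[OF that]]
    using partition_mem[OF pp n]
    by (intro sum.cong refl) (simp add: pairing_scaleR[OF pp] pairing_point_mass[OF pp] path_continuous[OF that])
qed

lemma kernel_eq:
  assumes "r \<in> {0..\<tau>}" "s \<in> {0..\<tau>}"
  shows "K r s = expectation (\<lambda>\<omega>. Z \<omega> r * Z \<omega> s)"
  using assms by (simp add: cov_kernel_def covariance_def centered_normal_expectation eval_centered_normal)

lemma kernel_commute: "K r s = K s r"
  by (simp add: cov_kernel_def covariance_def mult.commute)

lemma eval_measurable: "s \<in> {0..\<tau>} \<Longrightarrow> (\<lambda>\<omega>. Z \<omega> s) \<in> borel_measurable P"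
  using eval_centered_normal by (simp add: centered_normal_def)

lemma eval_product_integrable:
  "r \<in> {0..\<tau>} \<Longrightarrow> s \<in> {0..\<tau>} \<Longrightarrow> integrable P (\<lambda>\<omega>. Z \<omega> r * Z \<omega> s)"
  by (intro integrable_product eval_measurable centered_normal_square_integrable eval_centered_normal)

lemma discrete_form_eq:
  assumes n: "1 \<le> n"
  shows "discrete_form t n K m m = expectation (\<lambda>\<omega>. (riemann_sum t n m (Z \<omega>))\<^sup>2)"
proof -
  let ?c = "\<lambda>i. sm m (cell t n i)"
  have T: "t n i \<in> {0..\<tau>}" if "i \<in> {1..n}" for i using partition_mem[OF pp n] that by auto
  have "(riemann_sum t n m (Z \<omega>))\<^sup>2
      = (\<Sum>i=1..n. \<Sum>j=1..n. ?c i * ?c j * (Z \<omega> (t n i) * Z \<omega> (t n j)))" for \<omega>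
    unfolding riemann_sum_def power2_eq_square sum_product by (simp add: mult_ac)
  then have "expectation (\<lambda>\<omega>. (riemann_sum t n m (Z \<omega>))\<^sup>2)
      = (\<Sum>i=1..n. \<Sum>j=1..n. ?c i * ?c j * expectation (\<lambda>\<omega>. Z \<omega> (t n i) * Z \<omega> (t n j)))"
    using eval_product_integrable[OF T T]
    by (simp only: Bochner_Integration.integral_sum Bochner_Integration.integrable_sum
        integrable_mult_right integral_mult_right_zero cong: sum.cong)
  also have "\<dots> = discrete_form t n K m m"
    unfolding discrete_form_expand using T by (intro sum.cong refl) (simp add: kernel_eq)
  finally show ?thesis ..
qed

text \<open>
  Continuity of the covariance follows from continuity of the paths: the increments of a path tend
  to 0 pointwise, hence in mean square.
\<close>

lemma kernel_jointly_continuous: "continuous_on ({0..\<tau>} \<times> {0..\<tau>}) (\<lambda>(r, s). K r s)"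
  unfolding continuous_on_sequentially
proof (intro allI ballI impI, elim conjE)
  fix x and a assume a: "a \<in> {0..\<tau>} \<times> {0..\<tau>}" and x: "\<forall>n. x n \<in> {0..\<tau>} \<times> {0..\<tau>}" and lim: "x \<longlonglongrightarrow> a"
  let ?T = "{0..\<tau>}"
  define r s where "r n = fst (x n)" and "s n = snd (x n)" for n
  define r0 s0 where "r0 = fst a" and "s0 = snd a"
  have T: "r n \<in> ?T" "s n \<in> ?T" "r0 \<in> ?T" "s0 \<in> ?T" for n
    using a x by (auto simp: r_def s_def r0_def s0_def mem_Times_iff)
  have rs: "r \<longlonglongrightarrow> r0" "s \<longlonglongrightarrow> s0"
    using tendsto_fst[OF lim] tendsto_snd[OF lim] by (auto simp: r_def[abs_def] s_def[abs_def] r0_def s0_def)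
  let ?N = "\<lambda>f. sqrt (expectation (\<lambda>\<omega>. (f \<omega>)\<^sup>2))"
  have to0: "(\<lambda>n. ?N (\<lambda>\<omega>. Z \<omega> (u n) - Z \<omega> u0)) \<longlonglongrightarrow> 0"
    if "u \<longlonglongrightarrow> u0" "\<And>n. u n \<in> ?T" "u0 \<in> ?T" for u u0
  proof -
    have "(\<lambda>n. Z \<omega> (u n) - Z \<omega> u0) \<longlonglongrightarrow> 0" if "\<omega> \<in> space P" for \<omega>
      using continuous_on_tendsto_compose[OF path_continuous[OF that] \<open>u \<longlonglongrightarrow> u0\<close> \<open>u0 \<in> ?T\<close>]
        \<open>\<And>n. u n \<in> ?T\<close> by (auto intro!: LIM_zero)
    from centered_normal_tendsto_zero[OF diff_centered_normal[OF that(2,3)] this]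
    show ?thesis using tendsto_real_sqrt by force
  qed
  have sq: "integrable P (\<lambda>\<omega>. (Z \<omega> u)\<^sup>2)" "integrable P (\<lambda>\<omega>. (Z \<omega> u - Z \<omega> v)\<^sup>2)" "(\<lambda>\<omega>. Z \<omega> u - Z \<omega> v) \<in> borel_measurable P"
    if "u \<in> ?T" "v \<in> ?T" for u v
    using that centered_normal_square_integrable[OF eval_centered_normal] centered_normal_square_integrable[OF diff_centered_normal]
    by (auto intro!: borel_measurable_diff eval_measurable)
  have diff: "\<bar>K (r n) (s n) - K r0 s0\<bar> \<le> ?N (\<lambda>\<omega>. Z \<omega> (r n) - Z \<omega> r0) * ?N (\<lambda>\<omega>. Z \<omega> (s n) - Z \<omega> s0)
      + ?N (\<lambda>\<omega>. Z \<omega> (r n) - Z \<omega> r0) * ?N (\<lambda>\<omega>. Z \<omega> s0) + ?N (\<lambda>\<omega>. Z \<omega> r0) * ?N (\<lambda>\<omega>. Z \<omega> (s n) - Z \<omega> s0)" for n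
  proof -
    have i: "integrable P (\<lambda>\<omega>. (Z \<omega> (r n) - Z \<omega> r0) * (Z \<omega> (s n) - Z \<omega> s0))"
      "integrable P (\<lambda>\<omega>. (Z \<omega> (r n) - Z \<omega> r0) * Z \<omega> s0)" "integrable P (\<lambda>\<omega>. Z \<omega> r0 * (Z \<omega> (s n) - Z \<omega> s0))"
      using T by (auto intro!: integrable_product sq eval_measurable)
    have "K (r n) (s n) - K r0 s0 = expectation (\<lambda>\<omega>. Z \<omega> (r n) * Z \<omega> (s n) - Z \<omega> r0 * Z \<omega> s0)"
      using T by (simp add: kernel_eq eval_product_integrable)
    also have "(\<lambda>\<omega>. Z \<omega> (r n) * Z \<omega> (s n) - Z \<omega> r0 * Z \<omega> s0)
      = (\<lambda>\<omega>. (Z \<omega> (r n) - Z \<omega> r0) * (Z \<omega> (s n) - Z \<omega> s0) + (Z \<omega> (r n) - Z \<omega> r0) * Z \<omega> s0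
          + Z \<omega> r0 * (Z \<omega> (s n) - Z \<omega> s0))"
      by (auto simp: algebra_simps)
    also have "expectation \<dots> = expectation (\<lambda>\<omega>. (Z \<omega> (r n) - Z \<omega> r0) * (Z \<omega> (s n) - Z \<omega> s0))
      + expectation (\<lambda>\<omega>. (Z \<omega> (r n) - Z \<omega> r0) * Z \<omega> s0) + expectation (\<lambda>\<omega>. Z \<omega> r0 * (Z \<omega> (s n) - Z \<omega> s0))"
      using i by (simp add: Bochner_Integration.integral_add Bochner_Integration.integrable_add)
    finally show ?thesis
      using Cauchy_Schwarz_expectation[OF sq(3)[OF T(1)[of n] T(3)] sq(3)[OF T(2)[of n] T(4)] sq(2)[OF T(1)[of n] T(3)] sq(2)[OF T(2)[of n] T(4)]]
        Cauchy_Schwarz_expectation[OF sq(3)[OF T(1)[of n] T(3)] eval_measurable[OF T(4)] sq(2)[OF T(1)[of n] T(3)] sq(1)[OF T(4,4)]]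
        Cauchy_Schwarz_expectation[OF eval_measurable[OF T(3)] sq(3)[OF T(2)[of n] T(4)] sq(1)[OF T(3,3)] sq(2)[OF T(2)[of n] T(4)]]
      by linarith
  qed
  have "(\<lambda>n. K (r n) (s n) - K r0 s0) \<longlonglongrightarrow> 0"
  proof (rule Lim_null_comparison)
    show "\<forall>\<^sub>F n in sequentially. norm (K (r n) (s n) - K r0 s0) \<le> ?N (\<lambda>\<omega>. Z \<omega> (r n) - Z \<omega> r0) * ?N (\<lambda>\<omega>. Z \<omega> (s n) - Z \<omega> s0)
      + ?N (\<lambda>\<omega>. Z \<omega> (r n) - Z \<omega> r0) * ?N (\<lambda>\<omega>. Z \<omega> s0) + ?N (\<lambda>\<omega>. Z \<omega> r0) * ?N (\<lambda>\<omega>. Z \<omega> (s n) - Z \<omega> s0)"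
      using diff by simp
    have "(\<lambda>n. ?N (\<lambda>\<omega>. Z \<omega> (r n) - Z \<omega> r0) * ?N (\<lambda>\<omega>. Z \<omega> (s n) - Z \<omega> s0)
      + ?N (\<lambda>\<omega>. Z \<omega> (r n) - Z \<omega> r0) * ?N (\<lambda>\<omega>. Z \<omega> s0) + ?N (\<lambda>\<omega>. Z \<omega> r0) * ?N (\<lambda>\<omega>. Z \<omega> (s n) - Z \<omega> s0))
      \<longlonglongrightarrow> 0 * 0 + 0 * ?N (\<lambda>\<omega>. Z \<omega> s0) + ?N (\<lambda>\<omega>. Z \<omega> r0) * 0"
      using T rs by (intro tendsto_intros to0) auto
    then show "(\<lambda>n. ?N (\<lambda>\<omega>. Z \<omega> (r n) - Z \<omega> r0) * ?N (\<lambda>\<omega>. Z \<omega> (s n) - Z \<omega> s0)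
      + ?N (\<lambda>\<omega>. Z \<omega> (r n) - Z \<omega> r0) * ?N (\<lambda>\<omega>. Z \<omega> s0) + ?N (\<lambda>\<omega>. Z \<omega> r0) * ?N (\<lambda>\<omega>. Z \<omega> (s n) - Z \<omega> s0)) \<longlonglongrightarrow> 0"
      by simp
  qed
  then show "((\<lambda>(r, s). K r s) \<circ> x) \<longlonglongrightarrow> (case a of (r, s) \<Rightarrow> K r s)"
    by (auto simp: LIM_zero_iff r_def s_def r0_def s0_def comp_def case_prod_beta)
qed

sublocale kernel_on_interval \<tau> t K
  by unfold_locales (fact pp kernel_jointly_continuous kernel_commute)+

text \<open>
  The discretised form is the second moment of a Riemann sum, so no exchange of integrals is needed.
\<close>

lemma kernel_form_nonneg: "0 \<le> kernel_form \<tau> K m m"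
proof (rule tendsto_lowerbound[OF discrete_form_tendsto])
  show "\<forall>\<^sub>F n in sequentially. 0 \<le> discrete_form t n K m m"
    using eventually_ge_at_top[of 1]
    by eventually_elim (simp add: discrete_form_eq integral_nonneg_AE)
qed simp

text \<open>
  The constant does not depend on the partition.
\<close>

lemma riemann_sum_moments:
  obtains c where "0 \<le> c" and "\<And>n m. 1 \<le> n \<Longrightarrow> integrable P (\<lambda>\<omega>. \<bar>riemann_sum t n m (Z \<omega>)\<bar> ^ r)"
    and "\<And>n m. 1 \<le> n \<Longrightarrow> expectation (\<lambda>\<omega>. \<bar>riemann_sum t n m (Z \<omega>)\<bar> ^ r) \<le> c * norm m ^ r"
proof -
  obtain c where c: "0 \<le> c" "\<And>X. centered_normal P X \<Longrightarrow> integrable P (\<lambda>\<omega>. \<bar>X \<omega>\<bar> ^ r)"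
    "\<And>X. centered_normal P X \<Longrightarrow>
      expectation (\<lambda>\<omega>. \<bar>X \<omega>\<bar> ^ r) \<le> c * sqrt (expectation (\<lambda>\<omega>. (X \<omega>)\<^sup>2)) ^ r"
    using centered_normal_moments[of r] by metis
  obtain \<kappa> where \<kappa>: "0 \<le> \<kappa>" "\<And>r s. r \<in> {0..\<tau>} \<Longrightarrow> s \<in> {0..\<tau>} \<Longrightarrow> \<bar>K r s\<bar> \<le> \<kappa>"
    using kernel_bounded by metis
  show thesis
  proof
    show "0 \<le> c * sqrt \<kappa> ^ r" using c \<kappa> by simp
    fix n :: nat and m assume n: "1 \<le> n"
    show "integrable P (\<lambda>\<omega>. \<bar>riemann_sum t n m (Z \<omega>)\<bar> ^ r)"
      by (rule c(2)[OF riemann_sum_centered_normal[OF n]])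
    have "\<bar>discrete_form t n K m m\<bar> \<le> \<kappa> * (norm m)\<^sup>2"
      using abs_discrete_form_le[OF \<kappa> n, of m m] by (simp add: power2_eq_square mult.assoc)
    then have "sqrt (discrete_form t n K m m) \<le> sqrt (\<kappa> * (norm m)\<^sup>2)"
      by (intro real_sqrt_le_mono) simp
    then have le: "sqrt (discrete_form t n K m m) \<le> sqrt \<kappa> * norm m"
      by (simp add: real_sqrt_mult)
    have "expectation (\<lambda>\<omega>. \<bar>riemann_sum t n m (Z \<omega>)\<bar> ^ r) \<le> c * sqrt (discrete_form t n K m m) ^ r"
      unfolding discrete_form_eq[OF n] by (rule c(3)[OF riemann_sum_centered_normal[OF n]])
    also have "\<dots> \<le> c * (sqrt \<kappa> * norm m) ^ r"
      using le c(1) by (intro mult_left_mono power_mono) (auto simp: discrete_form_eq[OF n])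
    finally show "expectation (\<lambda>\<omega>. \<bar>riemann_sum t n m (Z \<omega>)\<bar> ^ r) \<le> c * sqrt \<kappa> ^ r * norm m ^ r"
      by (simp add: power_mult_distrib mult.assoc)
  qed
qed

end

section \<open>Chaining\<close>

text \<open>
  Nets of mesh proportional to $4^{-m}$: one point of the set in each nonempty cell of a cubic grid.
\<close>

lemma finite_nets:
  fixes A :: "(real ^ 'p) set"
  assumes "bounded A"
  obtains c D N where "0 \<le> c" "0 < D" "\<And>m. finite (N m)" "\<And>m. N m \<subseteq> A"
    "\<And>m. real (card (N m)) \<le> c * (4 ^ m) ^ CARD('p)"
    "\<And>m a. a \<in> A \<Longrightarrow> \<exists>b\<in>N m. norm (a - b) \<le> D / 4 ^ m"
proof -
  obtain B where B: "0 < B" "\<And>a. a \<in> A \<Longrightarrow> norm a \<le> B"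
    using assms by (auto simp: bounded_pos)
  define g where "g m a = (\<lambda>i::'p. \<lfloor>4 ^ m * a $ i\<rfloor>)" for m :: nat and a :: "real ^ 'p"
  define k where "k m = \<lceil>4 ^ m * B\<rceil>" for m :: nat
  define N where "N m = (\<lambda>v. SOME a. a \<in> A \<and> g m a = v) ` (g m ` A)" for m
  have gA: "g m ` A \<subseteq> PiE UNIV (\<lambda>_. {- k m..k m})" for m
  proof (intro image_subsetI PiE_I)
    fix a i assume "a \<in> A"
    then have "\<bar>a $ i\<bar> \<le> B" using B(2) component_le_norm_cart[of a i] by (meson order_trans)
    then have "\<bar>4 ^ m * a $ i\<bar> \<le> 4 ^ m * B" by (simp add: abs_mult)
    then have "- (4 ^ m * B) \<le> 4 ^ m * a $ i" "4 ^ m * a $ i \<le> 4 ^ m * B" by linarith+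
    from floor_mono[OF this(1)] floor_mono[OF this(2)]
    show "g m a i \<in> {- k m..k m}"
      unfolding g_def k_def ceiling_def using floor_le_ceiling[of "4 ^ m * B"]
      by (auto simp: ceiling_def)
  qed auto
  have finP: "finite (PiE (UNIV :: 'p set) (\<lambda>_. {- k m..k m}))" for m by (intro finite_PiE) auto
  have fin: "finite (g m ` A)" for m by (rule finite_subset[OF gA finP])
  have rep: "(SOME a'. a' \<in> A \<and> g m a' = g m a) \<in> A \<and> g m (SOME a'. a' \<in> A \<and> g m a' = g m a) = g m a"
    if "a \<in> A" for m a
    by (rule someI[of "\<lambda>a'. a' \<in> A \<and> g m a' = g m a" a]) (use that in simp)
  have card: "real (card (N m)) \<le> (2 * B + 3) ^ CARD('p) * (4 ^ m) ^ CARD('p)" for m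
  proof -
    have "card (N m) \<le> card (PiE (UNIV :: 'p set) (\<lambda>_. {- k m..k m}))"
      unfolding N_def using card_image_le[OF fin] card_mono[OF finP gA] by (rule order_trans)
    also have "\<dots> = nat (2 * k m + 1) ^ CARD('p)" by (simp add: card_PiE)
    finally have "real (card (N m)) \<le> real (nat (2 * k m + 1) ^ CARD('p))" by linarith
    also have "\<dots> = real_of_int (2 * k m + 1) ^ CARD('p)"
    proof -
      have "0 \<le> 4 ^ m * B" using B(1) by simp
      then have "0 \<le> k m" unfolding k_def by linarith
      then show ?thesis by simp
    qed
    also have "\<dots> \<le> ((2 * B + 3) * 4 ^ m) ^ CARD('p)"
    proof (rule power_mono)
      have "real_of_int (k m) \<le> 4 ^ m * B + 1" unfolding k_def by linarith
      moreover have "(1::real) \<le> 4 ^ m" by simp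
      moreover have "(2 * B + 3) * 4 ^ m = 2 * (4 ^ m * B) + 3 * 4 ^ m" by (simp add: algebra_simps)
      moreover have "real_of_int (2 * k m + 1) = 2 * real_of_int (k m) + 1" by simp
      ultimately show "real_of_int (2 * k m + 1) \<le> (2 * B + 3) * 4 ^ m" by linarith
      have "0 \<le> 4 ^ m * B" using B(1) by simp
      then have "0 \<le> k m" unfolding k_def by linarith
      then show "0 \<le> real_of_int (2 * k m + 1)" by simp
    qed
    finally show ?thesis by (simp add: power_mult_distrib)
  qed
  have net: "\<exists>b\<in>N m. norm (a - b) \<le> real CARD('p) / 4 ^ m" if a: "a \<in> A" for m a
  proof
    let ?b = "SOME a'. a' \<in> A \<and> g m a' = g m a"
    show "?b \<in> N m" using a by (auto simp: N_def)
    have "\<bar>(a - ?b) $ i\<bar> \<le> 1 / 4 ^ m" for i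
    proof -
      have "\<lfloor>4 ^ m * ?b $ i\<rfloor> = \<lfloor>4 ^ m * a $ i\<rfloor>" using rep[OF a, of m] unfolding g_def by metis
      then have "\<bar>4 ^ m * a $ i - 4 ^ m * ?b $ i\<bar> \<le> 1" by linarith
      then have "4 ^ m * \<bar>(a - ?b) $ i\<bar> \<le> 1"
        by (simp add: right_diff_distrib[symmetric] abs_mult)
      then show ?thesis by (simp add: field_simps)
    qed
    then have "(\<Sum>i\<in>UNIV. \<bar>(a - ?b) $ i\<bar>) \<le> (\<Sum>i\<in>(UNIV::'p set). 1 / 4 ^ m)" by (intro sum_mono)
    then show "norm (a - ?b) \<le> real CARD('p) / 4 ^ m"
      using norm_le_l1_cart[of "a - ?b"] by simp
  qed
  show thesis
  proof
    show "0 \<le> (2 * B + 3) ^ CARD('p)" using B(1) by simp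
    show "0 < real CARD('p)" by simp
    show "finite (N m)" for m using fin by (simp add: N_def)
    show "N m \<subseteq> A" for m using rep by (auto simp: N_def)
  qed (use card net in blast)+
qed

text \<open>
  Bounds on the moments of order \<open>R\<close> of the increments of a process over a bounded set bound the
  moment of its supremum, with the same constant \<open>C\<close> for all processes. To avoid measurability issues
  the supremum is replaced with a measurable majorant \<open>U\<close>, a multiple of the sum of all increments, raised
  to the power \<open>R\<close>, along links of consecutive nets of mesh $4^{-m}$. The weights $2^{mR}$ make the
  increments along a chain summable, and the condition on \<open>R\<close> pays for them and for the number of links.
\<close>

lemma chaining:
  fixes A :: "(real ^ 'p) set" and R :: nat and M :: "'w measure"
  assumes "bounded A" and R: "4 * CARD('p) < R"
  shows "\<exists>C\<ge>0. \<forall>W b. 0 \<le> b \<longrightarrow> (\<forall>a\<in>A. W a \<in> borel_measurable M) \<longrightarrow>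
    (\<forall>\<omega>\<in>space M. continuous_on A (\<lambda>a. W a \<omega>)) \<longrightarrow>
    (\<forall>a\<in>A. (\<integral>\<^sup>+\<omega>. ennreal (\<bar>W a \<omega>\<bar> ^ R) \<partial>M) \<le> ennreal b) \<longrightarrow>
    (\<forall>a\<in>A. \<forall>a'\<in>A. (\<integral>\<^sup>+\<omega>. ennreal (\<bar>W a \<omega> - W a' \<omega>\<bar> ^ R) \<partial>M) \<le> ennreal (b * norm (a - a') ^ R)) \<longrightarrow>
    (\<exists>U\<in>borel_measurable M. (\<integral>\<^sup>+\<omega>. U \<omega> \<partial>M) \<le> ennreal (C * b) \<and>
      (\<forall>\<omega>\<in>space M. \<forall>a\<in>A. ennreal (\<bar>W a \<omega>\<bar> ^ R) \<le> U \<omega>))"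
proof -
  obtain c D N where c: "0 \<le> c" and D: "0 < D" and N: "\<And>m. finite (N m)" "\<And>m. N m \<subseteq> A"
    and card: "\<And>m. real (card (N m)) \<le> c * (4 ^ m) ^ CARD('p)"
    and net: "\<And>m a. a \<in> A \<Longrightarrow> \<exists>b\<in>N m. norm (a - b) \<le> D / 4 ^ m"
    using finite_nets[OF \<open>bounded A\<close>] by metis
  let ?p = "CARD('p)"
  define E where "E m = {(a, a'). a \<in> N m \<and> a' \<in> N (Suc m) \<and> norm (a - a') \<le> 2 * D / 4 ^ m}" for m
  have E: "finite (E m)" for m
    by (rule finite_subset[of _ "N m \<times> N (Suc m)"]) (use N(1) in \<open>auto simp: E_def\<close>)
  define k where "k = c * c * 4 ^ ?p * (2 * D) ^ R"
  have k: "0 \<le> k" using c D by (simp add: k_def)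
  have weight: "2 ^ (m * R) * (real (card (E m)) * (2 * D / 4 ^ m) ^ R) \<le> k * (1 / 2) ^ m" for m
  proof -
    have "card (E m) \<le> card (N m \<times> N (Suc m))"
      by (rule card_mono) (use N(1) in \<open>auto simp: E_def\<close>)
    then have "real (card (E m)) \<le> real (card (N m)) * real (card (N (Suc m)))"
      by (simp add: card_cartesian_product flip: of_nat_mult)
    also have "\<dots> \<le> (c * (4 ^ m) ^ ?p) * (c * (4 ^ Suc m) ^ ?p)"
      using c by (intro mult_mono card) auto
    finally have "2 ^ (m * R) * (real (card (E m)) * (2 * D / 4 ^ m) ^ R)
        \<le> 2 ^ (m * R) * ((c * (4 ^ m) ^ ?p) * (c * (4 ^ Suc m) ^ ?p) * (2 * D / 4 ^ m) ^ R)"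
      using D by (intro mult_left_mono mult_right_mono) auto
    also have "\<dots> = k * ((2 ^ (m * R) * (4 ^ m) ^ ?p * (4 ^ m) ^ ?p) / (4 ^ m) ^ R)"
      by (simp add: k_def power_mult_distrib power_divide)
    also have "(2 ^ (m * R) * (4 ^ m) ^ ?p * (4 ^ m) ^ ?p) / (4 ^ m) ^ R \<le> (1 / 2 :: real) ^ m"
    proof -
      have four: "(4::real) ^ m = 2 ^ (2 * m)" by (simp add: power_mult)
      have "m * (4 * ?p + 1) \<le> m * R" using R by (intro mult_le_mono) auto
      then have "m * R + 2 * m * ?p + 2 * m * ?p + m \<le> 2 * m * R" by (simp add: algebra_simps)
      then have "(2::real) ^ (m * R + 2 * m * ?p + 2 * m * ?p + m) \<le> 2 ^ (2 * m * R)"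
        by (intro power_increasing) auto
      then have "((2::real) ^ (m * R) * 2 ^ (2 * m * ?p) * 2 ^ (2 * m * ?p)) * 2 ^ m \<le> 2 ^ (2 * m * R)"
        by (simp only: power_add)
      moreover have "x / y \<le> 1 / w" if "x * w \<le> y" "0 < y" "0 < w" for x y w :: real
        using that by (simp add: field_simps)
      ultimately have "((2::real) ^ (m * R) * 2 ^ (2 * m * ?p) * 2 ^ (2 * m * ?p)) / 2 ^ (2 * m * R) \<le> 1 / 2 ^ m"
        by simp
      then show ?thesis
        unfolding four power_mult[symmetric] power_one_over .
    qed
    finally show ?thesis using k by (simp add: mult_left_mono)
  qed
  define C where "C = 3 ^ R * (c + 2 * k)"
  show ?thesis
  proof (intro exI[of _ C] conjI allI impI)
    show "0 \<le> C" using c k by (simp add: C_def)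
    fix W :: "real ^ 'p \<Rightarrow> 'w \<Rightarrow> real" and b :: real
    assume b: "0 \<le> b" and "\<forall>a\<in>A. W a \<in> borel_measurable M"
      and "\<forall>\<omega>\<in>space M. continuous_on A (\<lambda>a. W a \<omega>)"
      and "\<forall>a\<in>A. (\<integral>\<^sup>+\<omega>. ennreal (\<bar>W a \<omega>\<bar> ^ R) \<partial>M) \<le> ennreal b"
      and "\<forall>a\<in>A. \<forall>a'\<in>A. (\<integral>\<^sup>+\<omega>. ennreal (\<bar>W a \<omega> - W a' \<omega>\<bar> ^ R) \<partial>M) \<le> ennreal (b * norm (a - a') ^ R)"
    note m = this(2)[rule_format] and cont = this(3)[rule_format] and W = this(4)[rule_format]
      and dW = this(5)[rule_format]
    \<comment> \<open>\<open>U0\<close> bounds the starting value and each weighted increment of every chain at once\<close>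
    define S where "S m \<omega> = (\<Sum>(a, a')\<in>E m. ennreal (\<bar>W a \<omega> - W a' \<omega>\<bar> ^ R))" for m \<omega>
    define U0 where "U0 \<omega> = (\<Sum>a\<in>N 0. ennreal (\<bar>W a \<omega>\<bar> ^ R)) + (\<Sum>m. 2 ^ (m * R) * S m \<omega>)" for \<omega>
    have EA: "a \<in> A" "a' \<in> A" if "(a, a') \<in> E m" for a a' m
      using that N(2) by (auto simp: E_def)
    have Sm[measurable]: "S m \<in> borel_measurable M" for m
      unfolding S_def[abs_def] split_beta
    proof (rule borel_measurable_sum)
      fix x assume "x \<in> E m"
      then have [measurable]: "W (fst x) \<in> borel_measurable M" "W (snd x) \<in> borel_measurable M"
        using EA[of "fst x" "snd x"] m by auto
      show "(\<lambda>\<omega>. ennreal (\<bar>W (fst x) \<omega> - W (snd x) \<omega>\<bar> ^ R)) \<in> borel_measurable M" by measurable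
    qed
    have Wm[measurable]: "(\<lambda>\<omega>. ennreal (\<bar>W a \<omega>\<bar> ^ R)) \<in> borel_measurable M" if "a \<in> N 0" for a
      using m[of a] N(2)[of 0] that by auto
    have U0m: "U0 \<in> borel_measurable M"
      unfolding U0_def[abs_def] by (intro borel_measurable_add borel_measurable_sum borel_measurable_suminf Wm) auto
    have iS: "(\<integral>\<^sup>+\<omega>. 2 ^ (m * R) * S m \<omega> \<partial>M) \<le> ennreal (k * b * (1 / 2) ^ m)" for m
    proof -
      have "(\<integral>\<^sup>+\<omega>. S m \<omega> \<partial>M) = (\<Sum>(a, a')\<in>E m. \<integral>\<^sup>+\<omega>. ennreal (\<bar>W a \<omega> - W a' \<omega>\<bar> ^ R) \<partial>M)"
        unfolding S_def split_beta
      proof (rule nn_integral_sum)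
        fix x assume "x \<in> E m"
        then have [measurable]: "W (fst x) \<in> borel_measurable M" "W (snd x) \<in> borel_measurable M"
          using EA[of "fst x" "snd x"] m by auto
        show "(\<lambda>\<omega>. ennreal (\<bar>W (fst x) \<omega> - W (snd x) \<omega>\<bar> ^ R)) \<in> borel_measurable M" by measurable
      qed
      also have "\<dots> \<le> (\<Sum>(a, a')\<in>E m. ennreal (b * (2 * D / 4 ^ m) ^ R))"
      proof (rule sum_mono, clarify)
        fix a a' assume e: "(a, a') \<in> E m"
        have "b * norm (a - a') ^ R \<le> b * (2 * D / 4 ^ m) ^ R"
          using e b by (intro mult_left_mono power_mono) (auto simp: E_def)
        then show "(\<integral>\<^sup>+\<omega>. ennreal (\<bar>W a \<omega> - W a' \<omega>\<bar> ^ R) \<partial>M) \<le> ennreal (b * (2 * D / 4 ^ m) ^ R)"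
          using dW[OF EA[OF e]] by (meson ennreal_leI order_trans)
      qed
      also have "\<dots> = ennreal (real (card (E m)) * (b * (2 * D / 4 ^ m) ^ R))"
        using b D by (simp add: ennreal_mult ennreal_of_nat_eq_real_of_nat)
      finally have "(\<integral>\<^sup>+\<omega>. 2 ^ (m * R) * S m \<omega> \<partial>M)
          \<le> ennreal (2 ^ (m * R)) * ennreal (real (card (E m)) * (b * (2 * D / 4 ^ m) ^ R))"
        by (subst nn_integral_cmult) (auto intro!: mult_left_mono simp: ennreal_power[symmetric])
      also have "\<dots> = ennreal (b * (2 ^ (m * R) * (real (card (E m)) * (2 * D / 4 ^ m) ^ R)))"
        using b D by (simp add: ennreal_mult[symmetric] mult_ac)
      also have "\<dots> \<le> ennreal (b * (k * (1 / 2) ^ m))"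
        by (intro ennreal_leI mult_left_mono weight b)
      finally show ?thesis by (simp add: mult_ac)
    qed
    have "(\<integral>\<^sup>+\<omega>. U0 \<omega> \<partial>M) = (\<Sum>a\<in>N 0. \<integral>\<^sup>+\<omega>. ennreal (\<bar>W a \<omega>\<bar> ^ R) \<partial>M) + (\<Sum>m. \<integral>\<^sup>+\<omega>. 2 ^ (m * R) * S m \<omega> \<partial>M)"
    proof -
      have "(\<integral>\<^sup>+\<omega>. (\<Sum>a\<in>N 0. ennreal (\<bar>W a \<omega>\<bar> ^ R)) \<partial>M) = (\<Sum>a\<in>N 0. \<integral>\<^sup>+\<omega>. ennreal (\<bar>W a \<omega>\<bar> ^ R) \<partial>M)"
        by (rule nn_integral_sum[OF Wm])
      moreover have "(\<integral>\<^sup>+\<omega>. (\<Sum>m. 2 ^ (m * R) * S m \<omega>) \<partial>M) = (\<Sum>m. \<integral>\<^sup>+\<omega>. 2 ^ (m * R) * S m \<omega> \<partial>M)"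
        by (rule nn_integral_suminf) measurable
      moreover have "(\<lambda>\<omega>. \<Sum>a\<in>N 0. ennreal (\<bar>W a \<omega>\<bar> ^ R)) \<in> borel_measurable M"
        by (rule borel_measurable_sum[OF Wm])
      ultimately show ?thesis
        unfolding U0_def by (subst nn_integral_add) (simp_all only:, measurable)
    qed
    also have "\<dots> \<le> (\<Sum>a\<in>N 0. ennreal b) + (\<Sum>m. ennreal (k * b * (1 / 2) ^ m))"
      using N(2) by (intro add_mono sum_mono W suminf_le iS) auto
    also have "(\<Sum>m. ennreal (k * b * (1 / 2) ^ m)) = ennreal (k * b * 2)"
      using sums_mult[OF geometric_sums[of "1 / 2 :: real"], of "k * b"] k b
      by (intro suminf_ennreal_eq) auto
    also have "(\<Sum>a\<in>N 0. ennreal b) \<le> ennreal (c * b)"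
    proof -
      have "real (card (N 0)) * b \<le> c * b" using card[of 0] b by (intro mult_right_mono) auto
      then show ?thesis using b by (simp add: ennreal_of_nat_eq_real_of_nat ennreal_mult[symmetric] ennreal_leI)
    qed
    finally have iU0: "(\<integral>\<^sup>+\<omega>. U0 \<omega> \<partial>M) \<le> ennreal (c * b + k * b * 2)"
      using b c k by (simp add: add_right_mono)
    have bound: "ennreal (\<bar>W a \<omega>\<bar> ^ R) \<le> 3 ^ R * U0 \<omega>" if \<omega>: "\<omega> \<in> space M" and a: "a \<in> A" for \<omega> a
    proof (cases "U0 \<omega> = \<top>")
      case True
      then show ?thesis by (simp add: ennreal_mult_top)
    next
      case False
      \<comment> \<open>the increment of the chain at level \<open>m\<close> is at most \<open>u / 2 ^ m\<close>\<close>
      define u where "u = root R (enn2real (U0 \<omega>))"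
      have R0: "0 < R" using R by simp
      have u: "0 \<le> u" "ennreal (u ^ R) = U0 \<omega>"
        using False R0 by (simp_all add: u_def less_top)
      have le_u: "x \<le> u" if "ennreal (x ^ R) \<le> U0 \<omega>" for x
      proof -
        have "x ^ R \<le> u ^ R" using that u by (metis ennreal_le_iff zero_le_power)
        then show ?thesis using u(1) R0 by (metis power_mono_iff linear order_trans)
      qed
      obtain \<beta> where \<beta>: "\<And>m. \<beta> m \<in> N m" "\<And>m. norm (a - \<beta> m) \<le> D / 4 ^ m"
        using net[OF a] by metis
      have \<beta>A: "\<beta> m \<in> A" for m using \<beta>(1) N(2) by blast
      have start: "\<bar>W (\<beta> 0) \<omega>\<bar> \<le> u"
      proof (rule le_u)
        have "ennreal (\<bar>W (\<beta> 0) \<omega>\<bar> ^ R) \<le> (\<Sum>a\<in>N 0. ennreal (\<bar>W a \<omega>\<bar> ^ R))"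
          by (rule member_le_sum) (use \<beta> N in auto)
        also have "\<dots> \<le> U0 \<omega>" unfolding U0_def by simp
        finally show "ennreal (\<bar>W (\<beta> 0) \<omega>\<bar> ^ R) \<le> U0 \<omega>" .
      qed
      have step: "\<bar>W (\<beta> m) \<omega> - W (\<beta> (Suc m)) \<omega>\<bar> \<le> u / 2 ^ m" for m
      proof -
        have "norm (\<beta> m - \<beta> (Suc m)) \<le> norm (a - \<beta> m) + norm (a - \<beta> (Suc m))"
          by norm
        also have "\<dots> \<le> D / 4 ^ m + D / 4 ^ Suc m" by (intro add_mono \<beta>)
        also have "\<dots> \<le> 2 * D / 4 ^ m" using D by (simp add: field_simps)
        finally have e: "(\<beta> m, \<beta> (Suc m)) \<in> E m" using \<beta>(1) by (simp add: E_def)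
        have "ennreal (\<bar>W (\<beta> m) \<omega> - W (\<beta> (Suc m)) \<omega>\<bar> ^ R) \<le> S m \<omega>"
          unfolding S_def using member_le_sum[OF e, of "\<lambda>(a, a'). ennreal (\<bar>W a \<omega> - W a' \<omega>\<bar> ^ R)"] E by simp
        then have "ennreal ((2 ^ m * \<bar>W (\<beta> m) \<omega> - W (\<beta> (Suc m)) \<omega>\<bar>) ^ R) \<le> 2 ^ (m * R) * S m \<omega>"
          by (simp add: power_mult_distrib power_mult[symmetric] ennreal_mult ennreal_power[symmetric] mult_left_mono)
        also have "\<dots> \<le> (\<Sum>m. 2 ^ (m * R) * S m \<omega>)"
          using sum_le_suminf[of "\<lambda>m. 2 ^ (m * R) * S m \<omega>" "{m}"] by simp
        also have "\<dots> \<le> U0 \<omega>" unfolding U0_def by simp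
        finally have "2 ^ m * \<bar>W (\<beta> m) \<omega> - W (\<beta> (Suc m)) \<omega>\<bar> \<le> u" by (rule le_u)
        then show ?thesis by (simp add: field_simps)
      qed
      have chain: "\<bar>W (\<beta> m) \<omega>\<bar> \<le> u * (3 - 2 / 2 ^ m)" for m
      proof (induction m)
        case (Suc m)
        have "\<bar>W (\<beta> (Suc m)) \<omega>\<bar> \<le> u * (3 - 2 / 2 ^ m) + u / 2 ^ m" using Suc step[of m] by linarith
        also have "\<dots> = u * (3 - 2 / 2 ^ Suc m)" by (simp add: field_simps)
        finally show ?case .
      qed (use start in simp)
      have "\<beta> \<longlonglongrightarrow> a"
      proof (rule LIM_zero_cancel, rule Lim_null_comparison)
        show "\<forall>\<^sub>F m in sequentially. norm (\<beta> m - a) \<le> D / 4 ^ m"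
          using \<beta>(2) by (simp add: norm_minus_commute)
        show "(\<lambda>m. D / 4 ^ m) \<longlonglongrightarrow> 0"
          using tendsto_mult_right_zero[OF LIMSEQ_power_zero[of "1 / 4 :: real"], of D] by (simp add: power_divide)
      qed
      then have "(\<lambda>m. W (\<beta> m) \<omega>) \<longlonglongrightarrow> W a \<omega>"
        by (rule continuous_on_tendsto_compose[OF cont[OF \<omega>] _ a]) (simp add: \<beta>A)
      then have "\<bar>W a \<omega>\<bar> \<le> 3 * u"
      proof (rule tendsto_upperbound[OF tendsto_rabs])
        have "u * (3 - 2 / 2 ^ m) \<le> 3 * u" for m :: nat
          using mult_left_mono[of "3 - 2 / 2 ^ m" 3 u] u(1) by (simp add: mult.commute)
        then show "\<forall>\<^sub>F m in sequentially. \<bar>W (\<beta> m) \<omega>\<bar> \<le> 3 * u"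
          using chain by (meson always_eventually order_trans)
      qed simp
      then have "\<bar>W a \<omega>\<bar> ^ R \<le> (3 * u) ^ R" by (intro power_mono) auto
      then have "ennreal (\<bar>W a \<omega>\<bar> ^ R) \<le> ennreal (3 ^ R * u ^ R)"
        by (intro ennreal_leI) (simp add: power_mult_distrib)
      also have "\<dots> = 3 ^ R * U0 \<omega>" using u by (simp add: ennreal_mult ennreal_power[symmetric])
      finally show ?thesis .
    qed
    show "\<exists>U\<in>borel_measurable M. (\<integral>\<^sup>+\<omega>. U \<omega> \<partial>M) \<le> ennreal (C * b) \<and>
        (\<forall>\<omega>\<in>space M. \<forall>a\<in>A. ennreal (\<bar>W a \<omega>\<bar> ^ R) \<le> U \<omega>)"
    proof (intro bexI conjI ballI)
      show "(\<lambda>\<omega>. 3 ^ R * U0 \<omega>) \<in> borel_measurable M" using U0m by measurable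
      have "(\<integral>\<^sup>+\<omega>. 3 ^ R * U0 \<omega> \<partial>M) = 3 ^ R * (\<integral>\<^sup>+\<omega>. U0 \<omega> \<partial>M)"
        by (rule nn_integral_cmult[OF U0m])
      also have "\<dots> \<le> ennreal (3 ^ R) * ennreal (c * b + k * b * 2)"
        using iU0 by (simp add: ennreal_power[symmetric] mult_left_mono)
      also have "\<dots> = ennreal (C * b)"
        using b c k by (simp add: C_def ennreal_mult[symmetric] algebra_simps)
      finally show "(\<integral>\<^sup>+\<omega>. 3 ^ R * U0 \<omega> \<partial>M) \<le> ennreal (C * b)" .
    qed (rule bound)
  qed
qed

section \<open>Uniform integrability and convergence in $L^q$\<close>

text \<open>
  Pointwise convergence together with a bound on a moment of higher order gives convergence of the
  moment of order \<open>q\<close>: truncate at a level \<open>L\<close>, where the remainder is at most \<open>C / L\<close>.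
\<close>

lemma (in prob_space) tendsto_nn_integral_powr:
  fixes f :: "nat \<Rightarrow> 'a \<Rightarrow> real" and R :: nat
  assumes m[measurable]: "\<And>k. f k \<in> borel_measurable M" and nonneg: "\<And>k \<omega>. \<omega> \<in> space M \<Longrightarrow> 0 \<le> f k \<omega>"
    and lim: "\<And>\<omega>. \<omega> \<in> space M \<Longrightarrow> (\<lambda>k. f k \<omega>) \<longlonglongrightarrow> 0"
    and q: "1 \<le> q" "q + 1 \<le> real R"
    and bound: "\<forall>\<^sub>F k in sequentially. (\<integral>\<^sup>+\<omega>. ennreal (f k \<omega> ^ R) \<partial>M) \<le> ennreal C"
  shows "(\<lambda>k. \<integral>\<^sup>+\<omega>. ennreal (f k \<omega> powr q) \<partial>M) \<longlonglongrightarrow> 0"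
proof (rule order_tendstoI)
  fix e :: ennreal assume "0 < e"
  then obtain e' where "0 < e'" "e' < e" using dense by blast
  then obtain r where r: "0 < r" "ennreal r < e"
    by (cases e') (auto simp: ennreal_less_zero_iff)
  define L where "L = max 1 (2 * max C 0 / r)"
  have L: "1 \<le> L" by (simp add: L_def)
  have CL: "max C 0 / L \<le> r / 2"
  proof -
    have "2 * max C 0 / r \<le> L" by (simp add: L_def)
    then show ?thesis using r(1) L by (simp add: field_simps)
  qed
  have pt: "f k \<omega> powr q \<le> min (f k \<omega>) L powr q + 1 / L * f k \<omega> ^ R" if "\<omega> \<in> space M" for k \<omega>
  proof (cases "f k \<omega> \<le> L")
    case True
    then show ?thesis using L nonneg[OF that] by (simp add: min_absorb1)
  next
    case False
    let ?x = "f k \<omega>"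
    have x: "1 < ?x" "L \<le> ?x" using False L by auto
    have "L * ?x powr q \<le> ?x * ?x powr q" using x by (intro mult_right_mono) auto
    also have "\<dots> = ?x powr (q + 1)" using x by (simp add: powr_add)
    also have "\<dots> \<le> ?x powr real R" using x q by (intro powr_mono) auto
    also have "\<dots> = ?x ^ R" using x by (simp add: powr_realpow)
    finally have "?x powr q \<le> 1 / L * ?x ^ R" using L by (simp add: field_simps)
    moreover have "0 \<le> min ?x L powr q" by simp
    ultimately show ?thesis by linarith
  qed
  have "(\<lambda>k. \<integral>\<^sup>+\<omega>. ennreal (min (f k \<omega>) L powr q) \<partial>M) \<longlonglongrightarrow> (\<integral>\<^sup>+\<omega>. 0 \<partial>M)"
  proof (rule nn_integral_dominated_convergence[where w = "\<lambda>_. ennreal (L powr q)"])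
    show "AE \<omega> in M. (\<lambda>k. ennreal (min (f k \<omega>) L powr q)) \<longlonglongrightarrow> 0"
    proof (rule AE_I2)
      fix \<omega> assume \<omega>: "\<omega> \<in> space M"
      have "(\<lambda>k. min (f k \<omega>) L powr q) \<longlonglongrightarrow> min 0 L powr q"
        using L q nonneg[OF \<omega>] by (intro tendsto_powr' tendsto_min lim[OF \<omega>] tendsto_const) (auto intro!: always_eventually)
      then show "(\<lambda>k. ennreal (min (f k \<omega>) L powr q)) \<longlonglongrightarrow> 0"
        using tendsto_ennrealI[of "\<lambda>k. min (f k \<omega>) L powr q" 0] L q by simp
    qed
    show "AE \<omega> in M. ennreal (min (f k \<omega>) L powr q) \<le> ennreal (L powr q)" for k
      using L q nonneg by (intro AE_I2 ennreal_leI powr_mono2) auto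
  qed (auto simp: less_top[symmetric] ennreal_mult_eq_top_iff emeasure_space_1)
  then have "\<forall>\<^sub>F k in sequentially. (\<integral>\<^sup>+\<omega>. ennreal (min (f k \<omega>) L powr q) \<partial>M) < ennreal (r / 2)"
    using r(1) by (intro order_tendstoD(2)) (auto simp: ennreal_less_zero_iff)
  then show "\<forall>\<^sub>F k in sequentially. (\<integral>\<^sup>+\<omega>. ennreal (f k \<omega> powr q) \<partial>M) < e"
    using bound
  proof eventually_elim
    case (elim k)
    have "(\<integral>\<^sup>+\<omega>. ennreal (f k \<omega> powr q) \<partial>M)
        \<le> (\<integral>\<^sup>+\<omega>. ennreal (min (f k \<omega>) L powr q) + ennreal (1 / L) * ennreal (f k \<omega> ^ R) \<partial>M)"
    proof (rule nn_integral_mono)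
      fix \<omega> assume \<omega>: "\<omega> \<in> space M"
      show "ennreal (f k \<omega> powr q) \<le> ennreal (min (f k \<omega>) L powr q) + ennreal (1 / L) * ennreal (f k \<omega> ^ R)"
        using ennreal_leI[OF pt[OF \<omega>, of k]] L nonneg[OF \<omega>, of k]
        by (simp only: ennreal_plus ennreal_mult powr_ge_zero zero_le_power mult_nonneg_nonneg divide_nonneg_nonneg
            zero_le_one order_trans[OF zero_le_one L])
    qed
    also have "\<dots> = (\<integral>\<^sup>+\<omega>. ennreal (min (f k \<omega>) L powr q) \<partial>M)
        + ennreal (1 / L) * (\<integral>\<^sup>+\<omega>. ennreal (f k \<omega> ^ R) \<partial>M)"
      by (subst nn_integral_add; simp add: nn_integral_cmult)
    also have "\<dots> \<le> ennreal (r / 2) + ennreal (1 / L) * ennreal (max C 0)"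
      using elim by (intro add_mono mult_left_mono) (auto intro: order_trans ennreal_leI)
    also have "\<dots> \<le> ennreal (r / 2) + ennreal (r / 2)"
    proof (intro add_mono order_refl)
      have "ennreal (1 / L) * ennreal (max C 0) = ennreal (max C 0 / L)"
        using L by (subst ennreal_mult[symmetric]) auto
      then show "ennreal (1 / L) * ennreal (max C 0) \<le> ennreal (r / 2)"
        using ennreal_leI[OF CL] by simp
    qed
    also have "\<dots> = ennreal r" using r(1) by (simp flip: ennreal_plus)
    finally show ?case using r(2) by (rule le_less_trans)
  qed
qed auto

text \<open>
  The codomain need not be separable, but continuous images of subsets of a Euclidean space are.
\<close>

lemma measurable_continuous_compose:
  fixes f :: "'a::euclidean_space \<Rightarrow> 'b::real_normed_vector"
  assumes f: "continuous_on S f" and S: "closed S"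
    and Y: "Y \<in> borel_measurable M" "\<And>\<omega>. \<omega> \<in> space M \<Longrightarrow> Y \<omega> \<in> S"
  shows "(\<lambda>\<omega>. f (Y \<omega>)) \<in> borel_measurable M"
    and "\<exists>D. countable D \<and> (\<lambda>\<omega>. f (Y \<omega>)) ` space M \<subseteq> closure D"
proof -
  have "Y \<in> M \<rightarrow>\<^sub>M restrict_space borel S"
    using Y by (intro measurable_restrict_space2) auto
  from measurable_compose[OF this borel_measurable_continuous_on_restrict[OF f]]
  show "(\<lambda>\<omega>. f (Y \<omega>)) \<in> borel_measurable M" .
  obtain D where D: "countable D" "D \<subseteq> S" "S \<subseteq> closure D" by (rule separable[of S])
  have "f y \<in> closure (f ` D)" if "y \<in> S" for y
  proof -
    from that D(3) have "y \<in> closure D" by blast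
    then obtain x where x: "\<And>n. x n \<in> D" "x \<longlonglongrightarrow> y" unfolding closure_sequential by blast
    have "(\<lambda>n. f (x n)) \<longlonglongrightarrow> f y"
      using D(2) by (intro continuous_on_tendsto_compose[OF f x(2) that] always_eventually allI) (use x(1) in blast)
    then show ?thesis unfolding closure_sequential using x(1) by (intro exI[of _ "\<lambda>n. f (x n)"]) auto
  qed
  then show "\<exists>D. countable D \<and> (\<lambda>\<omega>. f (Y \<omega>)) ` space M \<subseteq> closure D"
    using D(1) Y(2) by (intro exI[of _ "f ` D"]) auto
qed

lemma add_power_le:
  fixes a b :: real
  assumes "0 \<le> a" "0 \<le> b"
  shows "(a + b) ^ R \<le> 2 ^ R * (a ^ R + b ^ R)"
proof -
  have "(a + b) ^ R \<le> (2 * max a b) ^ R" using assms by (intro power_mono) auto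
  also have "\<dots> = 2 ^ R * max a b ^ R" by (rule power_mult_distrib)
  also have "max a b ^ R \<le> a ^ R + b ^ R" using assms by (simp add: max_def)
  finally show ?thesis by simp
qed

lemma sum_power_le:
  fixes s :: "'i \<Rightarrow> real"
  assumes I: "finite I" "I \<noteq> {}" and s: "\<And>i. i \<in> I \<Longrightarrow> 0 \<le> s i"
  shows "(\<Sum>i\<in>I. s i) ^ R \<le> real (card I) ^ R * (\<Sum>i\<in>I. s i ^ R)"
proof -
  have "Max (s ` I) \<in> s ` I" using I by simp
  then obtain j where j: "j \<in> I" "s j = Max (s ` I)" by force
  then have "s i \<le> s j" if "i \<in> I" for i using I that by simp
  then have "(\<Sum>i\<in>I. s i) \<le> real (card I) * s j" using sum_bounded_above[of I s "s j"] by simp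
  then have "(\<Sum>i\<in>I. s i) ^ R \<le> (real (card I) * s j) ^ R"
    using s by (intro power_mono) (auto intro: sum_nonneg)
  also have "\<dots> = real (card I) ^ R * s j ^ R" by (rule power_mult_distrib)
  also have "\<dots> \<le> real (card I) ^ R * (\<Sum>i\<in>I. s i ^ R)"
    using I j s by (intro mult_left_mono member_le_sum) auto
  finally show ?thesis .
qed

text \<open>
  Random variables with values in a possibly nonseparable space are given here as continuous functions
  of finite dimensional ones, which makes them and their differences strongly measurable.
\<close>

lemma (in prob_space) tendsto_Lq_compose:
  fixes G :: "nat \<Rightarrow> 'e::euclidean_space \<Rightarrow> 'b::real_normed_vector" and H :: "'e \<Rightarrow> 'b"
  assumes S: "compact S" and Y: "\<And>k. Y k \<in> borel_measurable M" "\<And>k \<omega>. \<omega> \<in> space M \<Longrightarrow> Y k \<omega> \<in> S"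
    and V: "V \<in> borel_measurable M"
    and G: "\<And>k. continuous_on S (G k)" and H: "continuous_on UNIV H"
    and lim: "\<And>\<omega>. \<omega> \<in> space M \<Longrightarrow> (\<lambda>k. G k (Y k \<omega>)) \<longlonglongrightarrow> H (V \<omega>)"
    and q: "1 \<le> q" "q + 1 \<le> real R"
    and bG: "\<forall>\<^sub>F k in sequentially. (\<integral>\<^sup>+\<omega>. ennreal (norm (G k (Y k \<omega>)) ^ R) \<partial>M) \<le> ennreal C"
    and bH: "(\<integral>\<^sup>+\<omega>. ennreal (norm (H (V \<omega>)) ^ R) \<partial>M) \<le> ennreal C"
  shows "tendsto_Lq M q (\<lambda>k \<omega>. G k (Y k \<omega>)) (\<lambda>\<omega>. H (V \<omega>))"
  unfolding tendsto_Lq_def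
proof (intro conjI allI)
  note Gm = measurable_continuous_compose[OF G compact_imp_closed[OF S] Y]
  note Hm = measurable_continuous_compose[OF H closed_UNIV V UNIV_I]
  have [measurable]: "(\<lambda>\<omega>. norm (G k (Y k \<omega>))) \<in> borel_measurable M" for k
    by (rule measurable_compose[OF Gm(1) borel_measurable_norm])
  have [measurable]: "(\<lambda>\<omega>. norm (H (V \<omega>))) \<in> borel_measurable M"
    by (rule measurable_compose[OF Hm(1) borel_measurable_norm])
  show "(\<lambda>\<omega>. G k (Y k \<omega>)) \<in> Lq_space M q" for k
    unfolding Lq_space_def
  proof (intro CollectI conjI Gm)
    obtain b where b: "\<And>y. y \<in> S \<Longrightarrow> norm (G k y) \<le> b"
      using compact_imp_bounded[OF compact_continuous_image[OF G S]] unfolding bounded_iff by blast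
    have "(\<integral>\<^sup>+\<omega>. ennreal (norm (G k (Y k \<omega>)) powr q) \<partial>M) \<le> (\<integral>\<^sup>+\<omega>. ennreal (b powr q) \<partial>M)"
      using b Y(2) q by (intro nn_integral_mono ennreal_leI powr_mono2) auto
    also have "\<dots> < \<infinity>" by (simp add: emeasure_space_1)
    finally show "(\<integral>\<^sup>+\<omega>. ennreal (norm (G k (Y k \<omega>)) powr q) \<partial>M) < \<infinity>" .
  qed
  show "(\<lambda>\<omega>. H (V \<omega>)) \<in> Lq_space M q"
    unfolding Lq_space_def
  proof (intro CollectI conjI Hm)
    have "x powr q \<le> 1 + x ^ R" if "0 \<le> x" for x :: real
    proof (cases "x \<le> 1")
      case True
      then have "x powr q \<le> 1" using that q powr_mono2[of q x 1] by simp
      then show ?thesis using that by (simp add: add_increasing2)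
    next
      case False
      then have "x powr q \<le> x powr real R" using q by (intro powr_mono) auto
      then show ?thesis using False by (simp add: powr_realpow)
    qed
    then have "(\<integral>\<^sup>+\<omega>. ennreal (norm (H (V \<omega>)) powr q) \<partial>M) \<le> (\<integral>\<^sup>+\<omega>. 1 + ennreal (norm (H (V \<omega>)) ^ R) \<partial>M)"
    proof (intro nn_integral_mono)
      fix \<omega>
      have "ennreal (norm (H (V \<omega>)) powr q) \<le> ennreal (1 + norm (H (V \<omega>)) ^ R)"
        using \<open>\<And>x. 0 \<le> x \<Longrightarrow> x powr q \<le> 1 + x ^ R\<close> by (intro ennreal_leI) simp
      then show "ennreal (norm (H (V \<omega>)) powr q) \<le> 1 + ennreal (norm (H (V \<omega>)) ^ R)"
        by (subst (asm) ennreal_plus) auto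
    qed
    also have "\<dots> = 1 + (\<integral>\<^sup>+\<omega>. ennreal (norm (H (V \<omega>)) ^ R) \<partial>M)"
      by (subst nn_integral_add) (auto simp: emeasure_space_1)
    also have "\<dots> \<le> 1 + ennreal C" using bH by (intro add_left_mono)
    also have "\<dots> < \<infinity>" by simp
    finally show "(\<integral>\<^sup>+\<omega>. ennreal (norm (H (V \<omega>)) powr q) \<partial>M) < \<infinity>" .
  qed
  show "(\<lambda>k. \<integral>\<^sup>+\<omega>. ennreal (norm (G k (Y k \<omega>) - H (V \<omega>)) powr q) \<partial>M) \<longlonglongrightarrow> 0"
  proof (rule tendsto_nn_integral_powr[OF _ _ _ q])
    have "continuous_on (S \<times> UNIV) (\<lambda>x. G k (fst x) - H (snd x))" for k
      by (intro continuous_on_diff continuous_on_compose2[OF G] continuous_on_compose2[OF H] continuous_intros) auto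
    then have "(\<lambda>\<omega>. G k (fst (Y k \<omega>, V \<omega>)) - H (snd (Y k \<omega>, V \<omega>))) \<in> borel_measurable M" for k
      by (rule measurable_continuous_compose(1)[OF _ closed_Times[OF compact_imp_closed[OF S] closed_UNIV]
            borel_measurable_Pair[OF Y(1) V]]) (simp add: Y(2))
    then show "(\<lambda>\<omega>. norm (G k (Y k \<omega>) - H (V \<omega>))) \<in> borel_measurable M" for k
      using measurable_compose[OF _ borel_measurable_norm] by simp
    show "(\<lambda>k. norm (G k (Y k \<omega>) - H (V \<omega>))) \<longlonglongrightarrow> 0" if "\<omega> \<in> space M" for \<omega>
      by (intro tendsto_norm_zero LIM_zero lim that)
    show "\<forall>\<^sub>F k in sequentially. (\<integral>\<^sup>+\<omega>. ennreal (norm (G k (Y k \<omega>) - H (V \<omega>)) ^ R) \<partial>M)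
        \<le> ennreal (2 ^ R * (max C 0 + max C 0))"
      using bG
    proof eventually_elim
      case (elim k)
      have "norm (G k (Y k \<omega>) - H (V \<omega>)) ^ R \<le> 2 ^ R * (norm (G k (Y k \<omega>)) ^ R + norm (H (V \<omega>)) ^ R)" for \<omega>
        by (rule order_trans[OF power_mono[OF norm_triangle_ineq4] add_power_le]) auto
      then have "(\<integral>\<^sup>+\<omega>. ennreal (norm (G k (Y k \<omega>) - H (V \<omega>)) ^ R) \<partial>M)
          \<le> (\<integral>\<^sup>+\<omega>. ennreal (2 ^ R) * (ennreal (norm (G k (Y k \<omega>)) ^ R) + ennreal (norm (H (V \<omega>)) ^ R)) \<partial>M)"
        by (intro nn_integral_mono) (simp add: ennreal_leI flip: ennreal_plus ennreal_mult)
      also have "\<dots> = ennreal (2 ^ R) * ((\<integral>\<^sup>+\<omega>. ennreal (norm (G k (Y k \<omega>)) ^ R) \<partial>M)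
          + (\<integral>\<^sup>+\<omega>. ennreal (norm (H (V \<omega>)) ^ R) \<partial>M))"
        by (subst nn_integral_cmult) (auto simp: nn_integral_add)
      also have "\<dots> \<le> ennreal (2 ^ R) * (ennreal (max C 0) + ennreal (max C 0))"
        using elim bH by (intro mult_left_mono add_mono) (auto intro: order_trans ennreal_leI)
      also have "\<dots> = ennreal (2 ^ R * (max C 0 + max C 0))"
        by (simp only: ennreal_mult ennreal_plus add_nonneg_nonneg zero_le_power max.cobounded2 zero_le_numeral)
      finally show ?case .
    qed
  qed auto
qed

section \<open>Smooth families\<close>

lemma partial_has_derivative:
  fixes f :: "real ^ 'p \<Rightarrow> 'b::real_normed_vector"
  assumes "f differentiable (at x)"
  shows "(f has_derivative (\<lambda>h. \<Sum>i\<in>UNIV. h $ i *\<^sub>R partial i f x)) (at x)"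
proof -
  let ?D = "frechet_derivative f (at x)"
  have D: "(f has_derivative ?D) (at x)" using assms by (simp add: frechet_derivative_works)
  then have lin: "linear ?D" by (rule has_derivative_linear)
  have "?D h = (\<Sum>i\<in>UNIV. h $ i *\<^sub>R partial i f x)" for h
  proof -
    have "?D h = ?D (\<Sum>i\<in>UNIV. h $ i *\<^sub>R axis i 1)"
      using basis_expansion[of h] by (simp add: scalar_mult_eq_scaleR)
    also have "\<dots> = (\<Sum>i\<in>UNIV. h $ i *\<^sub>R partial i f x)"
      by (simp add: linear_sum[OF lin] linear_scale[OF lin] partial_def)
    finally show ?thesis .
  qed
  then have "?D = (\<lambda>h. \<Sum>i\<in>UNIV. h $ i *\<^sub>R partial i f x)" by blast
  then show ?thesis using D by simp
qed

lemma norm_sum_scaleR_le: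
  fixes h :: "real ^ 'p" and m :: "'p \<Rightarrow> 'b::real_normed_vector"
  assumes "\<And>i. norm (m i) \<le> B"
  shows "norm (\<Sum>i\<in>UNIV. h $ i *\<^sub>R m i) \<le> real CARD('p) * B * norm h"
proof -
  have "norm (\<Sum>i\<in>UNIV. h $ i *\<^sub>R m i) \<le> (\<Sum>i\<in>(UNIV::'p set). norm h * B)"
    using assms component_le_norm_cart[of h]
    by (intro order_trans[OF norm_sum] sum_mono) (auto intro!: mult_mono)
  then show ?thesis by (simp add: mult_ac)
qed

text \<open>
  The segment from an interior point \<open>y\<close> to \<open>x\<close> stays in the interior, except possibly for its end
  point \<open>x\<close>, where continuity suffices.
\<close>

context
  fixes \<Theta> :: "(real ^ 'p) set" and x y :: "real ^ 'p"
  assumes conv: "convex \<Theta>" and x: "x \<in> \<Theta>" and y: "y \<in> interior \<Theta>"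
begin

lemma segment_interior: "0 \<le> s \<Longrightarrow> s < 1 \<Longrightarrow> y + s *\<^sub>R (x - y) \<in> interior \<Theta>"
  using mem_interior_convex_shrink[OF conv y x, of "1 - s"]
  by (simp add: algebra_simps)

lemma segment_continuous:
  "continuous_on \<Theta> f \<Longrightarrow> continuous_on {0..1} (\<lambda>s. f (y + s *\<^sub>R (x - y)))"
proof (rule continuous_on_compose2[of \<Theta> f])
  show "(\<lambda>s. y + s *\<^sub>R (x - y)) ` {0..1} \<subseteq> \<Theta>"
  proof (intro image_subsetI)
    fix s :: real assume "s \<in> {0..1}"
    then show "y + s *\<^sub>R (x - y) \<in> \<Theta>"
      using segment_interior[of s] interior_subset[of \<Theta>] x by (cases "s = 1") auto
  qed
qed (auto intro!: continuous_intros)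

lemma segment_derivative:
  fixes f :: "real ^ 'p \<Rightarrow> 'b::real_normed_vector"
  assumes f: "\<And>z. z \<in> interior \<Theta> \<Longrightarrow> f differentiable (at z)" and s: "0 \<le> s" "s < 1"
  shows "((\<lambda>s. f (y + s *\<^sub>R (x - y))) has_vector_derivative
    (\<Sum>i\<in>UNIV. (x - y) $ i *\<^sub>R partial i f (y + s *\<^sub>R (x - y)))) (at s)"
proof -
  have "((\<lambda>s. f (y + s *\<^sub>R (x - y))) has_derivative
      (\<lambda>r. \<Sum>i\<in>UNIV. (r *\<^sub>R (x - y)) $ i *\<^sub>R partial i f (y + s *\<^sub>R (x - y)))) (at s)"
  proof (rule has_derivative_compose[of "\<lambda>s. y + s *\<^sub>R (x - y)" "\<lambda>r. r *\<^sub>R (x - y)" s UNIV f])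
    show "((\<lambda>s. y + s *\<^sub>R (x - y)) has_derivative (\<lambda>r. r *\<^sub>R (x - y))) (at s)"
      by (auto intro!: derivative_eq_intros)
    show "(f has_derivative (\<lambda>h. \<Sum>i\<in>UNIV. h $ i *\<^sub>R partial i f (y + s *\<^sub>R (x - y))))
        (at (y + s *\<^sub>R (x - y)))"
      by (rule partial_has_derivative[OF f[OF segment_interior[OF s]]])
  qed
  then show ?thesis
    by (simp add: has_vector_derivative_def scaleR_sum_right)
qed

lemma increment_bound:
  fixes f :: "real ^ 'p \<Rightarrow> 'b::real_normed_vector"
  assumes cont: "continuous_on \<Theta> f" and f: "\<And>z. z \<in> interior \<Theta> \<Longrightarrow> f differentiable (at z)"
    and B: "\<And>i z. z \<in> interior \<Theta> \<Longrightarrow> norm (partial i f z) \<le> B"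
  shows "norm (f x - f y) \<le> real CARD('p) * B * norm (x - y)"
proof -
  let ?g = "\<lambda>s. f (y + s *\<^sub>R (x - y))" and ?c = "real CARD('p) * B * norm (x - y)"
  have "norm (?g 1 - ?g 0) \<le> 1 * ?c - 0 * ?c"
  proof (rule differentiable_bound_general[where \<phi> = "\<lambda>s. s * ?c" and \<phi>' = "\<lambda>_. ?c"
        and f' = "\<lambda>s. \<Sum>i\<in>UNIV. (x - y) $ i *\<^sub>R partial i f (y + s *\<^sub>R (x - y))"])
    show "continuous_on {0..1} ?g" by (rule segment_continuous[OF cont])
    show "(?g has_vector_derivative (\<Sum>i\<in>UNIV. (x - y) $ i *\<^sub>R partial i f (y + s *\<^sub>R (x - y)))) (at s)"
      if "0 < s" "s < 1" for s by (rule segment_derivative[OF f]) (use that in auto)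
    show "norm (\<Sum>i\<in>UNIV. (x - y) $ i *\<^sub>R partial i f (y + s *\<^sub>R (x - y))) \<le> ?c" if "0 < s" "s < 1" for s
      by (rule norm_sum_scaleR_le) (rule B, rule segment_interior, use that in auto)
  qed (auto intro!: continuous_intros derivative_eq_intros simp: has_vector_derivative_def mult.commute)
  then show ?thesis by simp
qed

text \<open>
  For a real linear functional \<open>l\<close> the mean value theorem holds with equality.
\<close>

lemma linear_mean_value:
  fixes f :: "real ^ 'p \<Rightarrow> 'b::real_normed_vector"
  assumes cont: "continuous_on \<Theta> f" and f: "\<And>z. z \<in> interior \<Theta> \<Longrightarrow> f differentiable (at z)"
    and l: "bounded_linear l"
  obtains \<xi> where "\<xi> \<in> interior \<Theta>" "l (f x - f y) = (\<Sum>i\<in>UNIV. (x - y) $ i * l (partial i f \<xi>))"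
proof -
  interpret l: bounded_linear l by (rule l)
  let ?g = "\<lambda>s. l (f (y + s *\<^sub>R (x - y)))"
  let ?d = "\<lambda>s. \<Sum>i\<in>UNIV. (x - y) $ i * l (partial i f (y + s *\<^sub>R (x - y)))"
  obtain s where s: "0 < s" "s < 1" "?g 1 - ?g 0 = (1 - 0) * ?d s"
  proof (rule mvt[of 0 1 ?g "\<lambda>s r. r * ?d s"])
    show "continuous_on {0..1} ?g"
      by (rule l.continuous_on[OF segment_continuous[OF cont]])
    fix s :: real assume "0 < s" "s < 1"
    from l.has_vector_derivative[OF segment_derivative[OF f, of s]] this
    show "(?g has_derivative (\<lambda>r. r * ?d s)) (at s)"
      by (simp add: has_vector_derivative_def l.sum l.scaleR)
  qed auto
  show thesis
    using segment_interior[of s] s by (intro that[of "y + s *\<^sub>R (x - y)"]) (simp_all add: l.diff)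
qed

end

lemma C_class_bounded_partials:
  fixes f :: "real ^ 'p \<Rightarrow> 'b::real_normed_vector"
  assumes f: "C_class k \<Theta> f" and "length is \<le> k" and "compact \<Theta>"
  obtains B where "0 \<le> B" "\<And>x. x \<in> interior \<Theta> \<Longrightarrow> norm (partials is f x) \<le> B"
proof -
  obtain g where g: "continuous_on \<Theta> g" "\<And>x. x \<in> interior \<Theta> \<Longrightarrow> g x = partials is f x"
    using f assms(2) unfolding C_class_def by metis
  have "bounded (g ` \<Theta>)"
    by (intro compact_imp_bounded compact_continuous_image g assms)
  then obtain B where "\<And>x. x \<in> \<Theta> \<Longrightarrow> norm (g x) \<le> B" by (auto simp: bounded_iff)
  then have "norm (partials is f x) \<le> max B 0" if "x \<in> interior \<Theta>" for x
    using that g(2)[OF that] interior_subset[of \<Theta>] by (metis max.coboundedI1 subsetD)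
  then show thesis using that[of "max B 0"] by simp
qed

lemma C_class_differentiable:
  "C_class k \<Theta> f \<Longrightarrow> length is < k \<Longrightarrow> x \<in> interior \<Theta> \<Longrightarrow> partials is f differentiable (at x)"
  by (auto simp: C_class_def)

text \<open>
  A family in a normed space over a compact convex parameter set, twice continuously differentiable up
  to the boundary, with a distinguished interior parameter \<open>\<theta>0\<close>.
\<close>

locale smooth_family =
  fixes \<Theta> :: "(real ^ 'p) set" and \<theta>0 :: "real ^ 'p" and \<mu> :: "real ^ 'p \<Rightarrow> 'b::real_normed_vector"
  assumes compact: "compact \<Theta>" and convex: "convex \<Theta>" and inner: "\<theta>0 \<in> interior \<Theta>"
    and cont: "continuous_on \<Theta> \<mu>" and C2: "C_class 2 \<Theta> \<mu>"
begin

text \<open>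
  The derivative of the family at \<open>\<theta>0\<close>.
\<close>

definition tangent :: "real ^ 'p \<Rightarrow> 'b" where
  "tangent h = (\<Sum>i\<in>UNIV. h $ i *\<^sub>R partial i \<mu> \<theta>0)"

lemma base: "\<theta>0 \<in> \<Theta>"
  using inner interior_subset by blast

lemma differentiable: "x \<in> interior \<Theta> \<Longrightarrow> \<mu> differentiable (at x)"
  using C_class_differentiable[OF C2, of "[]"] by (simp add: partials_def)

lemma partial_differentiable: "x \<in> interior \<Theta> \<Longrightarrow> partial i \<mu> differentiable (at x)"
  using C_class_differentiable[OF C2, of "[i]"] by (simp add: partials_def)

lemma partial_bounded:
  obtains B where "0 \<le> B" "\<And>i x. x \<in> interior \<Theta> \<Longrightarrow> norm (partial i \<mu> x) \<le> B"
proof -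
  have "\<exists>B. 0 \<le> B \<and> (\<forall>x\<in>interior \<Theta>. norm (partial i \<mu> x) \<le> B)" for i
    by (rule C_class_bounded_partials[OF C2 _ compact, of "[i]"]) (auto simp: partials_def)
  then obtain B where B: "\<And>i. 0 \<le> B i" "\<And>i x. x \<in> interior \<Theta> \<Longrightarrow> norm (partial i \<mu> x) \<le> B i"
    by metis
  have "norm (partial i \<mu> x) \<le> (\<Sum>i\<in>UNIV. B i)" if "x \<in> interior \<Theta>" for i x
    using B(2)[OF that, of i] member_le_sum[of i UNIV B] B(1) by force
  then show thesis using that[of "\<Sum>i\<in>UNIV. B i"] B(1) by (simp add: sum_nonneg)
qed

lemma lipschitz:
  obtains L where "0 \<le> L" "\<And>x. x \<in> \<Theta> \<Longrightarrow> norm (\<mu> x - \<mu> \<theta>0) \<le> L * norm (x - \<theta>0)"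
proof -
  obtain B where B: "0 \<le> B" "\<And>i x. x \<in> interior \<Theta> \<Longrightarrow> norm (partial i \<mu> x) \<le> B"
    using partial_bounded by metis
  show thesis
    using increment_bound[OF convex _ inner cont differentiable B(2)] B(1)
    by (intro that[of "real CARD('p) * B"]) auto
qed

lemma partial_lipschitz:
  obtains L where "0 \<le> L" "\<And>i x y. x \<in> interior \<Theta> \<Longrightarrow> y \<in> interior \<Theta> \<Longrightarrow>
    norm (partial i \<mu> x - partial i \<mu> y) \<le> L * norm (x - y)"
proof -
  have "\<exists>B. 0 \<le> B \<and> (\<forall>x\<in>interior \<Theta>. norm (partial j (partial i \<mu>) x) \<le> B)" for i j
    by (rule C_class_bounded_partials[OF C2 _ compact, of "[j, i]"]) (auto simp: partials_def)
  then have "\<forall>i. \<exists>b. \<forall>j. 0 \<le> b j \<and> (\<forall>x\<in>interior \<Theta>. norm (partial j (partial i \<mu>) x) \<le> b j)"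
    by (intro allI choice)
  from choice[OF this]
  obtain B where B: "\<And>i j. 0 \<le> B i j" "\<And>i j x. x \<in> interior \<Theta> \<Longrightarrow> norm (partial j (partial i \<mu>) x) \<le> B i j"
    by blast
  let ?B = "\<Sum>i\<in>UNIV. \<Sum>j\<in>UNIV. B i j"
  have le: "norm (partial j (partial i \<mu>) x) \<le> ?B" if "x \<in> interior \<Theta>" for i j x
  proof -
    have "norm (partial j (partial i \<mu>) x) \<le> B i j" by (rule B(2)[OF that])
    also have "\<dots> \<le> (\<Sum>j\<in>UNIV. B i j)" by (rule member_le_sum) (use B(1) in auto)
    also have "\<dots> \<le> ?B" by (rule member_le_sum) (use B(1) in \<open>auto intro: sum_nonneg\<close>)
    finally show ?thesis .
  qed
  have cont': "continuous_on (interior \<Theta>) (partial i \<mu>)" for i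
    using partial_differentiable
    by (intro continuous_at_imp_continuous_on ballI differentiable_imp_continuous_within) auto
  show thesis
  proof
    show "0 \<le> real CARD('p) * ?B" using B(1) by (simp add: sum_nonneg)
    show "norm (partial i \<mu> x - partial i \<mu> y) \<le> real CARD('p) * ?B * norm (x - y)"
      if "x \<in> interior \<Theta>" "y \<in> interior \<Theta>" for i x y
      by (rule increment_bound[of "interior \<Theta>"])
        (use that convex cont' partial_differentiable le in \<open>auto simp: convex_interior\<close>)
  qed
qed

lemma tangent_derivative: "(\<mu> has_derivative tangent) (at \<theta>0)"
  unfolding tangent_def[abs_def] by (rule partial_has_derivative[OF differentiable[OF inner]])

lemma bounded_linear_tangent: "bounded_linear tangent"
  by (rule has_derivative_bounded_linear[OF tangent_derivative])

lemma partial_tendsto: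
  "(\<lambda>k. x k) \<longlonglongrightarrow> \<theta>0 \<Longrightarrow> (\<lambda>k. partial i \<mu> (x k)) \<longlonglongrightarrow> partial i \<mu> \<theta>0"
  by (rule isCont_tendsto_compose[OF differentiable_imp_continuous_within[OF partial_differentiable[OF inner]]])

text \<open>Difference quotients at a scale \<open>r\<close> that bounds the distance from \<open>\<theta>0\<close> up to a constant.\<close>

lemma quotient_tendsto:
  assumes x: "x \<longlonglongrightarrow> \<theta>0" and r: "\<And>k. 0 < r k" and C: "\<And>k. norm (x k - \<theta>0) \<le> C * r k"
  shows "(\<lambda>k. (1 / r k) *\<^sub>R (\<mu> (x k) - \<mu> \<theta>0) - tangent ((1 / r k) *\<^sub>R (x k - \<theta>0))) \<longlonglongrightarrow> 0"
proof (rule LIMSEQ_I)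
  interpret bounded_linear tangent by (rule bounded_linear_tangent)
  fix e :: real assume e: "0 < e"
  define e' where "e' = e / (max C 0 + 1)"
  have e': "0 < e'" using e by (simp add: e'_def add_nonneg_pos)
  obtain d where d: "0 < d" "\<And>y. norm (y - \<theta>0) < d \<Longrightarrow> norm (\<mu> y - \<mu> \<theta>0 - tangent (y - \<theta>0)) \<le> e' * norm (y - \<theta>0)"
    using tangent_derivative e' unfolding has_derivative_at_alt by metis
  have "\<forall>\<^sub>F k in sequentially. norm ((1 / r k) *\<^sub>R (\<mu> (x k) - \<mu> \<theta>0) - tangent ((1 / r k) *\<^sub>R (x k - \<theta>0)) - 0) < e"
    using tendstoD[OF x d(1)]
  proof eventually_elim
    case (elim k)
    let ?v = "\<mu> (x k) - \<mu> \<theta>0 - tangent (x k - \<theta>0)"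
    have "norm ?v \<le> e' * norm (x k - \<theta>0)" using d(2) elim by (simp add: dist_norm)
    also have "\<dots> \<le> e' * (max C 0 * r k)"
      using C[of k] r[of k] e'
      by (intro mult_left_mono) (auto intro: order_trans[OF _ mult_right_mono[OF max.cobounded1]])
    also have "\<dots> < e' * ((max C 0 + 1) * r k)" using e' r[of k] by simp
    also have "\<dots> = e * r k"
    proof -
      have "max C 0 + 1 \<noteq> 0" by linarith
      then show ?thesis by (simp add: e'_def)
    qed
    finally have "(1 / r k) * norm ?v < e" using r[of k] by (simp add: field_simps)
    moreover have "(1 / r k) *\<^sub>R (\<mu> (x k) - \<mu> \<theta>0) - tangent ((1 / r k) *\<^sub>R (x k - \<theta>0)) = (1 / r k) *\<^sub>R ?v"
      by (simp only: scaleR scaleR_diff_right[of "1 / r k" "\<mu> (x k) - \<mu> \<theta>0"])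
    ultimately show ?case using r[of k] by simp
  qed
  then show "\<exists>no. \<forall>k\<ge>no. norm ((1 / r k) *\<^sub>R (\<mu> (x k) - \<mu> \<theta>0) - tangent ((1 / r k) *\<^sub>R (x k - \<theta>0)) - 0) < e"
    by (simp add: eventually_sequentially)
qed

text \<open>
  A positive semidefinite form that separates \<open>\<mu> \<theta>0\<close> from the other members of the family and
  is definite on the tangent space grows at least quadratically: far from \<open>\<theta>0\<close> by
  compactness, near \<open>\<theta>0\<close> by comparison with the tangent space.
\<close>

lemma quadratic_growth:
  assumes bil: "bounded_bilinear B" and psd: "\<And>m. 0 \<le> (B m m :: real)"
    and sep: "\<And>x. x \<in> \<Theta> \<Longrightarrow> B (\<mu> x - \<mu> \<theta>0) (\<mu> x - \<mu> \<theta>0) = 0 \<Longrightarrow> x = \<theta>0"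
    and nondeg: "\<And>h. B (tangent h) (tangent h) = 0 \<Longrightarrow> h = 0"
  obtains c where "0 < c" "\<And>x. x \<in> \<Theta> \<Longrightarrow> c * (norm (x - \<theta>0))\<^sup>2 \<le> B (\<mu> x - \<mu> \<theta>0) (\<mu> x - \<mu> \<theta>0)"
proof (rule ccontr)
  assume neg: "\<not> thesis"
  interpret B: bounded_bilinear B by (rule bil)
  have "\<exists>x\<in>\<Theta>. B (\<mu> x - \<mu> \<theta>0) (\<mu> x - \<mu> \<theta>0) < 1 / real (Suc k) * (norm (x - \<theta>0))\<^sup>2" for k
  proof (rule ccontr)
    assume "\<not> (\<exists>x\<in>\<Theta>. B (\<mu> x - \<mu> \<theta>0) (\<mu> x - \<mu> \<theta>0) < 1 / real (Suc k) * (norm (x - \<theta>0))\<^sup>2)"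
    then show False using neg that[of "1 / real (Suc k)"] by (simp add: not_less)
  qed
  then obtain x where x: "\<And>k. x k \<in> \<Theta>"
    and small: "\<And>k. B (\<mu> (x k) - \<mu> \<theta>0) (\<mu> (x k) - \<mu> \<theta>0) < 1 / real (Suc k) * (norm (x k - \<theta>0))\<^sup>2"
    by metis
  have ne: "x k \<noteq> \<theta>0" for k using small[of k] by (auto simp: B.zero_left)
  have "compact (\<Theta> \<times> sphere (0 :: real ^ 'p) 1)" by (intro compact_Times compact compact_sphere)
  moreover have "\<forall>k. (x k, (1 / norm (x k - \<theta>0)) *\<^sub>R (x k - \<theta>0)) \<in> \<Theta> \<times> sphere 0 1"
    using x ne by simp
  ultimately obtain l \<sigma> where l: "l \<in> \<Theta> \<times> sphere (0 :: real ^ 'p) 1" and \<sigma>: "strict_mono \<sigma>"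
    and lim: "((\<lambda>k. (x k, (1 / norm (x k - \<theta>0)) *\<^sub>R (x k - \<theta>0))) \<circ> \<sigma>) \<longlonglongrightarrow> l"
    by (rule seq_compactE[OF compact_imp_seq_compact])
  define y where "y k = x (\<sigma> k)" for k
  define r where "r k = norm (y k - \<theta>0)" for k
  have y: "y \<longlonglongrightarrow> fst l" using tendsto_fst[OF lim] by (simp add: comp_def y_def[abs_def])
  have w: "(\<lambda>k. (1 / r k) *\<^sub>R (y k - \<theta>0)) \<longlonglongrightarrow> snd l"
    using tendsto_snd[OF lim] by (simp add: comp_def y_def[abs_def] r_def[abs_def])
  have r: "0 < r k" for k using ne by (simp add: r_def y_def)
  have inv: "(\<lambda>k. 1 / real (Suc (\<sigma> k))) \<longlonglongrightarrow> 0"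
    using LIMSEQ_subseq_LIMSEQ[OF LIMSEQ_Suc[OF lim_inverse_n'] \<sigma>] by (simp add: comp_def)
  have small': "B (\<mu> (y k) - \<mu> \<theta>0) (\<mu> (y k) - \<mu> \<theta>0) \<le> 1 / real (Suc (\<sigma> k)) * (r k)\<^sup>2" for k
    using small[of "\<sigma> k"] by (simp add: y_def r_def)
  have "fst l = \<theta>0"
  proof (rule sep)
    show "fst l \<in> \<Theta>" using l by auto
    have "(\<lambda>k. \<mu> (y k)) \<longlonglongrightarrow> \<mu> (fst l)"
      using l x by (intro continuous_on_tendsto_compose[OF cont y]) (auto simp: y_def)
    then have "(\<lambda>k. B (\<mu> (y k) - \<mu> \<theta>0) (\<mu> (y k) - \<mu> \<theta>0)) \<longlonglongrightarrow> B (\<mu> (fst l) - \<mu> \<theta>0) (\<mu> (fst l) - \<mu> \<theta>0)"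
      by (intro B.tendsto tendsto_intros)
    moreover have "(\<lambda>k. 1 / real (Suc (\<sigma> k)) * (r k)\<^sup>2) \<longlonglongrightarrow> 0 * (norm (fst l - \<theta>0))\<^sup>2"
      unfolding r_def by (intro tendsto_intros inv y)
    ultimately have "B (\<mu> (fst l) - \<mu> \<theta>0) (\<mu> (fst l) - \<mu> \<theta>0) \<le> 0 * (norm (fst l - \<theta>0))\<^sup>2"
      using small' by (intro LIMSEQ_le[rotated, rotated]) auto
    then show "B (\<mu> (fst l) - \<mu> \<theta>0) (\<mu> (fst l) - \<mu> \<theta>0) = 0" using psd[of "\<mu> (fst l) - \<mu> \<theta>0"] by simp
  qed
  then have "(\<lambda>k. (1 / r k) *\<^sub>R (\<mu> (y k) - \<mu> \<theta>0) - tangent ((1 / r k) *\<^sub>R (y k - \<theta>0))) \<longlonglongrightarrow> 0"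
    using y r by (intro quotient_tendsto[where C = 1]) (auto simp: r_def)
  from tendsto_add[OF this bounded_linear.tendsto[OF bounded_linear_tangent w]]
  have q: "(\<lambda>k. (1 / r k) *\<^sub>R (\<mu> (y k) - \<mu> \<theta>0)) \<longlonglongrightarrow> tangent (snd l)" by simp
  have "B ((1 / r k) *\<^sub>R (\<mu> (y k) - \<mu> \<theta>0)) ((1 / r k) *\<^sub>R (\<mu> (y k) - \<mu> \<theta>0)) \<le> 1 / real (Suc (\<sigma> k))" for k
    unfolding B.scaleR_left B.scaleR_right real_scaleR_def
    using small'[of k] r[of k] by (simp add: power2_eq_square field_simps)
  then have "B (tangent (snd l)) (tangent (snd l)) \<le> 0"
    by (intro LIMSEQ_le[OF B.tendsto[OF q q] inv]) auto
  then have "B (tangent (snd l)) (tangent (snd l)) = 0" using psd[of "tangent (snd l)"] by simp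
  then have "snd l = 0" by (rule nondeg)
  then show False using l by auto
qed

end

section \<open>The maximum contrast estimator\<close>

text \<open>
  The statistical model: the family is carried by the interval, the covariance operator
  separates \<open>\<theta>0\<close> from the other parameters, and the Fisher matrix at \<open>\<theta>0\<close> is invertible.
\<close>

locale contrast_estimation = gaussian_vector P \<tau> t Z + smooth_family \<Theta> \<theta>0 \<mu>
  for P :: "'w measure" and \<tau> :: real and t :: "nat \<Rightarrow> nat \<Rightarrow> real" and Z :: "'w \<Rightarrow> real \<Rightarrow> real"
    and \<Theta> :: "(real ^ 'p) set" and \<theta>0 :: "real ^ 'p" and \<mu> :: "real ^ 'p \<Rightarrow> signed_measure" +
  assumes carried: "\<theta> \<in> \<Theta> \<Longrightarrow> \<mu> \<theta> \<in> measures_on {0..\<tau>}"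
    and identifiable: "\<theta> \<in> \<Theta> \<Longrightarrow>
      (\<And>s. s \<in> {0..\<tau>} \<Longrightarrow> cov_operator \<tau> K (\<mu> \<theta>) s = cov_operator \<tau> K (\<mu> \<theta>0) s) \<Longrightarrow> \<theta> = \<theta>0"
    and fisher_regular: "invertible (fisher_matrix \<tau> K \<mu> \<theta>0)"
begin

abbreviation fisher where "fisher \<equiv> fisher_matrix \<tau> K \<mu> \<theta>0"

sublocale form: bounded_bilinear "kernel_form \<tau> K"
  by (rule bounded_bilinear_kernel_form)

lemma bounded_bilinear_discrete_form:
  assumes n: "1 \<le> n"
  shows "bounded_bilinear (discrete_form t n K)"
proof
  obtain \<kappa> where \<kappa>: "0 \<le> \<kappa>" "\<And>r s. r \<in> {0..\<tau>} \<Longrightarrow> s \<in> {0..\<tau>} \<Longrightarrow> \<bar>K r s\<bar> \<le> \<kappa>"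
    using kernel_bounded by metis
  have "norm (discrete_form t n K m m') \<le> norm m * norm m' * \<kappa>" for m m'
    using abs_discrete_form_le[OF \<kappa> n, of m m'] by (simp add: mult_ac)
  then show "\<exists>\<kappa>. \<forall>m m'. norm (discrete_form t n K m m') \<le> norm m * norm m' * \<kappa>" by blast
qed (simp_all add: discrete_form_add_left discrete_form_add_right discrete_form_scale_left discrete_form_scale_right)

lemma fisher_mult: "(fisher *v h) $ j = kernel_form \<tau> K (partial j \<mu> \<theta>0) (tangent h)"
  by (simp add: matrix_vector_mult_def fisher_matrix_def tangent_def form.sum_right form.scaleR_right
      kernel_form_def[symmetric] mult.commute)

lemma fisher_inverse: "matrix_inv fisher *v (fisher *v h) = h"
proof -
  have "matrix_inv fisher ** fisher = mat 1"
    using fisher_regular unfolding invertible_def matrix_inv_def by (rule someI2_ex) simp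
  then show ?thesis by (simp add: matrix_vector_mul_assoc)
qed

lemma kernel_form_growth:
  obtains c where "0 < c"
    "\<And>\<theta>. \<theta> \<in> \<Theta> \<Longrightarrow> c * (norm (\<theta> - \<theta>0))\<^sup>2 \<le> kernel_form \<tau> K (\<mu> \<theta> - \<mu> \<theta>0) (\<mu> \<theta> - \<mu> \<theta>0)"
proof (rule quadratic_growth[OF bounded_bilinear_kernel_form kernel_form_nonneg])
  fix \<theta> assume \<theta>: "\<theta> \<in> \<Theta>" and z: "kernel_form \<tau> K (\<mu> \<theta> - \<mu> \<theta>0) (\<mu> \<theta> - \<mu> \<theta>0) = 0"
  have "cov_operator \<tau> K (\<mu> \<theta>) s = cov_operator \<tau> K (\<mu> \<theta>0) s" if "s \<in> {0..\<tau>}" for s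
    using kernel_form_degenerate[OF kernel_form_nonneg z, of "point_mass s"]
    by (simp add: form.diff_right kernel_form_point_mass[OF that])
  then show "\<theta> = \<theta>0" by (rule identifiable[OF \<theta>])
next
  fix h assume "kernel_form \<tau> K (tangent h) (tangent h) = 0"
  then have "fisher *v h = 0"
    using kernel_form_degenerate[OF kernel_form_nonneg] by (simp add: vec_eq_iff fisher_mult)
  then show "h = 0" using fisher_inverse[of h] by simp
qed (rule that)

text \<open>
  To be carried by the interval is a family of linear equations, which differentiation preserves.
\<close>

lemma partial_carried: "partial i \<mu> \<theta>0 \<in> measures_on {0..\<tau>}"
  unfolding measures_on_def
proof (intro CollectI ballI impI)
  fix A :: "real set" assume A: "A \<in> sets borel" "A \<inter> {0..\<tau>} = {}"
  have "((\<lambda>\<theta>. sm (\<mu> \<theta>) A) has_derivative (\<lambda>h. sm (tangent h) A)) (at \<theta>0)"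
    by (rule bounded_linear.has_derivative[OF bounded_linear_sm tangent_derivative])
  moreover have "((\<lambda>\<theta>. sm (\<mu> \<theta>) A) has_derivative (\<lambda>h. 0)) (at \<theta>0)"
  proof (rule has_derivative_transform_within_open[OF has_derivative_const open_interior inner])
    fix \<theta> assume "\<theta> \<in> interior \<Theta>"
    then show "0 = sm (\<mu> \<theta>) A" using A carried[of \<theta>] interior_subset[of \<Theta>] by (auto simp: measures_on_def)
  qed
  ultimately have "(\<lambda>h. sm (tangent h) A) = (\<lambda>h. 0)" by (rule has_derivative_unique)
  then have "sm (tangent (axis i 1)) A = 0" by metis
  moreover have "tangent (axis i 1) = partial i \<mu> \<theta>0"
    unfolding tangent_def by (subst sum.remove[of _ i]) (auto simp: axis_def)
  ultimately show "sm (partial i \<mu> \<theta>0) A = 0" by simp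
qed

text \<open>
  The parameter \<open>\<theta>\<close> maximizes the contrast built from the observation at noise level \<open>e\<close> and sample
  point \<open>\<omega>\<close>.
\<close>

definition maximizer :: "nat \<Rightarrow> real \<Rightarrow> 'w \<Rightarrow> real ^ 'p \<Rightarrow> bool" where
  "maximizer n e \<omega> \<theta> \<longleftrightarrow> \<theta> \<in> \<Theta> \<and> (\<forall>\<theta>'\<in>\<Theta>.
    contrast t K \<mu> n (observation \<tau> K (\<mu> \<theta>0) Z e \<omega>) \<theta>'
      \<le> contrast t K \<mu> n (observation \<tau> K (\<mu> \<theta>0) Z e \<omega>) \<theta>)"

lemma contrast_eq: "contrast t K \<mu> n x \<theta> = riemann_sum t n (\<mu> \<theta>) x - 1 / 2 * discrete_form t n K (\<mu> \<theta>) (\<mu> \<theta>)"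
  by (simp add: contrast_def riemann_sum_def discrete_form_expand)

lemma riemann_sum_observation:
  "riemann_sum t n m (observation \<tau> K (\<mu> \<theta>0) Z e \<omega>)
    = riemann_sum t n m (cov_operator \<tau> K (\<mu> \<theta>0)) + e * riemann_sum t n m (Z \<omega>)"
  by (simp add: observation_def[abs_def] riemann_sum_add_right riemann_sum_scale_right)

text \<open>
  Comparing the contrast at its maximizer with the contrast at \<open>\<theta>0\<close>: up to discretisation errors
  the contrast is \<open>- 1 / 2\<close> times the form at \<open>\<nu>\<close>, plus a noise term that is linear in \<open>\<nu>\<close>.
\<close>

lemma maximizer_inequality:
  assumes n: "1 \<le> n" and close: "kernel_close t K n \<delta>" and max: "maximizer n e \<omega> \<theta>" and e: "0 \<le> e"
  defines "\<nu> \<equiv> \<mu> \<theta> - \<mu> \<theta>0"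
  shows "kernel_form \<tau> K \<nu> \<nu> \<le> 6 * \<delta> * (norm \<nu>)\<^sup>2 + 4 * \<delta> * norm \<nu> * norm (\<mu> \<theta>0) + 2 * e * \<bar>riemann_sum t n \<nu> (Z \<omega>)\<bar>"
proof -
  interpret D: bounded_bilinear "discrete_form t n K" by (rule bounded_bilinear_discrete_form[OF n])
  have eq: "\<mu> \<theta> = \<mu> \<theta>0 + \<nu>" by (simp add: \<nu>_def)
  have "contrast t K \<mu> n (observation \<tau> K (\<mu> \<theta>0) Z e \<omega>) \<theta>0
      \<le> contrast t K \<mu> n (observation \<tau> K (\<mu> \<theta>0) Z e \<omega>) \<theta>"
    using max base by (simp add: maximizer_def)
  then have "discrete_form t n K \<nu> \<nu> \<le> 2 * (riemann_sum t n \<nu> (cov_operator \<tau> K (\<mu> \<theta>0)) - discrete_form t n K \<nu> (\<mu> \<theta>0))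
      + 2 * (e * riemann_sum t n \<nu> (Z \<omega>))"
    unfolding contrast_eq riemann_sum_observation eq riemann_sum_add D.add_left D.add_right
      discrete_form_commute[OF kernel_commute, where m = "\<mu> \<theta>0" and m' = \<nu>]
    by (simp add: algebra_simps)
  moreover have "e * riemann_sum t n \<nu> (Z \<omega>) \<le> e * \<bar>riemann_sum t n \<nu> (Z \<omega>)\<bar>"
    using e by (intro mult_left_mono) auto
  ultimately show ?thesis
    using kernel_form_discrete[OF n close, of \<nu> \<nu>] riemann_discrete_form[OF n close, of \<nu> "\<mu> \<theta>0"]
    unfolding power2_eq_square by (simp add: mult.assoc)
qed

text \<open>The first-order condition at an interior maximizer.\<close>

lemma maximizer_critical:
  assumes n: "1 \<le> n" and max: "maximizer n e \<omega> \<theta>" and \<theta>: "\<theta> \<in> interior \<Theta>"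
  shows "riemann_sum t n (partial j \<mu> \<theta>) (cov_operator \<tau> K (\<mu> \<theta>0)) + e * riemann_sum t n (partial j \<mu> \<theta>) (Z \<omega>)
    = discrete_form t n K (partial j \<mu> \<theta>) (\<mu> \<theta>)"
proof -
  interpret D: bounded_bilinear "discrete_form t n K" by (rule bounded_bilinear_discrete_form[OF n])
  let ?x = "observation \<tau> K (\<mu> \<theta>0) Z e \<omega>"
  let ?d = "\<lambda>h. \<Sum>i\<in>UNIV. h $ i *\<^sub>R partial i \<mu> \<theta>"
  let ?d' = "\<lambda>h. riemann_sum t n (?d h) ?x
      - 1 / 2 * (discrete_form t n K (\<mu> \<theta>) (?d h) + discrete_form t n K (?d h) (\<mu> \<theta>))"
  have d: "(\<mu> has_derivative ?d) (at \<theta>)"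
    by (rule partial_has_derivative[OF differentiable[OF \<theta>]])
  have der: "(contrast t K \<mu> n ?x has_derivative ?d') (at \<theta>)"
    unfolding contrast_eq[abs_def]
    by (intro has_derivative_diff has_derivative_mult_right D.FDERIV d
        bounded_linear.has_derivative[OF bounded_linear_riemann_sum d])
  have "?d' = (\<lambda>h. 0)"
    by (rule differential_zero_maxmin[OF \<theta> open_interior der])
      (use max interior_subset[of \<Theta>] in \<open>auto simp: maximizer_def\<close>)
  then have "?d' (axis j 1) = 0" by metis
  moreover have "?d (axis j 1) = partial j \<mu> \<theta>"
    by (subst sum.remove[of _ j]) (auto simp: axis_def)
  ultimately show ?thesis
    unfolding riemann_sum_observation discrete_form_commute[OF kernel_commute, where m = "\<mu> \<theta>" and m' = "?d (axis j 1)"]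
    by simp
qed

end

section \<open>Asymptotics of the estimator\<close>

text \<open>
  A sequence of noise levels, mesh parameters and maximizers, where the distance \<open>\<delta>\<close> of the step
  kernel from the kernel is small compared with the noise level.
\<close>

locale contrast_asymptotics = contrast_estimation P \<tau> t Z \<Theta> \<theta>0 \<mu>
  for P :: "'w measure" and \<tau> :: real and t :: "nat \<Rightarrow> nat \<Rightarrow> real" and Z :: "'w \<Rightarrow> real \<Rightarrow> real"
    and \<Theta> :: "(real ^ 'p) set" and \<theta>0 :: "real ^ 'p" and \<mu> :: "real ^ 'p \<Rightarrow> signed_measure" +
  fixes \<epsilon> \<delta> :: "nat \<Rightarrow> real" and N :: "nat \<Rightarrow> nat" and est :: "nat \<Rightarrow> 'w \<Rightarrow> real ^ 'p"
  assumes noise_pos: "0 < \<epsilon> k" and noise: "\<epsilon> \<longlonglongrightarrow> 0"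
    and N1: "1 \<le> N k" and N: "filterlim N at_top sequentially"
    and ratio: "(\<lambda>k. \<delta> k / \<epsilon> k) \<longlonglongrightarrow> 0"
    and close: "\<forall>\<^sub>F k in sequentially. kernel_close t K (N k) (\<delta> k)"
    and est_measurable: "est k \<in> borel_measurable P"
    and est_max: "\<omega> \<in> space P \<Longrightarrow> maximizer (N k) (\<epsilon> k) \<omega> (est k \<omega>)"
begin

text \<open>
  The estimation error in units of the noise level.
\<close>

definition scaled_error :: "nat \<Rightarrow> 'w \<Rightarrow> real ^ 'p" where
  "scaled_error k \<omega> = (1 / \<epsilon> k) *\<^sub>R (est k \<omega> - \<theta>0)"

text \<open>
  The vector $\langle\nabla_\theta\mu_{\theta_0}, Z\rangle$.
\<close>

definition score :: "'w \<Rightarrow> real ^ 'p" where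
  "score \<omega> = (\<chi> i. pairing {0..\<tau>} (partial i \<mu> \<theta>0) (Z \<omega>))"

lemma est_mem: "\<omega> \<in> space P \<Longrightarrow> est k \<omega> \<in> \<Theta>"
  using est_max by (simp add: maximizer_def)

text \<open>
  The rate of convergence, with any bound \<open>s\<close> for the noise term relative to the distance.
\<close>

lemma scaled_error_rate:
  obtains C where "0 \<le> C" "\<forall>\<^sub>F k in sequentially. \<forall>\<omega>\<in>space P. \<forall>s\<ge>0.
    \<bar>riemann_sum t (N k) (\<mu> (est k \<omega>) - \<mu> \<theta>0) (Z \<omega>)\<bar> \<le> norm (est k \<omega> - \<theta>0) * s \<longrightarrow>
    norm (scaled_error k \<omega>) \<le> C * (1 + s)"
proof -
  obtain c where c: "0 < c"
    "\<And>\<theta>. \<theta> \<in> \<Theta> \<Longrightarrow> c * (norm (\<theta> - \<theta>0))\<^sup>2 \<le> kernel_form \<tau> K (\<mu> \<theta> - \<mu> \<theta>0) (\<mu> \<theta> - \<mu> \<theta>0)"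
    using kernel_form_growth by metis
  obtain L where L: "0 \<le> L" "\<And>\<theta>. \<theta> \<in> \<Theta> \<Longrightarrow> norm (\<mu> \<theta> - \<mu> \<theta>0) \<le> L * norm (\<theta> - \<theta>0)"
    using lipschitz by metis
  let ?m = "norm (\<mu> \<theta>0)"
  have "(\<lambda>k. \<delta> k / \<epsilon> k * \<epsilon> k) \<longlonglongrightarrow> 0 * 0" by (intro tendsto_mult ratio noise)
  then have \<delta>0: "\<delta> \<longlonglongrightarrow> 0" using noise_pos by (simp add: less_imp_neq[THEN not_sym])
  have "\<forall>\<^sub>F k in sequentially. 12 * \<delta> k * L\<^sup>2 < c"
  proof (rule order_tendstoD(2))
    show "(\<lambda>k. 12 * \<delta> k * L\<^sup>2) \<longlonglongrightarrow> 12 * 0 * L\<^sup>2" by (intro tendsto_intros \<delta>0)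
  qed (use c in simp)
  moreover have "\<forall>\<^sub>F k in sequentially. \<delta> k / \<epsilon> k < 1" by (rule order_tendstoD(2)[OF ratio]) simp
  ultimately have "\<forall>\<^sub>F k in sequentially. \<forall>\<omega>\<in>space P. \<forall>s\<ge>0.
    \<bar>riemann_sum t (N k) (\<mu> (est k \<omega>) - \<mu> \<theta>0) (Z \<omega>)\<bar> \<le> norm (est k \<omega> - \<theta>0) * s \<longrightarrow>
    norm (scaled_error k \<omega>) \<le> (8 * L * ?m / c + 4 / c) * (1 + s)"
    using close
  proof eventually_elim
    case (elim k)
    show ?case
    proof (intro ballI allI impI)
      fix \<omega> s assume \<omega>: "\<omega> \<in> space P" and s: "0 \<le> s"
        and noise_le: "\<bar>riemann_sum t (N k) (\<mu> (est k \<omega>) - \<mu> \<theta>0) (Z \<omega>)\<bar> \<le> norm (est k \<omega> - \<theta>0) * s"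
      let ?d = "norm (est k \<omega> - \<theta>0)" and ?\<nu> = "\<mu> (est k \<omega>) - \<mu> \<theta>0"
      have \<delta>: "0 \<le> \<delta> k"
        using kernel_closeD[OF elim(3), of 1 1 "t (N k) 1" "t (N k) 1"] partition_in_cell[OF pp N1, of 1 k] N1[of k]
        by simp
      have \<nu>: "norm ?\<nu> \<le> L * ?d" by (rule L(2)[OF est_mem[OF \<omega>]])
      have "c * ?d\<^sup>2 \<le> kernel_form \<tau> K ?\<nu> ?\<nu>" by (rule c(2)[OF est_mem[OF \<omega>]])
      also have "\<dots> \<le> 6 * \<delta> k * (norm ?\<nu>)\<^sup>2 + 4 * \<delta> k * norm ?\<nu> * ?m
          + 2 * \<epsilon> k * \<bar>riemann_sum t (N k) ?\<nu> (Z \<omega>)\<bar>"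
        by (rule maximizer_inequality[OF N1 elim(3) est_max[OF \<omega>]]) (simp add: less_imp_le[OF noise_pos])
      also have "\<dots> \<le> 6 * \<delta> k * (L * ?d)\<^sup>2 + 4 * \<delta> k * (L * ?d) * ?m + 2 * \<epsilon> k * (?d * s)"
        using \<delta> \<nu> noise_le less_imp_le[OF noise_pos[of k]]
        by (intro add_mono mult_left_mono mult_right_mono power_mono) auto
      also have "6 * \<delta> k * (L * ?d)\<^sup>2 = (12 * \<delta> k * L\<^sup>2) * (?d\<^sup>2 / 2)" by (simp add: power_mult_distrib)
      also have "(12 * \<delta> k * L\<^sup>2) * (?d\<^sup>2 / 2) \<le> c * (?d\<^sup>2 / 2)"
        using elim(1) by (intro mult_right_mono) auto
      finally have "?d * (c * ?d) \<le> ?d * (8 * \<delta> k * L * ?m + 4 * \<epsilon> k * s)"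
        by (simp add: algebra_simps power2_eq_square)
      then have "c * ?d \<le> 8 * \<delta> k * L * ?m + 4 * \<epsilon> k * s"
        using L(1) \<delta> s less_imp_le[OF noise_pos[of k]]
        by (cases "?d = 0") (auto simp: mult_le_cancel_left)
      also have "\<dots> \<le> \<epsilon> k * (8 * L * ?m + 4 * s)"
      proof -
        have "\<delta> k \<le> \<epsilon> k" using elim(2) noise_pos[of k] by (simp add: divide_less_eq)
        then have "\<delta> k * (8 * L * ?m) \<le> \<epsilon> k * (8 * L * ?m)" using L(1) by (intro mult_right_mono) auto
        then show ?thesis by (simp add: algebra_simps)
      qed
      finally have "?d / \<epsilon> k \<le> (8 * L * ?m + 4 * s) / c"
        using c(1) noise_pos[of k] by (simp add: field_simps)
      also have "\<dots> \<le> (8 * L * ?m / c + 4 / c) * (1 + s)"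
      proof -
        have "0 \<le> 8 * L * ?m * s + 4" using L(1) s by simp
        then have "8 * L * ?m + 4 * s \<le> (8 * L * ?m + 4) * (1 + s)" by (simp add: algebra_simps)
        from divide_right_mono[OF this, of c] c(1) show ?thesis
          by (simp add: add_divide_distrib[symmetric])
      qed
      finally show "norm (scaled_error k \<omega>) \<le> (8 * L * ?m / c + 4 / c) * (1 + s)"
        using noise_pos[of k] by (simp add: scaled_error_def)
    qed
  qed
  then show thesis using that[of "8 * L * ?m / c + 4 / c"] L(1) c(1) by simp
qed

lemma path_bounded:
  assumes "\<omega> \<in> space P"
  obtains b where "0 \<le> b" "\<And>s. s \<in> {0..\<tau>} \<Longrightarrow> \<bar>Z \<omega> s\<bar> \<le> b"
proof -
  have "bounded (Z \<omega> ` {0..\<tau>})"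
    by (intro compact_imp_bounded compact_continuous_image path_continuous assms compact_Icc)
  then obtain b where "\<And>s. s \<in> {0..\<tau>} \<Longrightarrow> \<bar>Z \<omega> s\<bar> \<le> b" unfolding bounded_iff by (metis image_eqI real_norm_def)
  then show thesis using that[of "max b 0"] by (simp add: max.coboundedI1)
qed

lemma scaled_error_bounded:
  assumes \<omega>: "\<omega> \<in> space P"
  obtains C where "\<forall>\<^sub>F k in sequentially. norm (scaled_error k \<omega>) \<le> C"
proof -
  obtain C where C: "0 \<le> C" "\<forall>\<^sub>F k in sequentially. \<forall>\<omega>\<in>space P. \<forall>s\<ge>0.
    \<bar>riemann_sum t (N k) (\<mu> (est k \<omega>) - \<mu> \<theta>0) (Z \<omega>)\<bar> \<le> norm (est k \<omega> - \<theta>0) * s \<longrightarrow>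
    norm (scaled_error k \<omega>) \<le> C * (1 + s)"
    by (rule scaled_error_rate)
  obtain b where b: "0 \<le> b" "\<And>s. s \<in> {0..\<tau>} \<Longrightarrow> \<bar>Z \<omega> s\<bar> \<le> b" using path_bounded[OF \<omega>] by metis
  obtain L where L: "0 \<le> L" "\<And>\<theta>. \<theta> \<in> \<Theta> \<Longrightarrow> norm (\<mu> \<theta> - \<mu> \<theta>0) \<le> L * norm (\<theta> - \<theta>0)"
    using lipschitz by metis
  have "\<bar>riemann_sum t (N k) (\<mu> (est k \<omega>) - \<mu> \<theta>0) (Z \<omega>)\<bar> \<le> norm (est k \<omega> - \<theta>0) * (b * L)" for k
  proof -
    have "\<bar>riemann_sum t (N k) (\<mu> (est k \<omega>) - \<mu> \<theta>0) (Z \<omega>)\<bar> \<le> b * norm (\<mu> (est k \<omega>) - \<mu> \<theta>0)"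
      by (rule abs_riemann_sum_le[OF pp N1 b(2) b(1)])
    also have "\<dots> \<le> b * (L * norm (est k \<omega> - \<theta>0))"
      by (intro mult_left_mono L(2) est_mem \<omega> b(1))
    finally show ?thesis by (simp add: mult_ac)
  qed
  then have "\<forall>\<^sub>F k in sequentially. norm (scaled_error k \<omega>) \<le> C * (1 + b * L)"
    using C(2) \<omega> b(1) L(1) by (elim eventually_mono) simp
  then show thesis by (rule that)
qed

text \<open>
  Convergence holds for every path: by the first-order condition, the scaled error is an approximate
  solution of the normal equations with the Fisher matrix.
\<close>

lemma pathwise_limits:
  assumes \<omega>: "\<omega> \<in> space P"
  shows "(\<lambda>k. scaled_error k \<omega>) \<longlonglongrightarrow> matrix_inv fisher *v score \<omega>"
    and "(\<lambda>k. (1 / \<epsilon> k) *\<^sub>R (\<mu> (est k \<omega>) - \<mu> \<theta>0)) \<longlonglongrightarrow> tangent (matrix_inv fisher *v score \<omega>)"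
proof -
  obtain C where C: "\<forall>\<^sub>F k in sequentially. norm (scaled_error k \<omega>) \<le> C"
    using scaled_error_bounded[OF \<omega>] by metis
  then obtain k0 where k0: "\<And>k. k0 \<le> k \<Longrightarrow> norm (scaled_error k \<omega>) \<le> C"
    by (auto simp: eventually_sequentially)
  have err: "norm (est k \<omega> - \<theta>0) = norm (scaled_error k \<omega>) * \<epsilon> k" for k
    using noise_pos[of k] by (simp add: scaled_error_def)
  have C': "\<forall>\<^sub>F k in sequentially. norm (est k \<omega> - \<theta>0) \<le> C * \<epsilon> k"
    using C by eventually_elim (simp add: err less_imp_le[OF noise_pos] mult_right_mono)
  have to: "(\<lambda>k. est k \<omega>) \<longlonglongrightarrow> \<theta>0"
  proof (rule LIM_zero_cancel, rule Lim_null_comparison[OF C'])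
    show "(\<lambda>k. C * \<epsilon> k) \<longlonglongrightarrow> 0" using tendsto_mult_right_zero[OF noise] by simp
  qed
  define g where "g k = (1 / \<epsilon> k) *\<^sub>R (\<mu> (est k \<omega>) - \<mu> \<theta>0)" for k
  have diff: "(\<lambda>k. g k - tangent (scaled_error k \<omega>)) \<longlonglongrightarrow> 0"
  proof (rule LIMSEQ_offset[where k = k0])
    show "(\<lambda>k. g (k + k0) - tangent (scaled_error (k + k0) \<omega>)) \<longlonglongrightarrow> 0"
      unfolding g_def scaled_error_def
    proof (rule quotient_tendsto)
      show "(\<lambda>k. est (k + k0) \<omega>) \<longlonglongrightarrow> \<theta>0" by (rule LIMSEQ_ignore_initial_segment[OF to])
      show "norm (est (k + k0) \<omega> - \<theta>0) \<le> C * \<epsilon> (k + k0)" for k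
        unfolding err by (intro mult_right_mono k0) (auto simp: less_imp_le[OF noise_pos])
    qed (rule noise_pos)
  qed
  obtain L where L: "0 \<le> L" "\<And>\<theta>. \<theta> \<in> \<Theta> \<Longrightarrow> norm (\<mu> \<theta> - \<mu> \<theta>0) \<le> L * norm (\<theta> - \<theta>0)"
    using lipschitz by metis
  have g_bounded: "\<forall>\<^sub>F k in sequentially. norm (g k) \<le> L * C"
    using C
  proof eventually_elim
    case (elim k)
    have "norm (g k) \<le> (1 / \<epsilon> k) * (L * norm (est k \<omega> - \<theta>0))"
      using L(2)[OF est_mem[OF \<omega>]] noise_pos[of k] by (simp add: g_def divide_right_mono)
    also have "\<dots> = L * norm (scaled_error k \<omega>)" using noise_pos[of k] by (simp add: err)
    also have "\<dots> \<le> L * C" by (intro mult_left_mono elim L(1))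
    finally show ?case .
  qed
  have \<mu>to: "(\<lambda>k. \<mu> (est k \<omega>)) \<longlonglongrightarrow> \<mu> \<theta>0"
    by (rule continuous_on_tendsto_compose[OF cont to base]) (simp add: est_mem[OF \<omega>])
  have inner_ev: "\<forall>\<^sub>F k in sequentially. est k \<omega> \<in> interior \<Theta>"
    by (rule topological_tendstoD[OF to open_interior inner])
  obtain b where b: "0 \<le> b" "\<And>s. s \<in> {0..\<tau>} \<Longrightarrow> \<bar>Z \<omega> s\<bar> \<le> b" using path_bounded[OF \<omega>] by metis
  have normal_eq: "(\<lambda>k. (fisher *v scaled_error k \<omega>) $ j) \<longlonglongrightarrow> score \<omega> $ j" for j
  proof -
    define m where "m k = partial j \<mu> (est k \<omega>)" for k
    let ?m = "partial j \<mu> \<theta>0"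
    have mto: "m \<longlonglongrightarrow> ?m" unfolding m_def by (rule partial_tendsto[OF to])
    \<comment> \<open>the discretisation errors of the first-order condition, in units of the noise level\<close>
    define e where "e k = \<delta> k / \<epsilon> k * (6 * norm (m k) * norm (\<mu> (est k \<omega>)) + 4 * norm (m k) * norm (\<mu> \<theta>0))" for k
    have "e \<longlonglongrightarrow> 0 * (6 * norm ?m * norm (\<mu> \<theta>0) + 4 * norm ?m * norm (\<mu> \<theta>0))"
      unfolding e_def by (intro tendsto_intros ratio mto \<mu>to)
    then have e0: "e \<longlonglongrightarrow> 0" by simp
    have "(\<lambda>k. riemann_sum t (N k) (m k) (Z \<omega>) - kernel_form \<tau> K (m k) (g k)) \<longlonglongrightarrow> 0"
    proof (rule Lim_null_comparison[OF _ e0])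
      show "\<forall>\<^sub>F k in sequentially. norm (riemann_sum t (N k) (m k) (Z \<omega>) - kernel_form \<tau> K (m k) (g k)) \<le> e k"
        using close inner_ev
      proof eventually_elim
        case (elim k)
        let ?h = "riemann_sum t (N k) (m k) (cov_operator \<tau> K (\<mu> \<theta>0))"
          and ?D = "discrete_form t (N k) K (m k) (\<mu> (est k \<omega>))"
        have "?h + \<epsilon> k * riemann_sum t (N k) (m k) (Z \<omega>) = ?D"
          unfolding m_def by (rule maximizer_critical[OF N1 est_max[OF \<omega>] elim(2)])
        moreover have "\<epsilon> k * kernel_form \<tau> K (m k) (g k) = kernel_form \<tau> K (m k) (\<mu> (est k \<omega>)) - kernel_form \<tau> K (m k) (\<mu> \<theta>0)"
          using noise_pos[of k] by (simp add: g_def form.scaleR_right form.diff_right)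
        ultimately have "\<epsilon> k * (riemann_sum t (N k) (m k) (Z \<omega>) - kernel_form \<tau> K (m k) (g k))
            = (?D - kernel_form \<tau> K (m k) (\<mu> (est k \<omega>))) + (kernel_form \<tau> K (m k) (\<mu> \<theta>0) - ?h)"
          by (simp add: right_diff_distrib)
        then have "\<bar>\<epsilon> k * (riemann_sum t (N k) (m k) (Z \<omega>) - kernel_form \<tau> K (m k) (g k))\<bar>
            \<le> 6 * \<delta> k * norm (m k) * norm (\<mu> (est k \<omega>)) + 4 * \<delta> k * norm (m k) * norm (\<mu> \<theta>0)"
          using kernel_form_discrete[OF N1 elim(1), of "m k" "\<mu> (est k \<omega>)"] kernel_form_riemann[OF N1 elim(1), of "m k" "\<mu> \<theta>0"]
          by linarith
        also have "\<dots> = \<epsilon> k * e k" using noise_pos[of k] by (simp add: e_def field_simps)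
        finally show ?case using noise_pos[of k] by (simp add: abs_mult)
      qed
    qed
    moreover have "(\<lambda>k. riemann_sum t (N k) (m k) (Z \<omega>)) \<longlonglongrightarrow> score \<omega> $ j"
    proof -
      have "(\<lambda>k. riemann_sum t (N k) ?m (Z \<omega>)) \<longlonglongrightarrow> pairing {0..\<tau>} ?m (Z \<omega>)"
        by (rule filterlim_compose[OF riemann_sum_tendsto[OF pp path_continuous[OF \<omega>]] N])
      moreover have "(\<lambda>k. riemann_sum t (N k) (m k - ?m) (Z \<omega>)) \<longlonglongrightarrow> 0"
      proof (rule Lim_null_comparison)
        show "\<forall>\<^sub>F k in sequentially. norm (riemann_sum t (N k) (m k - ?m) (Z \<omega>)) \<le> b * norm (m k - ?m)"
          using abs_riemann_sum_le[OF pp N1 b(2) b(1)] by simp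
        show "(\<lambda>k. b * norm (m k - ?m)) \<longlonglongrightarrow> 0"
          using LIM_zero[OF mto] by (intro tendsto_mult_right_zero tendsto_norm_zero)
      qed
      ultimately have "(\<lambda>k. riemann_sum t (N k) ?m (Z \<omega>) + riemann_sum t (N k) (m k - ?m) (Z \<omega>))
          \<longlonglongrightarrow> pairing {0..\<tau>} ?m (Z \<omega>) + 0"
        by (rule tendsto_add)
      then show ?thesis by (simp add: riemann_sum_diff score_def)
    qed
    moreover have "(\<lambda>k. kernel_form \<tau> K (m k) (g k) - kernel_form \<tau> K ?m (tangent (scaled_error k \<omega>))) \<longlonglongrightarrow> 0"
    proof -
      have "Bfun g sequentially"
        using g_bounded by (rule BfunI)
      then have "(\<lambda>k. kernel_form \<tau> K (m k - ?m) (g k)) \<longlonglongrightarrow> 0"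
        using form.Zfun_prod_Bfun[of "\<lambda>k. m k - ?m" sequentially g] mto by (simp add: tendsto_Zfun_iff)
      moreover have "(\<lambda>k. kernel_form \<tau> K ?m (g k - tangent (scaled_error k \<omega>))) \<longlonglongrightarrow> 0"
        by (rule form.tendsto_right_zero[OF diff])
      ultimately have "(\<lambda>k. kernel_form \<tau> K (m k - ?m) (g k) + kernel_form \<tau> K ?m (g k - tangent (scaled_error k \<omega>))) \<longlonglongrightarrow> 0 + 0"
        by (rule tendsto_add)
      then show ?thesis by (simp add: form.diff_left form.diff_right)
    qed
    ultimately have "(\<lambda>k. riemann_sum t (N k) (m k) (Z \<omega>)
        - (riemann_sum t (N k) (m k) (Z \<omega>) - kernel_form \<tau> K (m k) (g k))
        - (kernel_form \<tau> K (m k) (g k) - kernel_form \<tau> K ?m (tangent (scaled_error k \<omega>)))) \<longlonglongrightarrow> score \<omega> $ j - 0 - 0"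
      by (intro tendsto_diff)
    then show ?thesis by (simp add: fisher_mult)
  qed
  then have "(\<lambda>k. fisher *v scaled_error k \<omega>) \<longlonglongrightarrow> score \<omega>"
    by (rule vec_tendstoI)
  from bounded_linear.tendsto[OF matrix_vector_mul_bounded_linear[of "matrix_inv fisher"] this]
  show lim: "(\<lambda>k. scaled_error k \<omega>) \<longlonglongrightarrow> matrix_inv fisher *v score \<omega>"
    by (simp add: fisher_inverse)
  from tendsto_add[OF diff bounded_linear.tendsto[OF bounded_linear_tangent lim]]
  show "(\<lambda>k. (1 / \<epsilon> k) *\<^sub>R (\<mu> (est k \<omega>) - \<mu> \<theta>0)) \<longlonglongrightarrow> tangent (matrix_inv fisher *v score \<omega>)"
    by (simp add: g_def)
qed

text \<open>
  Moments of the scaled error are bounded: the mean value theorem reduces the noise term to the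
  processes $\theta \mapsto \langle\partial_i\mu_\theta, Z\rangle$ in their discretised form, whose
  suprema are controlled by chaining.
\<close>

lemma scaled_error_moments:
  assumes R: "4 * CARD('p) < R"
  obtains C where "\<forall>\<^sub>F k in sequentially. (\<integral>\<^sup>+\<omega>. ennreal (norm (scaled_error k \<omega>) ^ R) \<partial>P) \<le> ennreal C"
proof -
  obtain C where C: "0 \<le> C" "\<forall>\<^sub>F k in sequentially. \<forall>\<omega>\<in>space P. \<forall>s\<ge>0.
    \<bar>riemann_sum t (N k) (\<mu> (est k \<omega>) - \<mu> \<theta>0) (Z \<omega>)\<bar> \<le> norm (est k \<omega> - \<theta>0) * s \<longrightarrow>
    norm (scaled_error k \<omega>) \<le> C * (1 + s)"
    by (rule scaled_error_rate)
  obtain c where c: "0 \<le> c" "\<And>n m. 1 \<le> n \<Longrightarrow> integrable P (\<lambda>\<omega>. \<bar>riemann_sum t n m (Z \<omega>)\<bar> ^ R)"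
    "\<And>n m. 1 \<le> n \<Longrightarrow> expectation (\<lambda>\<omega>. \<bar>riemann_sum t n m (Z \<omega>)\<bar> ^ R) \<le> c * norm m ^ R"
    using riemann_sum_moments[of R] by metis
  obtain B where B: "0 \<le> B" "\<And>i x. x \<in> interior \<Theta> \<Longrightarrow> norm (partial i \<mu> x) \<le> B"
    using partial_bounded by metis
  obtain L where L: "0 \<le> L" "\<And>i x y. x \<in> interior \<Theta> \<Longrightarrow> y \<in> interior \<Theta> \<Longrightarrow>
    norm (partial i \<mu> x - partial i \<mu> y) \<le> L * norm (x - y)"
    using partial_lipschitz by metis
  have mom: "(\<integral>\<^sup>+\<omega>. ennreal (\<bar>riemann_sum t n m (Z \<omega>)\<bar> ^ R) \<partial>P) \<le> ennreal (c * norm m ^ R)" if "1 \<le> n" for n m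
    using nn_integral_eq_integral[OF c(2)[OF that]] c(3)[OF that] by (simp add: ennreal_leI)
  have bdd: "bounded (interior \<Theta>)"
    by (rule bounded_subset[OF compact_imp_bounded[OF compact] interior_subset])
  obtain C' where C': "0 \<le> C'" and chain: "\<forall>W b. 0 \<le> b \<longrightarrow> (\<forall>a\<in>interior \<Theta>. W a \<in> borel_measurable P) \<longrightarrow>
    (\<forall>\<omega>\<in>space P. continuous_on (interior \<Theta>) (\<lambda>a. W a \<omega>)) \<longrightarrow>
    (\<forall>a\<in>interior \<Theta>. (\<integral>\<^sup>+\<omega>. ennreal (\<bar>W a \<omega>\<bar> ^ R) \<partial>P) \<le> ennreal b) \<longrightarrow>
    (\<forall>a\<in>interior \<Theta>. \<forall>a'\<in>interior \<Theta>.
      (\<integral>\<^sup>+\<omega>. ennreal (\<bar>W a \<omega> - W a' \<omega>\<bar> ^ R) \<partial>P) \<le> ennreal (b * norm (a - a') ^ R)) \<longrightarrow>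
    (\<exists>U\<in>borel_measurable P. (\<integral>\<^sup>+\<omega>. U \<omega> \<partial>P) \<le> ennreal (C' * b) \<and>
      (\<forall>\<omega>\<in>space P. \<forall>a\<in>interior \<Theta>. ennreal (\<bar>W a \<omega>\<bar> ^ R) \<le> U \<omega>))"
    using chaining[OF bdd R, of P] by (elim exE conjE)
  define b where "b = c * (B ^ R + L ^ R)"
  have b: "0 \<le> b" using c B L by (simp add: b_def)
  have sup: "\<exists>U\<in>borel_measurable P. (\<integral>\<^sup>+\<omega>. U \<omega> \<partial>P) \<le> ennreal (C' * b) \<and>
      (\<forall>\<omega>\<in>space P. \<forall>a\<in>interior \<Theta>. ennreal (\<bar>riemann_sum t (N k) (partial i \<mu> a) (Z \<omega>)\<bar> ^ R) \<le> U \<omega>)" for k i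
  proof (rule chain[rule_format, OF b])
    show "(\<lambda>\<omega>. riemann_sum t (N k) (partial i \<mu> a) (Z \<omega>)) \<in> borel_measurable P" for a
      using riemann_sum_centered_normal[OF N1] by (simp add: centered_normal_def)
    show "continuous_on (interior \<Theta>) (\<lambda>a. riemann_sum t (N k) (partial i \<mu> a) (Z \<omega>))" for \<omega>
      by (intro bounded_linear.continuous_on[OF bounded_linear_riemann_sum] continuous_at_imp_continuous_on ballI
          differentiable_imp_continuous_within partial_differentiable)
    fix a assume a: "a \<in> interior \<Theta>"
    have "c * norm (partial i \<mu> a) ^ R \<le> c * (B ^ R + L ^ R)"
      using c(1) L(1) power_mono[OF B(2)[OF a, of i], of R] by (intro mult_left_mono) (auto intro: add_increasing2)
    then show "(\<integral>\<^sup>+\<omega>. ennreal (\<bar>riemann_sum t (N k) (partial i \<mu> a) (Z \<omega>)\<bar> ^ R) \<partial>P) \<le> ennreal b"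
      unfolding b_def by (intro order_trans[OF mom[OF N1]] ennreal_leI)
    fix a' assume a': "a' \<in> interior \<Theta>"
    have "norm (partial i \<mu> a - partial i \<mu> a') ^ R \<le> (L * norm (a - a')) ^ R"
      by (intro power_mono L(2) a a') simp
    also have "\<dots> \<le> (B ^ R + L ^ R) * norm (a - a') ^ R"
      using B(1) by (simp add: power_mult_distrib mult_right_mono)
    finally have "c * norm (partial i \<mu> a - partial i \<mu> a') ^ R \<le> b * norm (a - a') ^ R"
      using c(1) by (simp add: b_def mult_left_mono mult.assoc)
    then show "(\<integral>\<^sup>+\<omega>. ennreal (\<bar>riemann_sum t (N k) (partial i \<mu> a) (Z \<omega>) - riemann_sum t (N k) (partial i \<mu> a') (Z \<omega>)\<bar> ^ R) \<partial>P)
        \<le> ennreal (b * norm (a - a') ^ R)"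
      unfolding riemann_sum_diff[symmetric] by (intro order_trans[OF mom[OF N1]] ennreal_leI)
  qed
  let ?p = "real CARD('p)"
  define D where "D = C ^ R * 2 ^ R * (1 + ?p ^ R * (?p * (C' * b)))"
  have "\<forall>\<^sub>F k in sequentially. (\<integral>\<^sup>+\<omega>. ennreal (norm (scaled_error k \<omega>) ^ R) \<partial>P) \<le> ennreal D"
    using C(2)
  proof eventually_elim
    case (elim k)
    obtain U where U: "\<And>i. U i \<in> borel_measurable P" "\<And>i. (\<integral>\<^sup>+\<omega>. U i \<omega> \<partial>P) \<le> ennreal (C' * b)"
      "\<And>i \<omega> a. \<omega> \<in> space P \<Longrightarrow> a \<in> interior \<Theta> \<Longrightarrow> ennreal (\<bar>riemann_sum t (N k) (partial i \<mu> a) (Z \<omega>)\<bar> ^ R) \<le> U i \<omega>"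
      using sup[of k] by metis
    have "ennreal (norm (scaled_error k \<omega>) ^ R) \<le> ennreal (C ^ R * 2 ^ R) * (1 + ennreal (?p ^ R) * (\<Sum>i\<in>UNIV. U i \<omega>))"
      if \<omega>: "\<omega> \<in> space P" for \<omega>
    proof -
      obtain \<xi> where \<xi>: "\<xi> \<in> interior \<Theta>"
        "riemann_sum t (N k) (\<mu> (est k \<omega>) - \<mu> \<theta>0) (Z \<omega>)
          = (\<Sum>i\<in>UNIV. (est k \<omega> - \<theta>0) $ i * riemann_sum t (N k) (partial i \<mu> \<xi>) (Z \<omega>))"
        using linear_mean_value[OF convex est_mem[OF \<omega>] inner cont differentiable bounded_linear_riemann_sum[of t "N k" "Z \<omega>"]] by blast
      define s where "s i = \<bar>riemann_sum t (N k) (partial i \<mu> \<xi>) (Z \<omega>)\<bar>" for i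
      have s: "0 \<le> s i" for i by (simp add: s_def)
      have "\<bar>riemann_sum t (N k) (\<mu> (est k \<omega>) - \<mu> \<theta>0) (Z \<omega>)\<bar> \<le> (\<Sum>i\<in>UNIV. norm (est k \<omega> - \<theta>0) * s i)"
        unfolding \<xi>(2) s_def
        by (intro order_trans[OF sum_abs] sum_mono, simp only: abs_mult)
          (intro mult_right_mono component_le_norm_cart abs_ge_zero)
      then have "norm (scaled_error k \<omega>) \<le> C * (1 + (\<Sum>i\<in>UNIV. s i))"
        using elim \<omega> s by (simp add: sum_distrib_left sum_nonneg)
      then have "norm (scaled_error k \<omega>) ^ R \<le> (C * (1 + (\<Sum>i\<in>UNIV. s i))) ^ R" by (intro power_mono) auto
      also have "\<dots> = C ^ R * (1 + (\<Sum>i\<in>UNIV. s i)) ^ R" by (rule power_mult_distrib)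
      also have "\<dots> \<le> C ^ R * (2 ^ R * (1 ^ R + (\<Sum>i\<in>UNIV. s i) ^ R))"
        using C(1) s by (intro mult_left_mono add_power_le) (auto intro: sum_nonneg)
      also have "\<dots> \<le> C ^ R * (2 ^ R * (1 ^ R + ?p ^ R * (\<Sum>i\<in>UNIV. s i ^ R)))"
        using C(1) s by (intro mult_left_mono add_left_mono sum_power_le) auto
      also have "\<dots> = C ^ R * 2 ^ R * (1 + ?p ^ R * (\<Sum>i\<in>UNIV. s i ^ R))" by simp
      finally have "ennreal (norm (scaled_error k \<omega>) ^ R) \<le> ennreal (C ^ R * 2 ^ R * (1 + ?p ^ R * (\<Sum>i\<in>UNIV. s i ^ R)))"
        by (rule ennreal_leI)
      also have "\<dots> = ennreal (C ^ R * 2 ^ R) * (1 + ennreal (?p ^ R) * (\<Sum>i\<in>UNIV. ennreal (s i ^ R)))"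
      proof -
        have "0 \<le> (\<Sum>i\<in>UNIV. s i ^ R)" using s by (simp add: sum_nonneg)
        then show ?thesis
          using C(1) s by (subst ennreal_mult) (simp_all add: ennreal_plus ennreal_mult sum_ennreal del: sum_ennreal add: sum_ennreal[symmetric])
      qed
      also have "\<dots> \<le> ennreal (C ^ R * 2 ^ R) * (1 + ennreal (?p ^ R) * (\<Sum>i\<in>UNIV. U i \<omega>))"
        unfolding s_def by (intro mult_left_mono add_left_mono sum_mono U(3) \<omega> \<xi>(1)) auto
      finally show ?thesis .
    qed
    then have "(\<integral>\<^sup>+\<omega>. ennreal (norm (scaled_error k \<omega>) ^ R) \<partial>P)
        \<le> (\<integral>\<^sup>+\<omega>. ennreal (C ^ R * 2 ^ R) * (1 + ennreal (?p ^ R) * (\<Sum>i\<in>UNIV. U i \<omega>)) \<partial>P)"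
      by (rule nn_integral_mono)
    also have "\<dots> = ennreal (C ^ R * 2 ^ R) * (1 + ennreal (?p ^ R) * (\<Sum>i\<in>UNIV. \<integral>\<^sup>+\<omega>. U i \<omega> \<partial>P))"
      using U(1) by (simp add: nn_integral_cmult nn_integral_add nn_integral_sum emeasure_space_1)
    also have "\<dots> \<le> ennreal (C ^ R * 2 ^ R) * (1 + ennreal (?p ^ R) * (\<Sum>i\<in>(UNIV :: 'p set). ennreal (C' * b)))"
      by (intro mult_left_mono add_left_mono sum_mono U(2)) auto
    also have "\<dots> = ennreal D"
    proof -
      have "(\<Sum>i\<in>(UNIV :: 'p set). ennreal (C' * b)) = ennreal (?p * (C' * b))"
        using C' b by (subst sum_ennreal) auto
      then show ?thesis
        using C(1) C' b unfolding D_def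
        by (subst ennreal_mult) (simp_all add: ennreal_plus ennreal_mult)
    qed
    finally show ?case .
  qed
  then show thesis by (rule that)
qed

end

context contrast_asymptotics
begin

lemma score_measurable: "score \<in> borel_measurable P"
proof -
  have "(\<lambda>\<omega>. score \<omega> $ i) \<in> borel_measurable P" for i
    using pairing_centered_normal[OF partial_carried[of i]] by (simp add: centered_normal_def score_def)
  then show ?thesis
    by (subst borel_measurable_euclidean_space) (auto simp: Basis_vec_def inner_axis)
qed

lemma score_moments:
  obtains C where "0 \<le> C" "(\<integral>\<^sup>+\<omega>. ennreal (norm (score \<omega>) ^ R) \<partial>P) \<le> ennreal C"
proof -
  let ?p = "real CARD('p)"
  have i: "integrable P (\<lambda>\<omega>. \<bar>score \<omega> $ i\<bar> ^ R)" for i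
    using centered_normal_moments[of R] pairing_centered_normal[OF partial_carried[of i]]
    unfolding score_def vec_lambda_beta by metis
  define C where "C = expectation (\<lambda>\<omega>. ?p ^ R * (\<Sum>i\<in>UNIV. \<bar>score \<omega> $ i\<bar> ^ R))"
  have "norm (score \<omega>) ^ R \<le> ?p ^ R * (\<Sum>i\<in>UNIV. \<bar>score \<omega> $ i\<bar> ^ R)" for \<omega>
  proof -
    have "norm (score \<omega>) ^ R \<le> (\<Sum>i\<in>UNIV. \<bar>score \<omega> $ i\<bar>) ^ R"
      by (intro power_mono norm_le_l1_cart) auto
    also have "\<dots> \<le> ?p ^ R * (\<Sum>i\<in>UNIV. \<bar>score \<omega> $ i\<bar> ^ R)" by (rule sum_power_le) auto
    finally show ?thesis .
  qed
  then have "(\<integral>\<^sup>+\<omega>. ennreal (norm (score \<omega>) ^ R) \<partial>P) \<le> (\<integral>\<^sup>+\<omega>. ennreal (?p ^ R * (\<Sum>i\<in>UNIV. \<bar>score \<omega> $ i\<bar> ^ R)) \<partial>P)"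
    by (intro nn_integral_mono ennreal_leI)
  also have "\<dots> = ennreal C"
    unfolding C_def by (rule nn_integral_eq_integral) (auto intro!: i AE_I2 mult_nonneg_nonneg sum_nonneg)
  finally have "(\<integral>\<^sup>+\<omega>. ennreal (norm (score \<omega>) ^ R) \<partial>P) \<le> ennreal C" .
  moreover have "0 \<le> C" unfolding C_def by (rule integral_nonneg_AE) (intro AE_I2 mult_nonneg_nonneg sum_nonneg; simp)
  ultimately show thesis using that by blast
qed

lemma moments_scale:
  assumes le: "\<And>\<omega>. \<omega> \<in> space P \<Longrightarrow> norm (f \<omega>) \<le> L * norm (g \<omega>)" and L: "0 \<le> L"
    and g: "(\<integral>\<^sup>+\<omega>. ennreal (norm (g \<omega>) ^ R) \<partial>P) \<le> ennreal C" "g \<in> borel_measurable P"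
  shows "(\<integral>\<^sup>+\<omega>. ennreal (norm (f \<omega>) ^ R) \<partial>P) \<le> ennreal (L ^ R * max C 0)"
proof -
  have "(\<integral>\<^sup>+\<omega>. ennreal (norm (f \<omega>) ^ R) \<partial>P) \<le> (\<integral>\<^sup>+\<omega>. ennreal (L ^ R) * ennreal (norm (g \<omega>) ^ R) \<partial>P)"
  proof (rule nn_integral_mono)
    fix \<omega> assume \<omega>: "\<omega> \<in> space P"
    have "norm (f \<omega>) ^ R \<le> L ^ R * norm (g \<omega>) ^ R"
      using power_mono[OF le[OF \<omega>], of R] by (simp add: power_mult_distrib)
    then show "ennreal (norm (f \<omega>) ^ R) \<le> ennreal (L ^ R) * ennreal (norm (g \<omega>) ^ R)"
      using L by (simp add: ennreal_leI flip: ennreal_mult)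
  qed
  also have "\<dots> = ennreal (L ^ R) * (\<integral>\<^sup>+\<omega>. ennreal (norm (g \<omega>) ^ R) \<partial>P)"
    by (rule nn_integral_cmult) (use measurable_compose[OF g(2) borel_measurable_norm] in measurable)
  also have "\<dots> \<le> ennreal (L ^ R) * ennreal (max C 0)"
    by (intro mult_left_mono order_trans[OF g(1)] ennreal_leI) auto
  also have "\<dots> = ennreal (L ^ R * max C 0)" using L by (subst ennreal_mult) auto
  finally show ?thesis .
qed

lemma Lq_limits:
  assumes q: "1 \<le> q"
  shows "tendsto_Lq P q scaled_error (\<lambda>\<omega>. matrix_inv fisher *v score \<omega>)"
    and "tendsto_Lq P q (\<lambda>k \<omega>. (1 / \<epsilon> k) *\<^sub>R (\<mu> (est k \<omega>) - \<mu> \<theta>0)) (\<lambda>\<omega>. tangent (matrix_inv fisher *v score \<omega>))"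
proof -
  \<comment> \<open>large enough both for chaining and for uniform integrability at order \<open>q\<close>\<close>
  define R where "R = nat \<lceil>q\<rceil> + 1 + (4 * CARD('p) + 1)"
  have R: "4 * CARD('p) < R" "q + 1 \<le> real R"
    using q by (simp_all add: R_def) linarith
  obtain C1 where C1: "\<forall>\<^sub>F k in sequentially. (\<integral>\<^sup>+\<omega>. ennreal (norm (scaled_error k \<omega>) ^ R) \<partial>P) \<le> ennreal C1"
    by (rule scaled_error_moments[OF R(1)])
  obtain C2 where C2: "0 \<le> C2" "(\<integral>\<^sup>+\<omega>. ennreal (norm (score \<omega>) ^ R) \<partial>P) \<le> ennreal C2"
    by (rule score_moments)
  have u: "scaled_error k \<in> borel_measurable P" for k
    unfolding scaled_error_def[abs_def] using est_measurable by measurable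
  have main: "tendsto_Lq P q (\<lambda>k \<omega>. G k (est k \<omega>)) (\<lambda>\<omega>. H (score \<omega>))"
    if G: "\<And>k. continuous_on \<Theta> (G k)" and H: "bounded_linear H"
      and lim: "\<And>\<omega>. \<omega> \<in> space P \<Longrightarrow> (\<lambda>k. G k (est k \<omega>)) \<longlonglongrightarrow> H (score \<omega>)"
      and L: "0 \<le> L" "\<And>k \<omega>. \<omega> \<in> space P \<Longrightarrow> norm (G k (est k \<omega>)) \<le> L * norm (scaled_error k \<omega>)"
    for G :: "nat \<Rightarrow> real ^ 'p \<Rightarrow> 'c::real_normed_vector" and H L
  proof -
    obtain l where l: "0 \<le> l" "\<And>v. norm (H v) \<le> norm v * l"
      using bounded_linear.nonneg_bounded[OF H] by metis
    have lr: "norm (H v) \<le> l * norm v" for v using l(2)[of v] by (simp add: mult.commute)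
    let ?C = "max (L ^ R * max C1 0) (l ^ R * max C2 0)"
    show ?thesis
    proof (rule tendsto_Lq_compose[OF compact est_measurable est_mem score_measurable G _ lim q R(2), where C = ?C])
      show "continuous_on UNIV H" by (rule linear_continuous_on[OF H])
      show "\<forall>\<^sub>F k in sequentially. (\<integral>\<^sup>+\<omega>. ennreal (norm (G k (est k \<omega>)) ^ R) \<partial>P) \<le> ennreal ?C"
        using C1
      proof eventually_elim
        case (elim k)
        show ?case
          by (rule order_trans[OF moments_scale[OF L(2) L(1) elim u] ennreal_leI[OF max.cobounded1]])
      qed
      show "(\<integral>\<^sup>+\<omega>. ennreal (norm (H (score \<omega>)) ^ R) \<partial>P) \<le> ennreal ?C"
        by (rule order_trans[OF moments_scale[OF lr l(1) C2(2) score_measurable] ennreal_leI[OF max.cobounded2]])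
    qed
  qed
  let ?V = "\<lambda>v. matrix_inv fisher *v v"
  have "tendsto_Lq P q (\<lambda>k \<omega>. (1 / \<epsilon> k) *\<^sub>R (est k \<omega> - \<theta>0)) (\<lambda>\<omega>. ?V (score \<omega>))"
    by (rule main[OF _ _ _ zero_le_one])
      (use pathwise_limits(1) in \<open>auto intro!: continuous_intros matrix_vector_mul_bounded_linear simp: scaled_error_def\<close>)
  then show "tendsto_Lq P q scaled_error (\<lambda>\<omega>. matrix_inv fisher *v score \<omega>)"
    by (simp add: scaled_error_def[abs_def])
  obtain L where L: "0 \<le> L" "\<And>\<theta>. \<theta> \<in> \<Theta> \<Longrightarrow> norm (\<mu> \<theta> - \<mu> \<theta>0) \<le> L * norm (\<theta> - \<theta>0)"
    using lipschitz by metis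
  show "tendsto_Lq P q (\<lambda>k \<omega>. (1 / \<epsilon> k) *\<^sub>R (\<mu> (est k \<omega>) - \<mu> \<theta>0)) (\<lambda>\<omega>. tangent (?V (score \<omega>)))"
  proof (rule main[OF _ _ _ L(1)])
    show "continuous_on \<Theta> (\<lambda>\<theta>. (1 / \<epsilon> k) *\<^sub>R (\<mu> \<theta> - \<mu> \<theta>0))" for k
      by (intro continuous_intros cont)
    show "bounded_linear (\<lambda>v. tangent (?V v))"
      by (rule bounded_linear_compose[OF bounded_linear_tangent matrix_vector_mul_bounded_linear])
    show "norm ((1 / \<epsilon> k) *\<^sub>R (\<mu> (est k \<omega>) - \<mu> \<theta>0)) \<le> L * norm (scaled_error k \<omega>)" if "\<omega> \<in> space P" for k \<omega>
      using L(2)[OF est_mem[OF that], of k] noise_pos[of k] by (simp add: scaled_error_def divide_right_mono)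
  qed (use pathwise_limits(2) in auto)
qed

end

theorem theorem3p35:
  fixes P :: "'w measure"
    and Z :: "'w \<Rightarrow> real \<Rightarrow> real"
    and \<tau> q :: real
    and t :: "nat \<Rightarrow> nat \<Rightarrow> real"
    and \<Theta> :: "(real ^ 'p) set"
    and \<theta>\<^sub>0 :: "real ^ 'p"
    and \<mu> :: "real ^ 'p \<Rightarrow> signed_measure"
    and \<theta>hat :: "nat \<Rightarrow> real \<Rightarrow> 'w \<Rightarrow> real ^ 'p"
    and \<epsilon> :: "nat \<Rightarrow> real"
    and N :: "nat \<Rightarrow> nat"
  defines "K \<equiv> cov_kernel P Z"
  defines "X \<equiv> observation \<tau> K (\<mu> \<theta>\<^sub>0) Z"
  defines "\<Sigma> \<equiv> fisher_matrix \<tau> K \<mu> \<theta>\<^sub>0"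
  defines "V \<equiv> \<lambda>\<omega>. matrix_inv \<Sigma> *v (\<chi> i. pairing {0..\<tau>} (partial i \<mu> \<theta>\<^sub>0) (Z \<omega>))"
  assumes "prob_space P"
    and "0 < \<tau>"
    and "centered_gaussian_vector P \<tau> Z"
    and "partition_points \<tau> t"
    and "compact \<Theta>" and "convex \<Theta>" and "smooth_boundary \<Theta>"
    and "\<theta>\<^sub>0 \<in> interior \<Theta>"
    and "\<forall>\<theta>\<in>\<Theta>. \<mu> \<theta> \<in> measures_on {0..\<tau>}"
    and "continuous_on \<Theta> \<mu>"
    and "C_class 2 \<Theta> \<mu>" and "C_class 3 \<Theta> \<mu>"
    and "\<forall>\<theta>\<in>\<Theta>. (\<forall>s\<in>{0..\<tau>}. cov_operator \<tau> K (\<mu> \<theta>) s = cov_operator \<tau> K (\<mu> \<theta>\<^sub>0) s) \<longrightarrow> \<theta> = \<theta>\<^sub>0"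
    and "invertible \<Sigma>"
    and "\<forall>n\<ge>1. \<forall>e>0. \<theta>hat n e \<in> borel_measurable P \<and>
          (\<forall>\<omega>\<in>space P. \<theta>hat n e \<omega> \<in> \<Theta> \<and>
            (\<forall>\<theta>\<in>\<Theta>. contrast t K \<mu> n (X e \<omega>) \<theta> \<le> contrast t K \<mu> n (X e \<omega>) (\<theta>hat n e \<omega>)))"
    and "\<forall>k. 0 < \<epsilon> k" and "\<epsilon> \<longlonglongrightarrow> 0"
    and "\<forall>k. 1 \<le> N k" and "filterlim N at_top sequentially"
    and "(\<lambda>k. ereal (1 / \<epsilon> k) * Linfty_norm {0..\<tau>} (\<lambda>r s. step_kernel t K (N k) r s - K r s)) \<longlonglongrightarrow> 0"
    and "1 \<le> q"
  shows "tendsto_Lq P q (\<lambda>k \<omega>. (1 / \<epsilon> k) *\<^sub>R (\<theta>hat (N k) (\<epsilon> k) \<omega> - \<theta>\<^sub>0)) V \<and>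
         tendsto_Lq P q (\<lambda>k \<omega>. (1 / \<epsilon> k) *\<^sub>R (\<mu> (\<theta>hat (N k) (\<epsilon> k) \<omega>) - \<mu> \<theta>\<^sub>0))
           (\<lambda>\<omega>. \<Sum>i\<in>UNIV. (V \<omega> $ i) *\<^sub>R partial i \<mu> \<theta>\<^sub>0)"
proof -
  interpret prob_space P by fact
  interpret contrast_estimation P \<tau> t Z \<Theta> \<theta>\<^sub>0 \<mu>
    using assms unfolding K_def \<Sigma>_def by unfold_locales auto
  let ?l = "\<lambda>k. Linfty_norm {0..\<tau>} (\<lambda>r s. step_kernel t K (N k) r s - K r s)"
  \<comment> \<open>the norm may be infinite for finitely many \<open>k\<close>, where \<open>\<delta> k\<close> is 0 by default\<close>
  define \<delta> where "\<delta> k = real_of_ereal (?l k)" for k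
  have lim: "(\<lambda>k. ereal (1 / \<epsilon> k) * ?l k) \<longlonglongrightarrow> ereal 0"
    using assms by (simp add: zero_ereal_def)
  have pos: "0 < \<epsilon> k" "1 \<le> N k" for k using assms by auto
  have "(\<lambda>k. real_of_ereal (ereal (1 / \<epsilon> k) * ?l k)) \<longlonglongrightarrow> 0"
    by (rule lim_real_of_ereal[OF lim])
  then have ratio: "(\<lambda>k. \<delta> k / \<epsilon> k) \<longlonglongrightarrow> 0"
    by (simp add: \<delta>_def)
  have "\<forall>\<^sub>F k in sequentially. ereal (1 / \<epsilon> k) * ?l k < \<infinity>" "\<forall>\<^sub>F k in sequentially. - \<infinity> < ereal (1 / \<epsilon> k) * ?l k"
    by (rule order_tendstoD[OF lim], simp)+
  then have close: "\<forall>\<^sub>F k in sequentially. kernel_close t K (N k) (\<delta> k)"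
  proof eventually_elim
    case (elim k)
    then have "?l k = ereal (\<delta> k)"
      using pos(1)[of k] by (cases "?l k") (auto simp: \<delta>_def)
    then show ?case
      using kernel_close_Linfty[OF pos(2), of k] by (simp add: K_def)
  qed
  interpret contrast_asymptotics P \<tau> t Z \<Theta> \<theta>\<^sub>0 \<mu> \<epsilon> \<delta> N "\<lambda>k. \<theta>hat (N k) (\<epsilon> k)"
    using assms ratio close pos unfolding K_def X_def by unfold_locales (auto simp: maximizer_def)
  have V: "V \<omega> = matrix_inv fisher *v score \<omega>" for \<omega>
    by (simp add: V_def \<Sigma>_def K_def score_def)
  show ?thesis
    using Lq_limits[OF \<open>1 \<le> q\<close>] unfolding V tangent_def scaled_error_def[abs_def] by blast
qed

end
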